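(* For every $\mu\in\mathcal{P}^1(\mathbb{P}_m)$ and every real $t\ge 1$, $$G(\mu^{t})\underset{\log}{\prec}G(\mu)^{t}.$$ In particular, for any unitarily invariant norm $|||\cdot|||$ on $m\times m$ complex matrices, $$|||G(\mu^{t})|||\le |||G(\mu)^{t}|||,\qquad t\ge 1.$$
   Context: $\mathbb{P}_m$ is the set of $m\times m$ (complex Hermitian) positive definite matrices, with the Riemannian trace metric $d(A,B)=\|\log A^{-1/2}BA^{-1/2}\|_2$, where $\|X\|_2=(\operatorname{tr}X^2)^{1/2}$ for Hermitian $X$; its topology coincides with the Euclidean one. $\mathcal{P}^1(\mathbb{P}_m)$ is the set of Borel probability measures $\mu$ on $\mathbb{P}_m$ with $\int d(X,Y)\,d\mu(X)<\infty$ for some (equivalently, all) $Y\in\mathbb{P}_m$. Cartan barycenter: for $\mu\in\mathcal{P}^1(\mathbb{P}_m)$, $G(\mu)$ is the unique minimizer over $Z\in\mathbb{P}_m$ of $\int_{\mathbb{P}_m}[d^2(Z,X)-d^2(Y,X)]\,d\mu(X)$, where $Y\in\mathbb{P}_m$ is fixed; the minimizer exists, is unique, and does not depend on $Y$. Power of a measure: for $t\in\mathbb{R}\setminus\{0\}$, $\mu^t$ is the push-forward of $\mu$ under $X\mapsto X^t$; $\mu^t\in\mathcal{P}^1(\mathbb{P}_m)$ whenever $\mu\in\mathcal{P}^1(\mathbb{P}_m)$. Log-majorization: for $A\in\mathbb{P}_m$ let $\lambda_1(A)\ge\cdots\ge\lambda_m(A)$ be its eigenvalues with multiplicity. For $A,B\in\mathbb{P}_m$,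 $A\underset{\log}{\prec}B$ means $\prod_{i=1}^k\lambda_i(A)\le\prod_{i=1}^k\lambda_i(B)$ for $1\le k\le m-1$ and $\det A=\det B$. A norm $|||\cdot|||$ on $m\times m$ complex matrices is unitarily invariant if $|||UXV|||=|||X|||$ for all $X$ and all unitary $U,V$. *)

theory Defs
  imports
    "HOL-Probability.Probability"
    "HOL-Computational_Algebra.Computational_Algebra"
begin

(* An m x m complex matrix has type complex^'n^'n with m = CARD('n). *)

definition ctranspose :: "complex^'n^'m \<Rightarrow> complex^'m^'n" where
  "ctranspose A = (\<chi> i j. cnj (A $ j $ i))"

definition unitary :: "complex^'n^'n \<Rightarrow> bool" where
  "unitary U \<longleftrightarrow> ctranspose U ** U = mat 1 \<and> U ** ctranspose U = mat 1"

definition hermitian :: "complex^'n^'n \<Rightarrow> bool" where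
  "hermitian A \<longleftrightarrow> ctranspose A = A"

definition posdef :: "(complex^'n^'n) set" where
  "posdef = {A. hermitian A \<and>
     (\<forall>x. x \<noteq> 0 \<longrightarrow> 0 < Re (\<Sum>i\<in>UNIV. cnj (x $ i) * (A *v x) $ i))}"

definition real_diag :: "('n \<Rightarrow> real) \<Rightarrow> complex^'n^'n" where
  "real_diag d = (\<chi> i j. if i = j then complex_of_real (d i) else 0)"

(* Functional calculus for Hermitian A.  By the spectral theorem a unitary
   diagonalization exists, and the resulting B does not depend on its choice. *)
definition herm_fun :: "(real \<Rightarrow> real) \<Rightarrow> complex^'n^'n \<Rightarrow> complex^'n^'n" where
  "herm_fun f A = (THE B. \<exists>U d. unitary U \<and>
     A = U ** real_diag d ** ctranspose U \<and>
     B = U ** real_diag (f \<circ> d) ** ctranspose U)"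

definition mat_powr :: "complex^'n^'n \<Rightarrow> real \<Rightarrow> complex^'n^'n" where
  "mat_powr A t = herm_fun (\<lambda>x. x powr t) A"

definition mat_ln :: "complex^'n^'n \<Rightarrow> complex^'n^'n" where
  "mat_ln A = herm_fun ln A"

(* For Hermitian X the trace of X ** X is a nonnegative real; Re only changes the type. *)
definition norm2 :: "complex^'n^'n \<Rightarrow> real" where
  "norm2 X = sqrt (Re (trace (X ** X)))"

definition trace_dist :: "complex^'n^'n \<Rightarrow> complex^'n^'n \<Rightarrow> real" where
  "trace_dist A B = norm2 (mat_ln (mat_powr A (-1/2) ** B ** mat_powr A (-1/2)))"

(* Borel sigma-algebra of posdef; its Euclidean topology is that of trace_dist. *)
definition posdef_borel :: "(complex^'n^'n) measure" where
  "posdef_borel = restrict_space borel posdef"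

definition prob1 :: "(complex^'n^'n) measure set" where
  "prob1 = {\<mu>. prob_space \<mu> \<and> sets \<mu> = sets posdef_borel \<and>
     (\<exists>Y\<in>posdef. integrable \<mu> (\<lambda>X. trace_dist X Y))}"

(* For measures in prob1 the minimizer exists, is unique, and is the same for every
   base point Y, so quantifying over Y here amounts to fixing any one Y in posdef. *)
definition cartan_barycenter :: "(complex^'n^'n) measure \<Rightarrow> complex^'n^'n" where
  "cartan_barycenter \<mu> = (THE Z. \<forall>Y\<in>posdef.
     is_arg_min (\<lambda>Z. \<integral>X. (trace_dist Z X)\<^sup>2 - (trace_dist Y X)\<^sup>2 \<partial>\<mu>)
       (\<lambda>Z. Z \<in> posdef) Z)"

definition measure_powr :: "(complex^'n^'n) measure \<Rightarrow> real \<Rightarrow> (complex^'n^'n) measure" where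
  "measure_powr \<mu> t = distr \<mu> posdef_borel (\<lambda>X. mat_powr X t)"

definition charpoly :: "complex^'n^'n \<Rightarrow> complex poly" where
  "charpoly A = det (\<chi> i j. (if i = j then [:0, 1:] else 0) - [:A $ i $ j:])"

(* For Hermitian A: all eigenvalues (which are real) with multiplicity, in decreasing order. *)
definition eigenvalue_list :: "complex^'n^'n \<Rightarrow> real list" where
  "eigenvalue_list A = rev (sorted_list_of_multiset (image_mset Re (proots (charpoly A))))"

(* The k-th largest eigenvalue, indexed from k = 1. *)
definition eigenvalue :: "nat \<Rightarrow> complex^'n^'n \<Rightarrow> real" where
  "eigenvalue k A = eigenvalue_list A ! (k - 1)"

definition log_majorized :: "complex^'n^'n \<Rightarrow> complex^'n^'n \<Rightarrow> bool" where
  "log_majorized A B \<longleftrightarrow> A \<in> posdef \<and> B \<in> posdef \<and>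
     (\<forall>k\<in>{1..CARD('n) - 1}. (\<Prod>i=1..k. eigenvalue i A) \<le> (\<Prod>i=1..k. eigenvalue i B)) \<and>
     det A = det B"

definition unitarily_invariant_norm :: "(complex^'n^'n \<Rightarrow> real) \<Rightarrow> bool" where
  "unitarily_invariant_norm N \<longleftrightarrow>
     (\<forall>X. N X = 0 \<longleftrightarrow> X = 0) \<and>
     (\<forall>X Y. N (X + Y) \<le> N X + N Y) \<and>
     (\<forall>c X. N (map_matrix ((*) c) X) = cmod c * N X) \<and>
     (\<forall>U V X. unitary U \<and> unitary V \<longrightarrow> N (U ** X ** V) = N X)"

end

(*
  The barycenter G of mu is the unique solution of the Karcher equation
  "integral of log (G^(-1/2) X G^(-1/2)) d mu = 0": a solution exists by Brouwer's theorem, and the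
  exponential metric increasing property d(Z, A) >= |log A - log Z| shows that any solution
  is the unique minimizer of the variance functional.

  The key inequality: if W <= lambda and W v = lambda v, then
  <v, log (W^(-1/2) B W^(-1/2)) v> <= <v, log B v> - log lambda |v|^2.  Applied at the extreme
  eigenvectors it gives a boundary condition for Brouwer's theorem and the monotonicity of the gradient of
  d^2(., A) along geodesics, hence the metric inequality.  Together with Hansen's inequality
  C A^t C <= (C A C)^t (C >= 1, 1 <= t <= 2) it gives the Ando-Hiai inequality:
  G(mu) <= 1 implies G(mu^t) <= 1.  This is applied in the antisymmetric tensor
  powers, where it compares products of the k largest eigenvalues; iteration gives every t >= 1.
  The norm inequality follows because a log-majorized vector is in the convex hull of the signed
  permutations of the majorizing one.
*)
theory Submission
  imports Defs
begin

text \<open>Logarithms are compared through the resolvents (A + s)^(-1) at a single vector, so that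
  information about one extreme eigenvector is enough; neither an integral representation nor a
  derivative of the matrix logarithm is formed. Hansen's inequality confines one step to 1 \<le> t
  \<le> 2, because x^t is operator convex for no t > 2. The exterior power of order k has dimension
  n choose k, which no index type built from 'n alone can follow while k varies. It is therefore
  realized inside the space of all tensors indexed by functions from 'n to 'n: identity factors
  outside a set S of size k, and the identity operator off the antisymmetric tensors, so that
  products, adjoints, powers and positivity survive. The bound of the Ando-Hiai step is the constant
  1, since 1 is exactly the value that the extended operator has off the antisymmetric tensors; a
  bound p on products of k eigenvalues is brought to this form by scaling with c, where c^k =
  1/p.\<close>

unbundle no fps_syntax

text \<open>The real inner product is the real part of the complex one, so for Hermitian A this is
  the full Hermitian form, and the Loewner order is the pointwise order of these functions.\<close>

abbreviation qf :: "complex^'n^'n \<Rightarrow> complex^'n \<Rightarrow> real" where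
  "qf A x \<equiv> x \<bullet> (A *v x)"

text \<open>The congruence that carries Z to the identity; the norm of its logarithm is the distance
  from Z to X.\<close>

abbreviation whiten :: "complex^'n^'n \<Rightarrow> complex^'n^'n \<Rightarrow> complex^'n^'n" where
  "whiten Z X \<equiv> mat_powr Z (-1/2) ** X ** mat_powr Z (-1/2)"

section \<open>Adjoints and inner products of complex vectors and matrices\<close>

lemma inner_complex_vec:
  fixes x y :: "complex^'n"
  shows "x \<bullet> y = Re (\<Sum>i\<in>UNIV. cnj (x $ i) * y $ i)"
  by (simp add: inner_vec_def inner_complex_def)

lemma posdef_iff:
  "A \<in> posdef \<longleftrightarrow> hermitian A \<and> (\<forall>x. x \<noteq> 0 \<longrightarrow> 0 < qf A x)"
  by (simp add: posdef_def inner_complex_vec)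

lemma ctranspose_nth [simp]: "ctranspose A $ i $ j = cnj (A $ j $ i)"
  by (simp add: ctranspose_def)

lemma ctranspose_ctranspose [simp]: "ctranspose (ctranspose A) = A"
  by (simp add: vec_eq_iff)

lemma ctranspose_mult: "ctranspose (A ** B) = ctranspose B ** ctranspose A"
  by (simp add: vec_eq_iff matrix_matrix_mult_def mult.commute)

lemma ctranspose_mat_1 [simp]: "ctranspose (mat 1) = mat 1"
  by (simp add: vec_eq_iff mat_def)

lemma ctranspose_add: "ctranspose (A + B) = ctranspose A + ctranspose B"
  by (simp add: vec_eq_iff)

lemma ctranspose_diff: "ctranspose (A - B) = ctranspose A - ctranspose B"
  by (simp add: vec_eq_iff)

lemma ctranspose_scaleR: "ctranspose (c *\<^sub>R A) = c *\<^sub>R ctranspose A"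
  by (simp add: vec_eq_iff)

lemma ctranspose_sum: "ctranspose (\<Sum>i\<in>I. f i) = (\<Sum>i\<in>I. ctranspose (f i))"
  by (simp add: vec_eq_iff)

lemma bounded_linear_ctranspose: "bounded_linear ctranspose"
  by (intro linear_conv_bounded_linear[THEN iffD1] linearI ctranspose_add ctranspose_scaleR)

lemma matrix_mul_scaleR_left: "(c *\<^sub>R A) ** B = c *\<^sub>R (A ** (B :: complex^'k^'n))"
  by (simp add: vec_eq_iff matrix_matrix_mult_def scaleR_right.sum)

lemma matrix_mul_scaleR_right: "A ** (c *\<^sub>R B) = c *\<^sub>R (A ** (B :: complex^'k^'n))"
  by (simp add: vec_eq_iff matrix_matrix_mult_def scaleR_right.sum)

lemma matrix_vector_scaleR_left: "(c *\<^sub>R A) *v x = c *\<^sub>R (A *v (x :: complex^'n))"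
  by (simp add: vec_eq_iff matrix_vector_mult_def scaleR_right.sum)

lemma matrix_vector_scaleR_right: "A *v (c *\<^sub>R x) = c *\<^sub>R (A *v (x :: complex^'n))"
  by (simp add: vec_eq_iff matrix_vector_mult_def scaleR_right.sum)

lemma matrix_add_rdistrib': "(A + B) ** C = A ** C + B ** (C :: complex^'k^'n)"
  by (simp add: vec_eq_iff matrix_matrix_mult_def distrib_right sum.distrib)

lemma bounded_bilinear_matrix_mult:
  "bounded_bilinear ((**) :: complex^'n^'m \<Rightarrow> complex^'k^'n \<Rightarrow> complex^'k^'m)"
  by (intro bilinear_conv_bounded_bilinear[THEN iffD1])
     (auto simp: bilinear_def matrix_mul_scaleR_left matrix_mul_scaleR_right
        matrix_add_ldistrib matrix_add_rdistrib' intro!: linearI)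

lemma bounded_bilinear_matrix_vector_mult:
  "bounded_bilinear ((*v) :: complex^'n^'m \<Rightarrow> complex^'n \<Rightarrow> complex^'m)"
  by (intro bilinear_conv_bounded_bilinear[THEN iffD1])
     (auto simp: bilinear_def matrix_vector_scaleR_left matrix_vector_scaleR_right
        matrix_vector_mult_add_rdistrib matrix_vector_right_distrib intro!: linearI)

lemmas continuous_on_matrix_mult [continuous_intros] =
  bounded_bilinear.continuous_on[OF bounded_bilinear_matrix_mult]
lemmas continuous_on_matrix_vector_mult [continuous_intros] =
  bounded_bilinear.continuous_on[OF bounded_bilinear_matrix_vector_mult]

lemma matrix_mul_zero_left [simp]: "0 ** (B :: complex^'k^'n) = 0"
  using bounded_bilinear.zero_left[OF bounded_bilinear_matrix_mult] .

lemma matrix_mul_zero_right [simp]: "A ** (0 :: complex^'k^'n) = 0"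
  using bounded_bilinear.zero_right[OF bounded_bilinear_matrix_mult] .

text \<open>The inner product of the type class is only the real part of this form; eigenvectors
  must be orthogonal over the complex numbers.\<close>

definition cdot :: "complex^'n \<Rightarrow> complex^'n \<Rightarrow> complex" where
  "cdot x y = (\<Sum>i\<in>UNIV. cnj (x $ i) * y $ i)"

lemma inner_cdot: "x \<bullet> y = Re (cdot x y)"
  by (simp add: inner_complex_vec cdot_def)

lemma cdot_cnj: "cnj (cdot x y) = cdot y x"
  by (simp add: cdot_def mult.commute)

lemma cdot_add_right: "cdot x (y + z) = cdot x y + cdot x z"
  by (simp add: cdot_def algebra_simps sum.distrib)

lemma cdot_diff_right: "cdot x (y - z) = cdot x y - cdot x z"
  by (simp add: cdot_def algebra_simps sum_subtractf)

lemma cdot_smult_right: "cdot x (c *s y) = c * cdot x y"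
  by (simp add: cdot_def algebra_simps sum_distrib_left)

lemma cdot_scaleR_right: "cdot x (c *\<^sub>R y) = of_real c * cdot x y"
  by (simp add: cdot_def sum_distrib_left) (simp add: scaleR_conv_of_real mult_ac)

lemma cdot_Im: "Im (cdot x y) = - ((\<i> *s x) \<bullet> y) * -1"
  by (simp add: inner_cdot cdot_def algebra_simps flip: sum_negf)

lemma cdot_eq_0_iff: "cdot x y = 0 \<longleftrightarrow> x \<bullet> y = 0 \<and> (\<i> *s x) \<bullet> y = 0"
  by (simp add: complex_eq_iff cdot_Im inner_cdot)

lemma cdot_self: "cdot x x = of_real ((norm x)\<^sup>2)"
  by (simp add: cdot_def norm_vec_def L2_set_def sum_nonneg complex_norm_square mult.commute flip: of_real_power)

lemma cdot_matrix_right: "cdot x (A *v y) = cdot (ctranspose A *v x) y"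
proof -
  have "(\<Sum>i\<in>UNIV. cnj (x $ i) * (A *v y) $ i) = (\<Sum>i\<in>UNIV. \<Sum>j\<in>UNIV. cnj (x $ i) * (A $ i $ j * y $ j))"
    by (simp add: matrix_vector_mult_def sum_distrib_left)
  also have "\<dots> = (\<Sum>j\<in>UNIV. \<Sum>i\<in>UNIV. cnj (x $ i) * (A $ i $ j * y $ j))"
    by (rule sum.swap)
  also have "\<dots> = (\<Sum>j\<in>UNIV. cnj ((ctranspose A *v x) $ j) * y $ j)"
    by (simp add: matrix_vector_mult_def sum_distrib_left sum_distrib_right mult_ac)
  finally show ?thesis by (simp add: cdot_def)
qed

lemma inner_matrix_vector_right:
  fixes x :: "complex^'m" and y :: "complex^'n"
  shows "x \<bullet> (A *v y) = (ctranspose A *v x) \<bullet> y"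
  by (simp add: inner_cdot cdot_matrix_right)

lemma inner_matrix_vector_left:
  fixes x :: "complex^'n" and y :: "complex^'m"
  shows "(A *v x) \<bullet> y = x \<bullet> (ctranspose A *v y)"
  by (simp add: inner_matrix_vector_right)

lemma inner_matrix: "A \<bullet> B = Re (trace (ctranspose A ** (B :: complex^'n^'m)))"
proof -
  have "trace (ctranspose A ** B) = (\<Sum>j\<in>UNIV. \<Sum>i\<in>UNIV. cnj (A $ i $ j) * B $ i $ j)"
    by (simp add: trace_def matrix_matrix_mult_def)
  also have "\<dots> = (\<Sum>i\<in>UNIV. \<Sum>j\<in>UNIV. cnj (A $ i $ j) * B $ i $ j)"
    by (rule sum.swap)
  finally show ?thesis
    by (simp add: inner_vec_def inner_complex_def)
qed

lemma norm_matrix_sq: "(norm (A :: complex^'n^'m))\<^sup>2 = (\<Sum>i\<in>UNIV. \<Sum>j\<in>UNIV. (cmod (A $ i $ j))\<^sup>2)"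
  by (simp add: norm_vec_def L2_set_def sum_nonneg)

section \<open>Unitary matrices\<close>

lemma unitary_ctranspose: "unitary (ctranspose U) \<longleftrightarrow> unitary U"
  by (auto simp: unitary_def)

lemma unitary_mat_1 [simp]: "unitary (mat 1)"
  by (simp add: unitary_def)

lemma unitary_mult: "unitary U \<Longrightarrow> unitary V \<Longrightarrow> unitary (U ** V)"
  unfolding unitary_def ctranspose_mult
  by (metis matrix_mul_assoc matrix_mul_lid)

lemma unitary_left: "unitary U \<Longrightarrow> ctranspose U ** U = mat 1"
  and unitary_right: "unitary U \<Longrightarrow> U ** ctranspose U = mat 1"
  by (auto simp: unitary_def)

lemma unitary_cancel:
  assumes "unitary U"
  shows "ctranspose U ** (U ** A) = A" "U ** (ctranspose U ** B) = B"
  using assms by (simp_all add: matrix_mul_assoc unitary_left unitary_right)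

lemma unitary_cancel_vec:
  assumes "unitary U"
  shows "ctranspose U *v (U *v x) = x" "U *v (ctranspose U *v y) = y"
  using assms by (simp_all add: matrix_vector_mul_assoc unitary_left unitary_right)

lemma unitaryI: "ctranspose U ** U = mat 1 \<Longrightarrow> unitary U"
  unfolding unitary_def using matrix_left_right_inverse by blast

lemma inner_unitary_vec: "unitary U \<Longrightarrow> (U *v x) \<bullet> (U *v y) = x \<bullet> y"
  by (simp add: inner_matrix_vector_left unitary_cancel_vec)

lemma norm_unitary_vec: "unitary U \<Longrightarrow> norm (U *v x) = norm x"
  by (simp add: norm_eq_sqrt_inner inner_unitary_vec)

lemma inner_unitary_left: "unitary U \<Longrightarrow> (U ** A) \<bullet> (U ** B) = A \<bullet> B"
proof -
  assume U: "unitary U"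
  have "ctranspose A ** ctranspose U ** (U ** B) = ctranspose A ** B"
    using unitary_cancel(1)[OF U, of B] by (metis matrix_mul_assoc)
  then show ?thesis by (simp add: inner_matrix ctranspose_mult)
qed

lemma inner_unitary_right: "unitary U \<Longrightarrow> (A ** U) \<bullet> (B ** U) = A \<bullet> (B :: complex^'n^'m)"
proof -
  assume U: "unitary U"
  have "trace (ctranspose U ** (ctranspose A ** B ** U)) = trace ((ctranspose A ** B ** U) ** ctranspose U)"
    by (rule trace_mul_sym)
  also have "(ctranspose A ** B ** U) ** ctranspose U = ctranspose A ** B"
    using U by (simp add: unitary_right flip: matrix_mul_assoc)
  finally show ?thesis by (simp add: inner_matrix ctranspose_mult matrix_mul_assoc)
qed

lemma norm_unitary_left: "unitary U \<Longrightarrow> norm (U ** A) = norm A"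
  by (simp add: norm_eq_sqrt_inner inner_unitary_left)

lemma norm_unitary_right: "unitary U \<Longrightarrow> norm (A ** U) = norm (A :: complex^'n^'m)"
  by (simp add: norm_eq_sqrt_inner inner_unitary_right)

subsection \<open>The spectral theorem\<close>

text \<open>The first-order condition at an extremum, for a variation that is quadratic in
  t.\<close>

lemma linear_coeff_zero:
  fixes a b :: real
  assumes "\<And>t. 0 \<le> 2 * t * a + t\<^sup>2 * b"
  shows "a = 0"
proof (rule ccontr)
  assume a: "a \<noteq> 0"
  \<comment> \<open>At this t the quadratic term is at most - t * a, half the size of the linear
    term, which is negative.\<close>
  define t where "t = - a / (\<bar>b\<bar> + 1)"
  have "t\<^sup>2 * b \<le> t\<^sup>2 * (\<bar>b\<bar> + 1)" by (intro mult_left_mono) auto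
  also have "t\<^sup>2 * (\<bar>b\<bar> + 1) = - t * a" by (simp add: t_def power2_eq_square)
  finally have "0 \<le> t * a" using assms[of t] by linarith
  moreover have "t * a = - (a\<^sup>2 / (\<bar>b\<bar> + 1))" by (simp add: t_def power2_eq_square)
  moreover have "a\<^sup>2 / (\<bar>b\<bar> + 1) > 0" using a by (intro divide_pos_pos) auto
  ultimately show False by linarith
qed

text \<open>The orthogonal complement W of the given eigenvectors is invariant under A, so a maximum
  point of \<open>qf A\<close> on its unit sphere is an eigenvector.\<close>

lemma hermitian_eigenvector_orthogonal:
  fixes A :: "complex^'n^'n"
  assumes A: "hermitian A" and S: "S \<noteq> UNIV"
    and ev: "\<And>i::'n. i \<in> S \<Longrightarrow> A *v v i = of_real (d i) *s v i"
  shows "\<exists>y l. norm y = 1 \<and> A *v y = of_real l *s y \<and> (\<forall>i\<in>S. cdot (v i) y = 0)"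
proof -
  define W where "W = {x. \<forall>i\<in>S. cdot (v i) x = 0}"
  have W_alt: "W = (\<Inter>i\<in>S. {x. v i \<bullet> x = 0} \<inter> {x. (\<i> *s v i) \<bullet> x = 0})"
    by (auto simp: W_def cdot_eq_0_iff)
  have closedW: "closed W"
    unfolding W_alt by (intro closed_INT ballI closed_Int closed_hyperplane)
  have addW: "x + y \<in> W" if "x \<in> W" "y \<in> W" for x y
    using that by (auto simp: W_def cdot_add_right)
  have diffW: "x - y \<in> W" if "x \<in> W" "y \<in> W" for x y
    using that by (auto simp: W_def cdot_diff_right)
  have scW: "c *\<^sub>R x \<in> W" if "x \<in> W" for x c
    using that by (auto simp: W_def cdot_scaleR_right)
  have AW: "A *v x \<in> W" if "x \<in> W" for x
    using that A ev by (auto simp: W_def cdot_matrix_right hermitian_def)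
      (metis (no_types, lifting) cdot_cnj cdot_smult_right complex_cnj_zero_iff mult_zero_right)
  have adj: "x \<bullet> (A *v y) = (A *v x) \<bullet> y" for x y
    using A by (simp add: inner_matrix_vector_right hermitian_def)
  \<comment> \<open>Complex orthogonality to v i is real orthogonality to v i and to \<i> v i; these
    are fewer than 2 * CARD('n) real conditions.\<close>
  define T where "T = (v ` S) \<union> ((\<lambda>i. \<i> *s v i) ` S)"
  have "card T \<le> card S + card S"
    unfolding T_def by (intro order_trans[OF card_Un_le] add_mono card_image_le) auto
  also have "\<dots> < 2 * CARD('n)"
    using psubset_card_mono[of UNIV S] S by (simp add: psubset_eq)
  finally have "dim T < DIM(complex^'n)"
    using dim_le_card'[of T] by (simp add: T_def)
  then obtain x0 where x0: "x0 \<noteq> 0" "\<And>y. y \<in> span T \<Longrightarrow> orthogonal x0 y"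
    using orthogonal_to_subspace_exists by blast
  have "x0 \<in> W"
    unfolding W_alt
  proof (intro INT_I IntI CollectI)
    fix i assume i: "i \<in> S"
    show "v i \<bullet> x0 = 0" "(\<i> *s v i) \<bullet> x0 = 0"
      using x0(2)[OF span_base, of "v i"] x0(2)[OF span_base, of "\<i> *s v i"] i
      unfolding T_def orthogonal_def by (simp_all add: inner_commute)
  qed
  define K where "K = W \<inter> sphere 0 1"
  have "compact K" unfolding K_def using closedW by (intro closed_Int_compact) auto
  moreover have "x0 /\<^sub>R norm x0 \<in> K"
    using \<open>x0 \<in> W\<close> x0(1) scW by (auto simp: K_def)
  moreover have "continuous_on K (\<lambda>x. x \<bullet> (A *v x))"
    by (intro continuous_intros)
  ultimately obtain y where y: "y \<in> K" "\<And>x. x \<in> K \<Longrightarrow> qf A x \<le> qf A y"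
    using continuous_attains_sup[of K "\<lambda>x. x \<bullet> (A *v x)"] by auto
  define l where "l = qf A y"
  have yW: "y \<in> W" "norm y = 1" using y by (auto simp: K_def)
  have ub: "qf A x \<le> l * (x \<bullet> x)" if "x \<in> W" for x
  proof (cases "x = 0")
    case False
    have "x /\<^sub>R norm x \<in> K" using that False scW by (auto simp: K_def)
    from y(2)[OF this] have "(qf A x) / (norm x)\<^sup>2 \<le> l"
      by (simp add: l_def matrix_vector_scaleR_right power2_eq_square divide_simps)
    then show ?thesis using False by (simp add: divide_simps dot_square_norm)
  qed simp
  \<comment> \<open>The residual of the eigenvalue equation. It lies in W, so it is an admissible
    direction of variation, and stationarity makes it orthogonal to itself.\<close>
  define w where "w = A *v y - l *\<^sub>R y"
  have wW: "w \<in> W" unfolding w_def using yW AW diffW scW by auto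
  have "0 \<le> 2 * t * (l * (y \<bullet> w) - w \<bullet> (A *v y)) + t\<^sup>2 * (l * (w \<bullet> w) - qf A w)" for t
  proof -
    have "qf A (y + t *\<^sub>R w) \<le> l * ((y + t *\<^sub>R w) \<bullet> (y + t *\<^sub>R w))"
      using yW wW addW scW by (intro ub) auto
    moreover have "qf A (y + t *\<^sub>R w) =
        qf A y + t * (y \<bullet> (A *v w)) + t * (w \<bullet> (A *v y)) + t * t * qf A w"
      by (simp add: matrix_vector_right_distrib matrix_vector_scaleR_right inner_add_left inner_add_right distrib_left)
    moreover have yy: "y \<bullet> y = 1" using yW by (simp add: dot_square_norm)
    moreover have "(y + t *\<^sub>R w) \<bullet> (y + t *\<^sub>R w) = 1 + 2 * t * (y \<bullet> w) + t * t * (w \<bullet> w)"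
      by (simp add: inner_add_left inner_add_right yy inner_commute[of w y] distrib_left)
    moreover have "y \<bullet> (A *v w) = w \<bullet> (A *v y)" using adj[of y w] by (metis inner_commute)
    ultimately have "l + 2 * (t * (w \<bullet> (A *v y))) + t * t * qf A w \<le> l * (1 + 2 * t * (y \<bullet> w) + t * t * (w \<bullet> w))"
      by (simp add: l_def)
    then show ?thesis by (simp add: power2_eq_square algebra_simps)
  qed
  then have "l * (y \<bullet> w) - w \<bullet> (A *v y) = 0" by (rule linear_coeff_zero)
  then have "w \<bullet> w = 0"
    by (subst (2) w_def) (simp add: inner_diff_right inner_commute)
  then have "A *v y = of_real l *s y"
    unfolding w_def inner_eq_zero_iff by (simp add: vec_eq_iff) (simp add: scaleR_conv_of_real)
  then show ?thesis using yW by (auto simp: W_def)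
qed

lemma spectral_family:
  fixes A :: "complex^'n^'n"
  assumes A: "hermitian A" and "finite S"
  shows "\<exists>v d. \<forall>i\<in>S. A *v v i = of_real (d i) *s v i \<and> (\<forall>j\<in>S. cdot (v i) (v (j::'n)) = (if i = j then 1 else 0))"
  using \<open>finite S\<close>
proof induction
  case (insert k S)
  then obtain v d where vd: "\<forall>i\<in>S. A *v v i = of_real (d i) *s v i \<and>
     (\<forall>j\<in>S. cdot (v i) (v j) = (if i = j then 1 else 0))" by blast
  obtain y l where y: "norm y = 1" "A *v y = of_real l *s y" "\<forall>i\<in>S. cdot (v i) y = 0"
    using hermitian_eigenvector_orthogonal[OF A, of S v d] vd insert by blast
  have y': "\<forall>i\<in>S. cdot y (v i) = 0" using y(3) by (metis cdot_cnj complex_cnj_zero)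
  have "\<forall>i\<in>insert k S. A *v (v(k:=y)) i = of_real ((d(k:=l)) i) *s (v(k:=y)) i \<and>
     (\<forall>j\<in>insert k S. cdot ((v(k:=y)) i) ((v(k:=y)) j) = (if i = j then 1 else 0))"
    using vd y y' insert by (auto simp: cdot_self[of y])
  then show ?case by blast
qed auto

text \<open>For unitary U, the matrix whose eigenvectors are the columns of U; the eigenvalues are
  indexed by 'n and carry no order. Functional calculus is computed in this form.\<close>

definition ud :: "complex^'n^'n \<Rightarrow> ('n \<Rightarrow> real) \<Rightarrow> complex^'n^'n" where
  "ud U d = U ** real_diag d ** ctranspose U"

lemma real_diag_nth: "real_diag d $ i $ j = (if i = j then of_real (d i) else 0)"
  by (simp add: real_diag_def)

lemma real_diag_mult_left: "(real_diag d ** A) $ i $ j = of_real (d i) * A $ i $ j"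
  by (simp add: matrix_matrix_mult_def real_diag_def if_distrib[where f="\<lambda>x. x * _"] cong: if_cong)

lemma real_diag_mult_right: "(A ** real_diag d) $ i $ j = A $ i $ j * of_real (d j)"
  by (simp add: matrix_matrix_mult_def real_diag_def if_distrib[where f="\<lambda>x. _ * x"] cong: if_cong)

lemma real_diag_vec: "(real_diag d *v x) $ i = of_real (d i) * x $ i"
  by (simp add: matrix_vector_mult_def real_diag_def if_distrib[where f="\<lambda>x. x * _"] cong: if_cong)

lemma spectral_theorem:
  fixes A :: "complex^'n^'n"
  assumes A: "hermitian A"
  obtains U d where "unitary U" "A = ud U d"
proof -
  obtain v d where vd: "\<forall>i. A *v v i = of_real (d i) *s v i \<and>
     (\<forall>j. cdot (v i) (v (j::'n)) = (if i = j then 1 else 0))"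
    using spectral_family[OF A, of UNIV] by auto
  define U :: "complex^'n^'n" where "U = (\<chi> i j. v j $ i)"
  have "ctranspose U ** U = mat 1"
    using vd by (simp add: vec_eq_iff matrix_matrix_mult_def U_def mat_def cdot_def)
  then have U: "unitary U" by (rule unitaryI)
  have "A ** U = U ** real_diag d"
  proof -
    have "(A ** U) $ i $ j = (A *v v j) $ i" for i j
      by (simp add: matrix_matrix_mult_def matrix_vector_mult_def U_def)
    then show ?thesis using vd
      by (simp add: vec_eq_iff real_diag_mult_right) (simp add: U_def mult.commute)
  qed
  then have "A = ud U d"
    using U unfolding ud_def by (metis matrix_mul_assoc matrix_mul_rid unitary_right)
  with U that show ?thesis by blast
qed

subsection \<open>Functional calculus\<close>

lemma real_diag_mult: "real_diag a ** real_diag b = real_diag (\<lambda>i. a i * b i)"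
  by (simp add: vec_eq_iff real_diag_mult_left real_diag_nth)

lemma real_diag_const: "real_diag (\<lambda>_. c) = c *\<^sub>R mat 1"
  by (simp add: vec_eq_iff real_diag_nth mat_def scaleR_conv_of_real[where 'a=complex])

lemma ctranspose_real_diag [simp]: "ctranspose (real_diag d) = real_diag d"
  by (simp add: vec_eq_iff real_diag_nth)

lemma ud_mult:
  assumes "unitary U"
  shows "ud U a ** ud U b = ud U (\<lambda>i. a i * b i)"
proof -
  have "ud U a ** ud U b = U ** real_diag a ** (ctranspose U ** (U ** (real_diag b ** ctranspose U)))"
    by (simp add: ud_def matrix_mul_assoc)
  also have "\<dots> = ud U (\<lambda>i. a i * b i)"
    unfolding unitary_cancel(1)[OF assms] by (simp add: ud_def matrix_mul_assoc flip: real_diag_mult)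
  finally show ?thesis .
qed

lemma ud_const: "unitary U \<Longrightarrow> ud U (\<lambda>_. c) = c *\<^sub>R mat 1"
  by (simp add: ud_def real_diag_const matrix_mul_scaleR_left matrix_mul_scaleR_right unitary_right)

lemma ud_add: "ud U a + ud U b = ud U (\<lambda>i. a i + b i)"
proof -
  have "real_diag (\<lambda>i. a i + b i) = real_diag a + real_diag b"
    by (simp add: vec_eq_iff real_diag_nth)
  then show ?thesis
    by (simp add: ud_def bounded_bilinear.add_left[OF bounded_bilinear_matrix_mult]
       bounded_bilinear.add_right[OF bounded_bilinear_matrix_mult])
qed

lemma ud_scaleR: "c *\<^sub>R ud U a = ud U (\<lambda>i. c * a i)"
proof -
  have "real_diag (\<lambda>i. c * a i) = c *\<^sub>R real_diag a"
    by (simp add: vec_eq_iff real_diag_nth scaleR_conv_of_real[where 'a=complex])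
  then show ?thesis
    by (simp add: ud_def matrix_mul_scaleR_left matrix_mul_scaleR_right)
qed

lemma ud_minus: "- ud U a = ud U (\<lambda>i. - a i)"
  using ud_scaleR[of "-1" U a] by simp

lemma ud_diff: "ud U a - ud U b = ud U (\<lambda>i. a i - b i)"
  using ud_add[of U a "\<lambda>i. - b i"] by (simp flip: ud_minus)

lemma ctranspose_ud [simp]: "ctranspose (ud U d) = ud U d"
  by (simp add: ud_def ctranspose_mult matrix_mul_assoc)

lemma hermitian_ud [simp]: "hermitian (ud U d)"
  by (simp add: hermitian_def)

lemma hermitian_mat_1 [simp]: "hermitian (mat 1)"
  by (simp add: hermitian_def)

lemma ud_mat_1 [simp]: "ud (mat 1) d = real_diag d"
  by (simp add: ud_def)

lemma ud_conj: "ud (V ** U) d = V ** ud U d ** ctranspose V"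
  by (simp add: ud_def ctranspose_mult matrix_mul_assoc)

lemma qf_ud: "qf (ud U d) x = (\<Sum>i\<in>UNIV. d i * (cmod ((ctranspose U *v x) $ i))\<^sup>2)"
proof -
  define y where "y = ctranspose U *v x"
  have "qf (ud U d) x = qf (real_diag d) y"
    by (simp add: ud_def y_def inner_matrix_vector_left flip: matrix_vector_mul_assoc)
  also have "\<dots> = (\<Sum>i\<in>UNIV. d i * (cmod (y $ i))\<^sup>2)"
    unfolding inner_vec_def cmod_power2 by (simp add: real_diag_vec inner_complex_def algebra_simps power2_eq_square)
  finally show ?thesis by (simp add: y_def)
qed

lemma norm_vec_sq: "(norm (x :: complex^'n))\<^sup>2 = (\<Sum>i\<in>UNIV. (cmod (x $ i))\<^sup>2)"
  by (simp add: norm_vec_def L2_set_def sum_nonneg)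

lemma sum_weights_unitary: "unitary U \<Longrightarrow> (\<Sum>i\<in>UNIV. (cmod ((ctranspose U *v x) $ i))\<^sup>2) = (norm x)\<^sup>2"
  unfolding norm_vec_sq[symmetric] by (simp add: norm_unitary_vec unitary_ctranspose)

lemma column_unitary: "unitary U \<Longrightarrow> ctranspose U *v column i U = axis i 1"
  using unitary_left[of U]
  by (auto simp: vec_eq_iff matrix_matrix_mult_def matrix_vector_mult_def column_def axis_def mat_def)

lemma column_mult: "column i U = U *v axis i 1"
  by (simp add: vec_eq_iff matrix_vector_mult_def column_def axis_def if_distrib[where f="\<lambda>x. _ * x"] cong: if_cong)

lemma norm_column: "unitary U \<Longrightarrow> norm (column i U) = 1"
  by (simp add: column_mult norm_unitary_vec norm_axis_1)

lemma ud_column: "unitary U \<Longrightarrow> ud U d *v column i U = d i *\<^sub>R column i U"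
proof -
  assume U: "unitary U"
  have "ud U d *v column i U = U *v (real_diag d *v axis i 1)"
    by (simp add: ud_def column_unitary[OF U] flip: matrix_vector_mul_assoc)
  also have "real_diag d *v axis i 1 = d i *\<^sub>R axis i 1"
    by (simp add: vec_eq_iff real_diag_vec axis_def scaleR_conv_of_real[where 'a=complex])
  finally show ?thesis by (simp add: column_mult matrix_vector_scaleR_right)
qed

lemma inner_ud:
  fixes H :: "complex^'n^'n"
  shows "H \<bullet> ud U a = (\<Sum>i\<in>UNIV. a i * qf H (column i U))"
proof -
  have "H \<bullet> ud U a = Re (trace ((ctranspose H ** U ** real_diag a) ** ctranspose U))"
    by (simp add: inner_matrix ud_def matrix_mul_assoc)
  also have "\<dots> = Re (trace (ctranspose U ** (ctranspose H ** U ** real_diag a)))"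
    by (subst trace_mul_sym) (rule refl)
  also have "\<dots> = Re (trace ((ctranspose U ** ctranspose H ** U) ** real_diag a))"
    by (simp add: matrix_mul_assoc)
  also have "\<dots> = (\<Sum>i\<in>UNIV. a i * Re ((ctranspose U ** ctranspose H ** U) $ i $ i))"
    by (simp add: trace_def real_diag_mult_right mult.commute)
  also have "\<dots> = (\<Sum>i\<in>UNIV. a i * qf H (column i U))"
  proof (intro sum.cong refl, goal_cases)
    case (1 i)
    have "qf H (column i U) = axis i 1 \<bullet> ((ctranspose U ** H ** U) *v axis i 1)"
      by (simp add: column_mult inner_matrix_vector_left flip: matrix_vector_mul_assoc)
    also have "\<dots> = Re ((ctranspose U ** H ** U) $ i $ i)"
      by (simp add: inner_axis' column_mult[symmetric] column_def inner_complex_def)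
    also have "ctranspose U ** H ** U = ctranspose (ctranspose U ** ctranspose H ** U)"
      by (simp add: ctranspose_mult matrix_mul_assoc)
    finally show ?case by (simp add: matrix_mul_assoc)
  qed
  finally show ?thesis .
qed

lemma norm_ud: "unitary U \<Longrightarrow> (norm (ud U d))\<^sup>2 = (\<Sum>i\<in>UNIV. (d i)\<^sup>2)"
proof -
  assume U: "unitary U"
  then have "norm (ud U d) = norm (real_diag d :: complex^'a^'a)"
    by (simp add: ud_def norm_unitary_right norm_unitary_left unitary_ctranspose)
  also have "\<dots>\<^sup>2 = (\<Sum>i\<in>UNIV. \<Sum>j\<in>UNIV. if i = j then (d i)\<^sup>2 else 0)"
    unfolding norm_matrix_sq by (intro sum.cong) (auto simp: real_diag_nth)
  finally show ?thesis by simp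
qed

lemma trace_ud: "unitary U \<Longrightarrow> trace (ud U d) = of_real (\<Sum>i\<in>UNIV. d i)"
proof -
  assume U: "unitary U"
  have "trace (ud U d) = trace (ctranspose U ** (U ** real_diag d))"
    unfolding ud_def by (rule trace_mul_sym)
  then show ?thesis
    using U by (simp add: unitary_cancel trace_def real_diag_nth)
qed

text \<open>Between the two eigenbases the difference has the entries (a i - b j) W i j with W =
  \<open>ctranspose U ** V\<close>. This gives both the well-definedness of \<open>herm_fun\<close>
  and its Lipschitz bound.\<close>

lemma norm_ud_diff:
  assumes U: "unitary U" and V: "unitary V"
  shows "(norm (ud U a - ud V b))\<^sup>2 =
    (\<Sum>i\<in>UNIV. \<Sum>j\<in>UNIV. (a i - b j)\<^sup>2 * (cmod ((ctranspose U ** V) $ i $ j))\<^sup>2)"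
proof -
  let ?W = "ctranspose U ** V"
  have "norm (ud U a - ud V b) = norm (ctranspose U ** (ud U a - ud V b) ** V)"
    using U V by (simp add: norm_unitary_right norm_unitary_left unitary_ctranspose)
  also have "ctranspose U ** (ud U a - ud V b) ** V = real_diag a ** ?W - ?W ** real_diag b"
  proof -
    have "ctranspose U ** ud U a = real_diag a ** ctranspose U"
      using U by (simp add: ud_def matrix_mul_assoc unitary_left)
    moreover have "ud V b ** V = V ** real_diag b"
      using V by (simp add: ud_def unitary_left flip: matrix_mul_assoc)
    ultimately show ?thesis
      by (simp add: bounded_bilinear.diff_left[OF bounded_bilinear_matrix_mult]
        bounded_bilinear.diff_right[OF bounded_bilinear_matrix_mult] matrix_mul_assoc)
        (metis matrix_mul_assoc)
  qed
  also have "(norm \<dots>)\<^sup>2 = (\<Sum>i\<in>UNIV. \<Sum>j\<in>UNIV. (a i - b j)\<^sup>2 * (cmod (?W $ i $ j))\<^sup>2)"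
  proof -
    have "(cmod (of_real (a i) * w - w * of_real (b j)))\<^sup>2 = (a i - b j)\<^sup>2 * (cmod w)\<^sup>2" for i j w
    proof -
      have "of_real (a i) * w - w * of_real (b j) = of_real (a i - b j) * w"
        by (simp add: algebra_simps)
      then show ?thesis by (simp add: norm_mult power_mult_distrib del: of_real_diff)
    qed
    then show ?thesis
      by (simp add: norm_matrix_sq real_diag_mult_left real_diag_mult_right)
  qed
  finally show ?thesis .
qed

text \<open>Equal matrices force a i = b j wherever the transition matrix has a nonzero entry, hence
  f (a i) = f (b j) there.\<close>

lemma ud_fun_cong:
  assumes U: "unitary U" and V: "unitary V" and eq: "ud U a = ud V b"
  shows "ud U (f \<circ> a) = ud V (f \<circ> b)"
proof -
  let ?W = "ctranspose U ** V"
  have "(\<Sum>i\<in>UNIV. \<Sum>j\<in>UNIV. (a i - b j)\<^sup>2 * (cmod (?W $ i $ j))\<^sup>2) = 0"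
    using norm_ud_diff[OF U V, of a b] eq by simp
  then have "(a i - b j)\<^sup>2 * (cmod (?W $ i $ j))\<^sup>2 = 0" for i j
    by (simp add: sum_nonneg_eq_0_iff sum_nonneg)
  then have "(f (a i) - f (b j))\<^sup>2 * (cmod (?W $ i $ j))\<^sup>2 = 0" for i j
    by (metis cancel_comm_monoid_add_class.diff_cancel mult_eq_0_iff power_eq_0_iff
        eq_iff_diff_eq_0)
  then have "(norm (ud U (f \<circ> a) - ud V (f \<circ> b)))\<^sup>2 = 0"
    unfolding norm_ud_diff[OF U V] by (simp add: sum_nonneg_eq_0_iff sum_nonneg)
  then show ?thesis by simp
qed

lemma herm_fun_ud:
  assumes U: "unitary U"
  shows "herm_fun f (ud U d) = ud U (f \<circ> d)"
  unfolding herm_fun_def ud_def[symmetric]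
proof (rule the_equality)
  show "\<exists>Ua da. unitary Ua \<and> ud U d = ud Ua da \<and> ud U (f \<circ> d) = ud Ua (f \<circ> da)"
    using U by blast
  show "B = ud U (f \<circ> d)" if "\<exists>Ua da. unitary Ua \<and> ud U d = ud Ua da \<and> B = ud Ua (f \<circ> da)" for B
    using that ud_fun_cong[OF U] by metis
qed

lemma mat_powr_ud: "unitary U \<Longrightarrow> mat_powr (ud U d) t = ud U (\<lambda>i. d i powr t)"
  by (simp add: mat_powr_def herm_fun_ud comp_def)

lemma mat_ln_ud: "unitary U \<Longrightarrow> mat_ln (ud U d) = ud U (\<lambda>i. ln (d i))"
  by (simp add: mat_ln_def herm_fun_ud comp_def)

lemma qf_column: "unitary U \<Longrightarrow> qf (ud U d) (column i U) = d i"
  by (simp add: ud_column dot_square_norm norm_column)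

lemma posdef_ud: "unitary U \<Longrightarrow> ud U d \<in> posdef \<longleftrightarrow> (\<forall>i. 0 < d i)"
proof
  assume U: "unitary U" and "ud U d \<in> posdef"
  have "0 < qf (ud U d) (column i U)" for i
  proof -
    have "column i U \<noteq> 0" using norm_column[OF U, of i] by auto
    then show ?thesis using \<open>ud U d \<in> posdef\<close> by (simp add: posdef_iff)
  qed
  then show "\<forall>i. 0 < d i" by (simp add: qf_column[OF U])
next
  assume U: "unitary U" and d: "\<forall>i. 0 < d i"
  show "ud U d \<in> posdef" unfolding posdef_iff
  proof (intro conjI allI impI)
    fix x :: "complex^'a" assume "x \<noteq> 0"
    then have "(\<Sum>i\<in>UNIV. (cmod ((ctranspose U *v x) $ i))\<^sup>2) > 0"
      by (simp add: sum_weights_unitary[OF U])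
    then obtain k where "(cmod ((ctranspose U *v x) $ k))\<^sup>2 > 0"
      by (metis (mono_tags, lifting) not_less sum_nonpos)
    then have "0 < (\<Sum>i\<in>UNIV. d i * (cmod ((ctranspose U *v x) $ i))\<^sup>2)"
      using d by (intro sum_pos2[of _ k]) (auto simp: less_imp_le)
    then show "0 < qf (ud U d) x" by (simp add: qf_ud)
  qed simp
qed

lemma posdef_decomp:
  assumes "A \<in> posdef"
  obtains U d where "unitary U" "\<And>i. 0 < d i" "A = ud U d" "\<And>i. d i \<noteq> 0"
proof -
  obtain U d where U: "unitary U" "A = ud U d"
    using assms by (auto simp: posdef_iff elim: spectral_theorem)
  then have d: "\<And>i. 0 < d i" using assms posdef_ud[of U d] by simp
  then have "\<And>i. d i \<noteq> 0" by (metis less_irrefl)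
  then show ?thesis using that U d by blast
qed

lemma posdef_hermitian: "A \<in> posdef \<Longrightarrow> hermitian A"
  by (simp add: posdef_iff)

lemma posdef_ctranspose: "A \<in> posdef \<Longrightarrow> ctranspose A = A"
  by (simp add: posdef_iff hermitian_def)

lemma posdef_mat_1 [simp]: "mat 1 \<in> posdef"
  using posdef_ud[of "mat 1" "\<lambda>_. 1"] by (simp add: real_diag_const)

lemma posdef_mat_powr [simp]: "A \<in> posdef \<Longrightarrow> mat_powr A t \<in> posdef"
  by (elim posdef_decomp) (simp add: mat_powr_ud posdef_ud)

lemma hermitian_mat_ln [simp]: "A \<in> posdef \<Longrightarrow> hermitian (mat_ln A)"
  by (elim posdef_decomp) (simp add: mat_ln_ud)

lemma ctranspose_mat_powr [simp]: "A \<in> posdef \<Longrightarrow> ctranspose (mat_powr A t) = mat_powr A t"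
  by (simp add: posdef_ctranspose)

lemma ctranspose_mat_ln [simp]: "A \<in> posdef \<Longrightarrow> ctranspose (mat_ln A) = mat_ln A"
  using hermitian_mat_ln hermitian_def by blast

lemma mat_powr_add: "A \<in> posdef \<Longrightarrow> mat_powr A s ** mat_powr A t = mat_powr A (s + t)"
  by (elim posdef_decomp) (simp add: mat_powr_ud ud_mult powr_add)

lemma mat_powr_0 [simp]: "A \<in> posdef \<Longrightarrow> mat_powr A 0 = mat 1"
  by (elim posdef_decomp) (simp add: mat_powr_ud ud_const)

lemma mat_powr_1 [simp]: "A \<in> posdef \<Longrightarrow> mat_powr A 1 = A"
  by (elim posdef_decomp) (simp add: mat_powr_ud less_imp_le)

lemma mat_powr_powr: "A \<in> posdef \<Longrightarrow> mat_powr (mat_powr A s) t = mat_powr A (s * t)"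
  by (elim posdef_decomp) (simp add: mat_powr_ud powr_powr)

lemma mat_ln_powr: "A \<in> posdef \<Longrightarrow> mat_ln (mat_powr A t) = t *\<^sub>R mat_ln A"
  by (elim posdef_decomp) (simp add: mat_powr_ud mat_ln_ud ud_scaleR ln_powr)

lemma mat_powr_cancel:
  assumes "A \<in> posdef"
  shows "mat_powr A t ** mat_powr A (- t) = mat 1" "mat_powr A (- t) ** mat_powr A t = mat 1"
  using assms by (simp_all add: mat_powr_add)

lemma mat_powr_half:
  assumes "A \<in> posdef"
  shows "mat_powr A (1/2) ** mat_powr A (1/2) = A"
  using assms by (simp add: mat_powr_add)

lemma mat_1_eq_ud: "unitary U \<Longrightarrow> mat 1 = ud U (\<lambda>_. 1)"
  by (simp add: ud_const)

lemma mat_ln_1 [simp]: "mat_ln (mat 1) = 0"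
  using mat_ln_ud[of "mat 1" "\<lambda>_. 1"] by (simp add: real_diag_const)

lemma mat_powr_mat_1 [simp]: "mat_powr (mat 1) t = mat 1"
  using mat_powr_ud[of "mat 1" "\<lambda>_. 1"] by (simp add: real_diag_const)

lemma posdef_scaleR: "A \<in> posdef \<Longrightarrow> 0 < c \<Longrightarrow> c *\<^sub>R A \<in> posdef"
  by (auto simp: posdef_iff hermitian_def ctranspose_scaleR matrix_vector_scaleR_left)

lemma mat_powr_scaleR: "A \<in> posdef \<Longrightarrow> 0 < c \<Longrightarrow> mat_powr (c *\<^sub>R A) t = (c powr t) *\<^sub>R mat_powr A t"
  by (elim posdef_decomp) (simp add: mat_powr_ud ud_scaleR powr_mult less_imp_le)

lemma mat_ln_scaleR: "A \<in> posdef \<Longrightarrow> 0 < c \<Longrightarrow> mat_ln (c *\<^sub>R A) = ln c *\<^sub>R mat 1 + mat_ln A"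
  by (elim posdef_decomp) (simp add: mat_ln_ud ud_scaleR mat_1_eq_ud ud_add ln_mult)

lemma mat_ln_eq_0: "A \<in> posdef \<Longrightarrow> mat_ln A = 0 \<longleftrightarrow> A = mat 1"
proof
  assume A: "A \<in> posdef" and 0: "mat_ln A = 0"
  obtain U d where U: "unitary U" "\<And>i. 0 < d i" "A = ud U d" using A by (elim posdef_decomp) blast
  have "(\<Sum>i\<in>UNIV. (ln (d i))\<^sup>2) = 0"
    using 0 norm_ud[OF U(1), of "\<lambda>i. ln (d i)"] by (simp add: U mat_ln_ud)
  then have "d i = 1" for i using U(2)[of i] by (simp add: sum_nonneg_eq_0_iff) (metis ln_eq_zero_iff)
  then have "d = (\<lambda>_. 1)" by auto
  then show "A = mat 1" using U by (simp add: ud_const)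
qed simp

lemma herm_fun_unitary_conj:
  "hermitian A \<Longrightarrow> unitary V \<Longrightarrow> herm_fun f (V ** A ** ctranspose V) = V ** herm_fun f A ** ctranspose V"
  by (elim spectral_theorem) (simp add: herm_fun_ud unitary_mult flip: ud_conj)

lemma mat_ln_unitary_conj:
  "A \<in> posdef \<Longrightarrow> unitary V \<Longrightarrow> mat_ln (V ** A ** ctranspose V) = V ** mat_ln A ** ctranspose V"
  unfolding mat_ln_def by (simp add: herm_fun_unitary_conj posdef_hermitian)

text \<open>The left inverse T' makes \<open>ctranspose T\<close> injective.\<close>

lemma posdef_congruence:
  assumes A: "A \<in> posdef" and T: "T' ** ctranspose T = mat 1"
  shows "T ** A ** ctranspose T \<in> posdef"
  unfolding posdef_iff
proof (intro conjI allI impI)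
  show "hermitian (T ** A ** ctranspose T)"
    using A by (simp add: hermitian_def ctranspose_mult posdef_ctranspose matrix_mul_assoc)
  fix x :: "complex^'b" assume "x \<noteq> 0"
  then have "ctranspose T *v x \<noteq> 0"
    using T by (metis matrix_vector_mul_assoc matrix_vector_mul_lid matrix_vector_mult_0_right)
  then show "0 < qf (T ** A ** ctranspose T) x"
    using A by (simp add: posdef_iff inner_matrix_vector_right[of x T] flip: matrix_vector_mul_assoc)
qed

lemma posdef_congruence_invertible:
  assumes "A \<in> posdef" and "invertible T"
  shows "T ** A ** ctranspose T \<in> posdef"
proof -
  obtain T' where "T ** T' = mat 1" using assms by (auto simp: invertible_def)
  then have "ctranspose T' ** ctranspose T = mat 1"
    by (metis ctranspose_mat_1 ctranspose_mult)
  then show ?thesis using assms posdef_congruence by blast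
qed

lemma invertible_posdef: "A \<in> posdef \<Longrightarrow> invertible A"
  using mat_powr_cancel[of A 1] by (auto simp: invertible_def)

lemma posdef_congruence_posdef: "A \<in> posdef \<Longrightarrow> C \<in> posdef \<Longrightarrow> C ** A ** C \<in> posdef"
  using posdef_congruence_invertible[of A C] invertible_posdef[of C] by (simp add: posdef_ctranspose)

lemma mat_powr_neg_1_unique:
  assumes "A \<in> posdef" "B ** A = mat 1"
  shows "mat_powr A (-1) = B"
  using assms mat_powr_cancel[of A 1]
  by (metis matrix_mul_assoc matrix_mul_lid matrix_mul_rid mat_powr_1)

text \<open>Eigenvectors of A span the space. This serves for matrices whose eigenvectors are
  understood without an explicit diagonalization, such as
  \<open>ext_power S (real_diag d)\<close>.\<close>

lemma herm_fun_eigenI: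
  assumes A: "hermitian A" and B: "\<And>l x. A *v x = l *\<^sub>R x \<Longrightarrow> B *v x = f l *\<^sub>R x"
  shows "herm_fun f A = B"
proof -
  obtain U d where U: "unitary U" "A = ud U d" using A by (elim spectral_theorem)
  have "B *v column i U = f (d i) *\<^sub>R column i U" for i
    using U by (intro B) (simp add: ud_column)
  then have "(B ** U) $ j $ i = (U ** real_diag (f \<circ> d)) $ j $ i" for i j
    by (simp add: real_diag_mult_right) (auto simp: vec_eq_iff matrix_vector_mult_def column_def matrix_matrix_mult_def
       scaleR_conv_of_real[where 'a=complex] mult.commute)
  then have "B ** U = U ** real_diag (f \<circ> d)" by (simp add: vec_eq_iff)
  then have "B = ud U (f \<circ> d)"
    using U unfolding ud_def by (metis matrix_mul_assoc matrix_mul_rid unitary_right)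
  then show ?thesis using U by (simp add: herm_fun_ud)
qed

subsection \<open>Continuity of the functional calculus\<close>

text \<open>By \<open>norm_ud_diff\<close> a Lipschitz constant of f on an interval that contains
  both spectra is a Lipschitz constant of the functional calculus in the Euclidean norm.\<close>

lemma continuous_on_herm_fun:
  fixes f :: "real \<Rightarrow> real"
  assumes lip: "\<And>a b. 0 < a \<Longrightarrow> a < b \<Longrightarrow> \<exists>L. \<forall>x\<in>{a..b}. \<forall>y\<in>{a..b}. \<bar>f x - f y\<bar> \<le> L * \<bar>x - y\<bar>"
  shows "continuous_on posdef (herm_fun f)"
  unfolding continuous_on_iff
proof (intro ballI allI impI)
  fix A :: "complex^'a^'a" and e :: real assume A: "A \<in> posdef" and e: "e > 0"
  obtain U a where U: "unitary U" "\<And>i. 0 < a i" "A = ud U a" using A by (elim posdef_decomp) blast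
  \<comment> \<open>Half the smallest eigenvalue: a perturbation smaller than lo keeps the spectrum
    in the compact interval from lo to hi, away from 0.\<close>
  define lo where "lo = Min (range a) / 2"
  define hi where "hi = Max (range a) + lo"
  have lo: "lo > 0" using U(2) by (simp add: lo_def)
  have ai: "2 * lo \<le> a i" "a i + lo \<le> hi" for i by (auto simp: lo_def hi_def)
  have "lo < hi" using ai(1)[of undefined] ai(2)[of undefined] lo by linarith
  then obtain L where L: "\<forall>x\<in>{lo..hi}. \<forall>y\<in>{lo..hi}. \<bar>f x - f y\<bar> \<le> L * \<bar>x - y\<bar>"
    using lip[OF lo] by blast
  define d where "d = min lo (e / (\<bar>L\<bar> + 1))"
  have d: "d > 0" using lo e by (auto simp: d_def)
  show "\<exists>d>0. \<forall>B\<in>posdef. dist B A < d \<longrightarrow> dist (herm_fun f B) (herm_fun f A) < e"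
  proof (intro exI[of _ d] conjI d ballI impI)
    fix B :: "complex^'a^'a" assume B: "B \<in> posdef" and dist: "dist B A < d"
    obtain V b where V: "unitary V" "\<And>i. 0 < b i" "B = ud V b" using B by (elim posdef_decomp) blast
    let ?W = "ctranspose V ** U"
    have nAB: "norm (A - B) < d" using dist by (simp add: dist_norm norm_minus_commute)
    have bj: "lo \<le> b j \<and> b j \<le> hi" for j
    proof -
      let ?v = "column j V"
      \<comment> \<open>An eigenvalue of B is compared with the Rayleigh quotient of A at the same
        vector, which lies between the extreme eigenvalues of A.\<close>
      have "b j - ?v \<bullet> (A *v ?v) = ?v \<bullet> ((B - A) *v ?v)"
        by (simp add: V qf_column matrix_vector_mult_diff_rdistrib inner_diff_right)
      also have "\<bar>\<dots>\<bar> \<le> norm (B - A)"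
      proof -
        have "?v \<bullet> ((B - A) *v ?v) = (B - A) \<bullet> ud V (\<lambda>i. if i = j then 1 else 0)"
          by (simp add: inner_ud if_distrib[where f="\<lambda>x. x * _"] cong: if_cong)
        also have "\<bar>\<dots>\<bar> \<le> norm (B - A) * norm (ud V (\<lambda>i. if i = j then 1 else 0))"
          by (rule Cauchy_Schwarz_ineq2)
        also have "(norm (ud V (\<lambda>i. if i = j then 1 else 0)))\<^sup>2 = 1"
          using norm_ud[OF V(1), of "\<lambda>i. if i = j then 1 else 0"] by (simp add: if_distrib[where f="\<lambda>x. x^2"] cong: if_cong)
        then have "norm (ud V (\<lambda>i. if i = j then 1 else 0)) = 1"
          by (simp add: power2_eq_1_iff) (smt (verit) norm_ge_zero)
        finally show ?thesis by simp
      qed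
      finally have *: "\<bar>b j - ?v \<bullet> (A *v ?v)\<bar> < lo"
        using nAB by (simp add: d_def norm_minus_commute)
      let ?w = "\<lambda>i. (cmod ((ctranspose U *v ?v) $ i))\<^sup>2"
      have s1: "(\<Sum>i\<in>UNIV. ?w i) = 1" using sum_weights_unitary[OF U(1), of ?v] by (simp add: norm_column V)
      have "?v \<bullet> (A *v ?v) = (\<Sum>i\<in>UNIV. a i * ?w i)" by (simp add: U qf_ud)
      moreover have "(\<Sum>i\<in>UNIV. (2 * lo) * ?w i) \<le> (\<Sum>i\<in>UNIV. a i * ?w i)"
        by (intro sum_mono mult_right_mono ai) auto
      moreover have "(\<Sum>i\<in>UNIV. a i * ?w i) \<le> (\<Sum>i\<in>UNIV. (hi - lo) * ?w i)"
        using ai by (intro sum_mono mult_right_mono) (auto simp: le_diff_eq)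
      ultimately have "2 * lo \<le> ?v \<bullet> (A *v ?v)" "?v \<bullet> (A *v ?v) \<le> hi - lo"
        unfolding sum_distrib_left[symmetric] s1 by auto
      with * show ?thesis by auto
    qed
    have "(norm (herm_fun f B - herm_fun f A))\<^sup>2 = (\<Sum>i\<in>UNIV. \<Sum>j\<in>UNIV. (f (b i) - f (a j))\<^sup>2 * (cmod (?W $ i $ j))\<^sup>2)"
      using U V by (simp add: herm_fun_ud norm_ud_diff)
    also have "\<dots> \<le> (\<Sum>i\<in>UNIV. \<Sum>j\<in>UNIV. L\<^sup>2 * ((b i - a j)\<^sup>2 * (cmod (?W $ i $ j))\<^sup>2))"
    proof (intro sum_mono)
      fix i j
      have "a j \<in> {lo..hi}" "b i \<in> {lo..hi}" using bj[of i] ai[of j] lo by auto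
      then have "\<bar>f (b i) - f (a j)\<bar> \<le> L * \<bar>b i - a j\<bar>" using L by blast
      then have "\<bar>f (b i) - f (a j)\<bar>\<^sup>2 \<le> (L * \<bar>b i - a j\<bar>)\<^sup>2" by (intro power_mono) auto
      then have "(f (b i) - f (a j))\<^sup>2 \<le> L\<^sup>2 * (b i - a j)\<^sup>2" by (simp add: power_mult_distrib)
      then show "(f (b i) - f (a j))\<^sup>2 * (cmod (?W $ i $ j))\<^sup>2 \<le> L\<^sup>2 * ((b i - a j)\<^sup>2 * (cmod (?W $ i $ j))\<^sup>2)"
        by (simp add: mult_right_mono flip: mult.assoc)
    qed
    also have "\<dots> = (\<bar>L\<bar> * norm (B - A))\<^sup>2"
      using U V by (simp add: norm_ud_diff power_mult_distrib sum_distrib_left)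
    finally have "norm (herm_fun f B - herm_fun f A) \<le> \<bar>L\<bar> * norm (B - A)"
      by (rule power2_le_imp_le) auto
    also have "\<dots> \<le> (\<bar>L\<bar> + 1) * norm (B - A)" by (intro mult_right_mono) auto
    also have "\<dots> < (\<bar>L\<bar> + 1) * (e / (\<bar>L\<bar> + 1))"
      using nAB by (intro mult_strict_left_mono) (auto simp: d_def norm_minus_commute)
    finally show "dist (herm_fun f B) (herm_fun f A) < e" by (simp add: dist_norm)
  qed
qed

lemma lipschitz_from_deriv:
  fixes f f' :: "real \<Rightarrow> real"
  assumes "\<And>x. 0 < x \<Longrightarrow> (f has_real_derivative f' x) (at x)"
    and "continuous_on {0<..} f'" and "0 < a" "a < b"
  shows "\<exists>L. \<forall>x\<in>{a..b}. \<forall>y\<in>{a..b}. \<bar>f x - f y\<bar> \<le> L * \<bar>x - y\<bar>"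
proof -
  have "compact (f' ` {a..b})"
    using assms by (intro compact_continuous_image continuous_on_subset[OF assms(2)]) auto
  then have "bounded (f' ` {a..b})" by (rule compact_imp_bounded)
  then obtain L where "\<forall>x\<in>f' ` {a..b}. norm x \<le> L" unfolding bounded_iff by blast
  then have L: "\<And>x. x \<in> {a..b} \<Longrightarrow> norm (f' x) \<le> L" by blast
  have "norm (f x - f y) \<le> L * norm (x - y)" if "x \<in> {a..b}" "y \<in> {a..b}" for x y
    using assms L that
    by (intro field_differentiable_bound[of "{a..b}" f f'])
       (auto intro: has_field_derivative_at_within)
  then show ?thesis by (intro exI[of _ L] ballI) simp
qed

lemma continuous_on_mat_ln: "continuous_on posdef mat_ln"
  unfolding mat_ln_def
  by (intro continuous_on_herm_fun lipschitz_from_deriv[where f' = "\<lambda>x. 1 / x"])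
    (auto intro!: derivative_eq_intros continuous_intros)

lemma continuous_on_mat_powr: "continuous_on posdef (\<lambda>A. mat_powr A t)"
  unfolding mat_powr_def
  by (intro continuous_on_herm_fun lipschitz_from_deriv[where f' = "\<lambda>x. t * x powr (t - 1)"])
    (auto intro!: derivative_eq_intros continuous_intros)

subsection \<open>Comparison of logarithms and powers\<close>

text \<open>Shift both logarithms by s: the difference h has the difference of the resolvent sums as
  derivative, so it decreases, and it tends to 0 at infinity. Hence h 0 is nonnegative.\<close>

lemma sum_ln_compare:
  fixes a w :: "'i::finite \<Rightarrow> real" and b v :: "'j::finite \<Rightarrow> real"
  assumes a: "\<And>i. 0 < a i" and b: "\<And>j. 0 < b j" and wv: "(\<Sum>i\<in>UNIV. w i) = (\<Sum>j\<in>UNIV. v j)"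
    and r: "\<And>s. 0 \<le> s \<Longrightarrow> (\<Sum>j\<in>UNIV. v j / (b j + s)) \<le> (\<Sum>i\<in>UNIV. w i / (a i + s))"
  shows "(\<Sum>i\<in>UNIV. w i * ln (a i)) \<le> (\<Sum>j\<in>UNIV. v j * ln (b j))"
proof -
  define h where "h s = (\<Sum>j\<in>UNIV. v j * ln (b j + s)) - (\<Sum>i\<in>UNIV. w i * ln (a i + s))" for s
  have *: "((\<lambda>s. ln (c + s) - ln s) \<longlongrightarrow> 0) at_top" if "c > 0" for c :: real
  proof (rule tendsto_sandwich)
    show "\<forall>\<^sub>F s in at_top. 0 \<le> ln (c + s) - ln s"
      using eventually_gt_at_top[of 0] by eventually_elim (use that in auto)
    show "\<forall>\<^sub>F s in at_top. ln (c + s) - ln s \<le> c * inverse s"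
      using eventually_gt_at_top[of 0]
    proof eventually_elim
      case (elim s)
      have "1 + c / s = (c + s) / s" using elim by (simp add: field_simps)
      then have "ln (c + s) - ln s = ln (1 + c / s)"
        using elim that by (simp add: ln_div)
      also have "\<dots> \<le> c / s" using elim that by (intro ln_add_one_self_le_self) auto
      finally show ?case by (simp add: field_simps)
    qed
    show "((\<lambda>s. c * inverse s) \<longlongrightarrow> 0) at_top"
      by (intro tendsto_mult_right_zero tendsto_inverse_0_at_top filterlim_ident)
  qed auto
  \<comment> \<open>Equal total weights allow ln s to be subtracted from every logarithm, after
    which each term tends to 0.\<close>
  have h_eq: "h s = (\<Sum>j\<in>UNIV. v j * (ln (b j + s) - ln s)) - (\<Sum>i\<in>UNIV. w i * (ln (a i + s) - ln s))" for s
    by (simp add: h_def right_diff_distrib sum_subtractf wv flip: sum_distrib_right)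
  have "(h \<longlongrightarrow> (\<Sum>j\<in>UNIV. v j * 0) - (\<Sum>i\<in>UNIV. w i * 0)) at_top"
    unfolding h_eq[abs_def] by (intro tendsto_diff tendsto_sum tendsto_mult tendsto_const * a b)
  then have lim: "(h \<longlongrightarrow> 0) at_top" by simp
  have le: "h s \<le> h 0" if s: "0 \<le> s" for s
  proof (rule DERIV_nonpos_imp_nonincreasing[OF s])
    fix x :: real assume x: "0 \<le> x"
    have pos: "a i + x > 0" "b j + x > 0" for i j using a[of i] b[of j] x by auto
    have "(h has_real_derivative (\<Sum>j\<in>UNIV. v j / (b j + x)) - (\<Sum>i\<in>UNIV. w i / (a i + x))) (at x)"
      unfolding h_def by (auto intro!: derivative_eq_intros sum.cong simp: pos)
    then show "\<exists>y. (h has_real_derivative y) (at x) \<and> y \<le> 0"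
      using r[OF x] by (intro exI conjI) auto
  qed
  have "0 \<le> h 0"
    by (rule tendsto_upperbound[OF lim]) (auto intro!: eventually_mono[OF eventually_ge_at_top[of 0]] le)
  then show ?thesis by (simp add: h_def)
qed

text \<open>u \<bullet> x is the resolvent form of A at x. Stating it through solutions of linear
  equations avoids inverses.\<close>

lemma resolvent_ln:
  fixes A :: "complex^'n^'n" and B :: "complex^'m^'m"
  assumes A: "A \<in> posdef" and B: "B \<in> posdef" and n: "norm x = norm y"
    and r: "\<And>s u w. 0 \<le> s \<Longrightarrow> A *v u + s *\<^sub>R u = x \<Longrightarrow> B *v w + s *\<^sub>R w = y \<Longrightarrow> w \<bullet> y \<le> u \<bullet> x"
  shows "qf (mat_ln A) x \<le> qf (mat_ln B) y"
proof -
  obtain U a where U: "unitary U" "\<And>i. 0 < a i" "A = ud U a" using A by (elim posdef_decomp) blast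
  obtain V b where V: "unitary V" "\<And>i. 0 < b i" "B = ud V b" using B by (elim posdef_decomp) blast
  let ?w = "\<lambda>i. (cmod ((ctranspose U *v x) $ i))\<^sup>2" and ?v = "\<lambda>i. (cmod ((ctranspose V *v y) $ i))\<^sup>2"
  have res: "ud Q d *v (ud Q (\<lambda>i. 1 / (d i + s)) *v z) + s *\<^sub>R (ud Q (\<lambda>i. 1 / (d i + s)) *v z) = z"
    if "unitary Q" "\<And>i. 0 < d i" "0 \<le> s" for Q :: "complex^'k^'k" and d s z
  proof -
    have nz: "d i + s \<noteq> 0" for i using that(2)[of i] that(3) by linarith
    have "ud Q d *v (ud Q (\<lambda>i. 1 / (d i + s)) *v z) + s *\<^sub>R (ud Q (\<lambda>i. 1 / (d i + s)) *v z)
      = (ud Q d ** ud Q (\<lambda>i. 1 / (d i + s)) + s *\<^sub>R ud Q (\<lambda>i. 1 / (d i + s))) *v z"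
      by (simp add: matrix_vector_mul_assoc matrix_vector_mult_add_rdistrib matrix_vector_scaleR_left)
    also have "ud Q d ** ud Q (\<lambda>i. 1 / (d i + s)) + s *\<^sub>R ud Q (\<lambda>i. 1 / (d i + s)) = ud Q (\<lambda>i. 1)"
      using that nz by (simp add: ud_mult ud_scaleR ud_add flip: add_divide_distrib)
    finally show ?thesis by (simp add: ud_const that)
  qed
  have "(\<Sum>i\<in>UNIV. ?w i * ln (a i)) \<le> (\<Sum>j\<in>UNIV. ?v j * ln (b j))"
  proof (rule sum_ln_compare)
    show "(\<Sum>i\<in>UNIV. ?w i) = (\<Sum>j\<in>UNIV. ?v j)"
      using U V n by (simp add: sum_weights_unitary)
    fix s :: real assume s: "0 \<le> s"
    have "(ud V (\<lambda>i. 1 / (b i + s)) *v y) \<bullet> y \<le> (ud U (\<lambda>i. 1 / (a i + s)) *v x) \<bullet> x"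
      unfolding U(3) V(3) using U V s by (intro r[OF s]) (simp_all add: U(3) V(3) res)
    then show "(\<Sum>j\<in>UNIV. ?v j / (b j + s)) \<le> (\<Sum>i\<in>UNIV. ?w i / (a i + s))"
      by (simp add: inner_commute[of _ y] inner_commute[of _ x] qf_ud)
  qed (use U V in auto)
  then show ?thesis using U V by (simp add: mat_ln_ud qf_ud mult.commute)
qed

text \<open>Inversion reverses the order: expand \<open>qf P (u - y)\<close>, which is nonnegative.
  The comparison of P with Q enters only at the solution y.\<close>

lemma solution_compare:
  assumes P: "ctranspose P = P" "\<And>z. 0 \<le> qf P z" and u: "P *v u = x" and y: "Q *v y = x"
    and le: "qf P y \<le> qf Q y"
  shows "y \<bullet> x \<le> u \<bullet> x"
proof -
  have "0 \<le> qf P (u - y)" by (rule P)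
  also have "\<dots> = qf P u - u \<bullet> (P *v y) - y \<bullet> (P *v u) + qf P y"
    by (simp add: matrix_vector_mult_diff_distrib inner_diff_left inner_diff_right)
  also have "u \<bullet> (P *v y) = y \<bullet> x" using P(1) u by (metis inner_matrix_vector_right inner_commute)
  finally show ?thesis using le u y by simp
qed

lemma posdef_qf_nonneg: "A \<in> posdef \<Longrightarrow> 0 \<le> qf A x"
  by (cases "x = 0") (auto simp: posdef_iff less_imp_le)

lemma mat_ln_mono:
  assumes A: "A \<in> posdef" and B: "B \<in> posdef" and le: "\<And>x. x \<bullet> (A *v x) \<le> qf B x"
  shows "qf (mat_ln A) x \<le> qf (mat_ln B) x"
proof (rule resolvent_ln[OF A B refl])
  fix s u w assume s: "0 \<le> s" and u: "A *v u + s *\<^sub>R u = x" and w: "B *v w + s *\<^sub>R w = x"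
  let ?P = "A + s *\<^sub>R mat 1" and ?Q = "B + s *\<^sub>R mat 1"
  show "w \<bullet> x \<le> u \<bullet> x"
  proof (rule solution_compare[of ?P _ _ ?Q])
    show "ctranspose ?P = ?P" using A by (simp add: ctranspose_add ctranspose_scaleR posdef_ctranspose)
    show "0 \<le> qf ?P z" for z
      using posdef_qf_nonneg[OF A, of z] s
      by (simp add: matrix_vector_mult_add_rdistrib matrix_vector_scaleR_left inner_add_right)
    show "?P *v u = x" "?Q *v w = x"
      using u w by (simp_all add: matrix_vector_mult_add_rdistrib matrix_vector_scaleR_left)
    show "qf ?P w \<le> qf ?Q w"
      using le[of w] by (simp add: matrix_vector_mult_add_rdistrib inner_add_right)
  qed
qed

lemma herm_fun_eigenvector:
  assumes A: "hermitian A" and v: "A *v v = l *\<^sub>R v"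
  shows "herm_fun f A *v v = f l *\<^sub>R v"
proof -
  obtain U d where U: "unitary U" "A = ud U d" using A by (elim spectral_theorem)
  define y where "y = ctranspose U *v v"
  have vy: "v = U *v y" using U by (simp add: y_def unitary_cancel_vec)
  have dy: "real_diag g *v y = ctranspose U *v (ud U g *v v)" for g
    unfolding ud_def y_def using U
    by (metis matrix_vector_mul_assoc unitary_cancel_vec(1))
  have "real_diag d *v y = l *\<^sub>R y"
    using v U by (simp add: dy matrix_vector_scaleR_right) (simp add: y_def)
  then have "d i = l \<or> y $ i = 0" for i
    unfolding vec_eq_iff by (auto simp: real_diag_vec scaleR_conv_of_real[where 'a=complex])
  then have "f (d i) = f l \<or> y $ i = 0" for i by metis
  then have "real_diag (f \<circ> d) *v y = f l *\<^sub>R y"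
    unfolding vec_eq_iff by (auto simp add: real_diag_vec scaleR_conv_of_real[where 'a=complex])
  moreover have "herm_fun f A *v v = U *v (real_diag (f \<circ> d) *v y)"
    using U by (simp add: herm_fun_ud dy unitary_cancel_vec)
  ultimately show ?thesis by (simp add: vy matrix_vector_scaleR_right)
qed

lemma mat_powr_eigenvector: "A \<in> posdef \<Longrightarrow> A *v v = l *\<^sub>R v \<Longrightarrow> mat_powr A t *v v = (l powr t) *\<^sub>R v"
  unfolding mat_powr_def by (rule herm_fun_eigenvector) (auto simp: posdef_hermitian)

lemma qf_ud_le_iff: "unitary U \<Longrightarrow> (\<forall>x. x \<bullet> (ud U d *v x) \<le> c * (x \<bullet> x)) \<longleftrightarrow> (\<forall>i. d i \<le> c)"
proof (intro iffI allI)
  assume U: "unitary U"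
  fix i assume "\<forall>x. x \<bullet> (ud U d *v x) \<le> c * (x \<bullet> x)"
  then have "qf (ud U d) (column i U) \<le> c * (column i U \<bullet> column i U)" by blast
  then show "d i \<le> c" using U by (simp add: qf_column dot_square_norm norm_column)
next
  fix x assume U: "unitary U" and d: "\<forall>i. d i \<le> c"
  have "qf (ud U d) x \<le> (\<Sum>i\<in>UNIV. c * (cmod ((ctranspose U *v x) $ i))\<^sup>2)"
    unfolding qf_ud using d by (intro sum_mono mult_right_mono) auto
  also have "\<dots> = c * (x \<bullet> x)"
    using U by (simp add: sum_weights_unitary dot_square_norm flip: sum_distrib_left)
  finally show "qf (ud U d) x \<le> c * (x \<bullet> x)" .
qed

lemma qf_ud_ge_iff: "unitary U \<Longrightarrow> (\<forall>x. c * (x \<bullet> x) \<le> qf (ud U d) x) \<longleftrightarrow> (\<forall>i. c \<le> d i)"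
  using qf_ud_le_iff[of U "\<lambda>i. - d i" "- c"]
  by (simp add: ud_minus[symmetric] bounded_bilinear.minus_left[OF bounded_bilinear_matrix_vector_mult])

text \<open>The resolvent identity \<open>(\<lambda> W\<^sup>-\<^sup>1\<^sup>/\<^sup>2 B W\<^sup>-\<^sup>1\<^sup>/\<^sup>2 + s) u = v\<close> becomes \<open>(B + (s / \<lambda>) W) w = v\<close> for
  \<open>w = \<lambda>\<^sup>1\<^sup>/\<^sup>2 W\<^sup>-\<^sup>1\<^sup>/\<^sup>2 u\<close>, and \<open>B + (s / \<lambda>) W\<close> is dominated by \<open>B + s\<close>.\<close>

lemma mat_ln_congruence_top:
  assumes W: "W \<in> posdef" and B: "B \<in> posdef" and lam: "0 < lam" "W *v v = lam *\<^sub>R v"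
    and le: "\<And>x. x \<bullet> (W *v x) \<le> lam * (x \<bullet> x)"
  shows "qf (mat_ln (whiten W B)) v
    \<le> qf (mat_ln B) v - ln lam * (v \<bullet> v)"
proof -
  define R where "R = mat_powr W (-1/2)"
  define H where "H = mat_powr W (1/2)"
  define c where "c = sqrt lam"
  have c: "c > 0" "c * c = lam" using lam by (auto simp: c_def)
  have HR: "H ** R = mat 1" using mat_powr_cancel[OF W, of "1/2"] by (simp add: H_def R_def)
  have WR: "W ** R = H" using mat_powr_add[OF W, of 1 "-1/2"] W by (simp add: H_def R_def)
  have R: "R \<in> posdef" using W by (simp add: R_def)
  have N: "R ** B ** R \<in> posdef" using B R by (rule posdef_congruence_posdef)
  have Hv: "H *v v = c *\<^sub>R v"
    unfolding H_def using mat_powr_eigenvector[OF W lam(2), of "1/2"] lam by (simp add: c_def powr_half_sqrt)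
  have Rv: "R *v v = (1 / c) *\<^sub>R v"
    unfolding R_def using mat_powr_eigenvector[OF W lam(2), of "-1/2"] lam
    by (simp add: c_def powr_minus powr_half_sqrt field_simps)
  have "qf (mat_ln (lam *\<^sub>R (R ** B ** R))) v \<le> qf (mat_ln B) v"
  proof (rule resolvent_ln[OF posdef_scaleR[OF N lam(1)] B refl])
    fix s u w assume s: "0 \<le> s" and u: "(lam *\<^sub>R (R ** B ** R)) *v u + s *\<^sub>R u = v" and w: "B *v w + s *\<^sub>R w = v"
    define z where "z = c *\<^sub>R (R *v u)"
    let ?P = "B + (s / lam) *\<^sub>R W" and ?Q = "B + s *\<^sub>R mat 1"
    have "H *v v = lam *\<^sub>R (B *v (R *v u)) + s *\<^sub>R (H *v u)"
      unfolding u[symmetric]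
      by (simp add: matrix_vector_right_distrib matrix_vector_scaleR_right matrix_vector_scaleR_left
          matrix_vector_mul_assoc matrix_mul_assoc HR)
    then have e: "c *\<^sub>R v = lam *\<^sub>R (B *v (R *v u)) + s *\<^sub>R (H *v u)" by (simp add: Hv)
    have WRu: "W *v (R *v u) = H *v u" by (simp add: matrix_vector_mul_assoc WR)
    have "c * (c * s) / lam = s" using c(2) lam by (simp flip: mult.assoc)
    then have "c *\<^sub>R (?P *v z) = lam *\<^sub>R (B *v (R *v u)) + s *\<^sub>R (H *v u)"
      using c lam by (simp add: z_def matrix_vector_mult_add_rdistrib matrix_vector_scaleR_left matrix_vector_scaleR_right
         WRu scaleR_add_right)
    then have Pz: "?P *v z = v" using e c by (metis less_numeral_extra(3) scaleR_cancel_left)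
    have "w \<bullet> v \<le> z \<bullet> v"
    proof (rule solution_compare[of ?P _ _ ?Q])
      show "ctranspose ?P = ?P" using B W by (simp add: ctranspose_add ctranspose_scaleR posdef_ctranspose)
      show "0 \<le> qf ?P x" for x
        using posdef_qf_nonneg[OF B, of x] posdef_qf_nonneg[OF W, of x] s lam
        by (simp add: matrix_vector_mult_add_rdistrib matrix_vector_scaleR_left inner_add_right)
      have "(s / lam) * qf W w \<le> (s / lam) * (lam * (w \<bullet> w))"
        using s lam le by (intro mult_left_mono) auto
      then show "qf ?P w \<le> qf ?Q w"
        using lam by (simp add: matrix_vector_mult_add_rdistrib matrix_vector_scaleR_left inner_add_right)
      show "?P *v z = v" by (rule Pz)
      show "?Q *v w = v" using w by (simp add: matrix_vector_mult_add_rdistrib matrix_vector_scaleR_left)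
    qed
    also have "z \<bullet> v = c * (u \<bullet> (R *v v))"
      using R by (simp add: z_def inner_matrix_vector_left posdef_ctranspose)
    also have "\<dots> = u \<bullet> v" using c by (simp add: Rv)
    finally show "w \<bullet> v \<le> u \<bullet> v" .
  qed
  then show ?thesis using N lam unfolding R_def[symmetric]
    by (simp add: mat_ln_scaleR matrix_vector_mult_add_rdistrib matrix_vector_scaleR_left inner_add_right)
qed

lemma mat_powr_inverse_congruence:
  assumes "W \<in> posdef" "B \<in> posdef"
  shows "mat_powr (mat_powr W s ** B ** mat_powr W s) (-1) = mat_powr W (- s) ** mat_powr B (-1) ** mat_powr W (- s)"
proof (rule mat_powr_neg_1_unique)
  show "mat_powr W s ** B ** mat_powr W s \<in> posdef" using assms by (simp add: posdef_congruence_posdef)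
  have "mat_powr W (- s) ** mat_powr B (- 1) ** mat_powr W (- s) ** (mat_powr W s ** B ** mat_powr W s)
     = mat_powr W (- s) ** (mat_powr B (- 1) ** (mat_powr W (- s) ** mat_powr W s) ** B) ** mat_powr W s"
    by (simp only: matrix_mul_assoc)
  also have "\<dots> = mat_powr W (- s) ** (mat_powr B (- 1) ** B) ** mat_powr W s"
    using assms by (simp add: mat_powr_cancel)
  also have "mat_powr B (- 1) ** B = mat 1" using mat_powr_cancel(2)[of B 1] assms by simp
  finally show "mat_powr W (- s) ** mat_powr B (- 1) ** mat_powr W (- s) ** (mat_powr W s ** B ** mat_powr W s) = mat 1"
    using assms by (simp add: mat_powr_cancel)
qed

lemma matrix_vector_minus_left: "(- A) *v x = - (A *v (x :: complex^'n))"
  using bounded_bilinear.minus_left[OF bounded_bilinear_matrix_vector_mult] .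

text \<open>The bound at the top eigenvalue, applied to the inverses of W and B: 1 / lam is the
  largest eigenvalue of the inverse of W, and inversion negates the logarithm.\<close>

lemma mat_ln_congruence_bottom:
  assumes W: "W \<in> posdef" and B: "B \<in> posdef" and lam: "0 < lam" "W *v v = lam *\<^sub>R v"
    and le: "\<And>x. lam * (x \<bullet> x) \<le> qf W x"
  shows "qf (mat_ln B) v - ln lam * (v \<bullet> v) \<le>
    qf (mat_ln (whiten W B)) v"
proof -
  let ?W = "mat_powr W (-1)" and ?B = "mat_powr B (-1)"
  obtain U d where U: "unitary U" "\<And>i. 0 < d i" "W = ud U d" using W by (elim posdef_decomp) blast
  have "\<forall>i. lam \<le> d i" using qf_ud_ge_iff[OF U(1), of lam d] le unfolding U(3) by blast
  then have "\<forall>i. d i powr - 1 \<le> 1 / lam"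
    using U(2) lam by (auto simp: powr_minus_divide less_imp_le intro!: divide_left_mono)
  then have le': "qf ?W x \<le> (1 / lam) * (x \<bullet> x)" for x
    using qf_ud_le_iff[OF U(1), of "\<lambda>i. d i powr - 1" "1 / lam"] U by (simp add: mat_powr_ud)
  have "qf (mat_ln (mat_powr ?W (-1/2) ** ?B ** mat_powr ?W (-1/2))) v
    \<le> qf (mat_ln ?B) v - ln (1 / lam) * (v \<bullet> v)"
    using W B lam le' mat_powr_eigenvector[OF W lam(2), of "-1"]
    by (intro mat_ln_congruence_top) (auto simp: powr_minus_divide)
  also have "mat_powr ?W (-1/2) ** ?B ** mat_powr ?W (-1/2) = mat_powr (whiten W B) (-1)"
    using mat_powr_inverse_congruence[OF W B, of "-1/2"] W by (simp add: mat_powr_powr)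
  finally show ?thesis
    using W B lam by (simp add: mat_ln_powr posdef_congruence_posdef matrix_vector_minus_left ln_div)
qed

text \<open>Jensen's inequality for the probability weights that the unit vector u gives to the
  eigenvalues of N; the tangent of ln at the mean c is the affine majorant.\<close>

lemma mat_ln_jensen:
  assumes N: "N \<in> posdef" and u: "norm u = 1"
  shows "qf (mat_ln N) u \<le> ln (qf N u)"
proof -
  obtain U d where U: "unitary U" "\<And>i. 0 < d i" "N = ud U d" using N by (elim posdef_decomp) blast
  let ?w = "\<lambda>i. (cmod ((ctranspose U *v u) $ i))\<^sup>2"
  define c where "c = qf N u"
  have c: "c > 0" using N u by (auto simp: c_def posdef_iff) (metis norm_zero zero_neq_one)
  have w1: "(\<Sum>i\<in>UNIV. ?w i) = 1" using sum_weights_unitary[OF U(1), of u] u by simp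
  have "qf (mat_ln N) u = (\<Sum>i\<in>UNIV. ln (d i) * ?w i)"
    using U by (simp add: mat_ln_ud qf_ud)
  also have "\<dots> \<le> (\<Sum>i\<in>UNIV. (d i / c - 1 + ln c) * ?w i)"
  proof (intro sum_mono mult_right_mono)
    fix i
    have "ln (d i / c) \<le> d i / c - 1" using U(2)[of i] c by (intro ln_le_minus_one) auto
    then show "ln (d i) \<le> d i / c - 1 + ln c" using U(2)[of i] c by (simp add: ln_div)
  qed auto
  also have "\<dots> = (\<Sum>i\<in>UNIV. d i * ?w i) / c + (ln c - 1) * (\<Sum>i\<in>UNIV. ?w i)"
    by (simp add: sum_divide_distrib sum_distrib_left flip: sum.distrib) (simp add: algebra_simps)
  also have "(\<Sum>i\<in>UNIV. d i * ?w i) = c" by (simp add: c_def U qf_ud)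
  finally show ?thesis using c by (simp add: w1 c_def)
qed

section \<open>Hansen's inequality\<close>

lemma closed_midpoint_interval:
  fixes S :: "real set"
  assumes S: "closed S" "a \<in> S" "b \<in> S" and mid: "\<And>x y. x \<in> S \<Longrightarrow> y \<in> S \<Longrightarrow> (x + y) / 2 \<in> S"
    and t: "a \<le> t" "t \<le> b"
  shows "t \<in> S"
proof (rule ccontr)
  assume nt: "t \<notin> S"
  define l where "l = Sup (S \<inter> {..t})"
  define r where "r = Inf (S \<inter> {t..})"
  have bd: "bdd_above (S \<inter> {..t})" "bdd_below (S \<inter> {t..})" by auto
  have "l \<in> S \<inter> {..t}" unfolding l_def
    using S t bd by (intro closed_contains_Sup) auto
  moreover have "r \<in> S \<inter> {t..}" unfolding r_def
    using S t bd by (intro closed_contains_Inf) auto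
  ultimately have lr: "l \<in> S" "r \<in> S" "l < t" "t < r" using nt by (auto simp: order.order_iff_strict)
  \<comment> \<open>l and r are the nearest points of S on the two sides of t, but their midpoint is
    in S and lies strictly between them.\<close>
  then have m: "(l + r) / 2 \<in> S" by (intro mid)
  show False
  proof (cases "(l + r) / 2 \<le> t")
    case True
    then have "(l + r) / 2 \<le> l" unfolding l_def using m bd by (intro cSup_upper) (auto simp: l_def[symmetric])
    then show False using lr by simp
  next
    case False
    then have "r \<le> (l + r) / 2" unfolding r_def using m bd by (intro cInf_lower) (auto simp: r_def[symmetric])
    then show False using lr by simp
  qed
qed

lemma inner_posdef_commute: "A \<in> posdef \<Longrightarrow> x \<bullet> (A *v y) = (A *v x) \<bullet> y"
  by (simp add: inner_matrix_vector_right posdef_ctranspose)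

lemma qf_le_of_normalized:
  assumes N: "N \<in> posdef"
    and le: "\<And>x. x \<bullet> (whiten N M *v x) \<le> x \<bullet> x"
  shows "qf M x \<le> qf N x"
proof -
  let ?R = "mat_powr N (-1/2)" and ?H = "mat_powr N (1/2)"
  have RH: "?R ** ?H = mat 1" using mat_powr_cancel[OF N, of "1/2"] by simp
  have Rv: "?R *v (?H *v x) = x" unfolding matrix_vector_mul_assoc RH by simp
  have "qf (?R ** M ** ?R) (?H *v x) = (?R *v (?H *v x)) \<bullet> (M *v (?R *v (?H *v x)))"
    using N by (simp add: inner_posdef_commute flip: matrix_vector_mul_assoc)
  then have "qf M x \<le> (?H *v x) \<bullet> (?H *v x)" using le[of "?H *v x"] unfolding Rv by simp
  also have "\<dots> = qf (?H ** ?H) x"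
    using N by (simp add: inner_posdef_commute flip: matrix_vector_mul_assoc)
  finally show ?thesis using N by (simp add: mat_powr_half)
qed

lemma qf_mat_powr_continuous:
  assumes "A \<in> posdef"
  shows "continuous_on UNIV (\<lambda>t. x \<bullet> (mat_powr A t *v x))"
proof -
  obtain U d where U: "unitary U" "\<And>i. 0 < d i" "A = ud U d" using assms by (elim posdef_decomp) blast
  have "d i \<noteq> 0" for i using U(2)[of i] by simp
  then show ?thesis using U by (simp add: mat_powr_ud qf_ud) (intro continuous_intros, auto)
qed

text \<open>The exponents \<open>t\<close> for which \<open>C A\<^sup>t C \<le> (C A C)\<^sup>t\<close> holds form a closed set that contains 1 and 2
  and is stable under midpoints.\<close>

lemma hansen_midpoint:
  assumes A: "A \<in> posdef" and C: "C \<in> posdef"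
    and t: "\<And>x. x \<bullet> (C ** mat_powr A t ** C *v x) \<le> qf (mat_powr (C ** A ** C) t) x"
    and r: "\<And>x. x \<bullet> (C ** mat_powr A r ** C *v x) \<le> qf (mat_powr (C ** A ** C) r) x"
  shows "qf (C ** mat_powr A ((t + r) / 2) ** C) x \<le> qf (mat_powr (C ** A ** C) ((t + r) / 2)) x"
proof (rule qf_le_of_normalized)
  define B where "B = C ** A ** C"
  have B: "B \<in> posdef" using A C by (simp add: B_def posdef_congruence_posdef)
  define M where "M = C ** mat_powr A ((t + r) / 2) ** C"
  define N where "N = mat_powr B ((t + r) / 2)"
  have M: "M \<in> posdef" using A C by (simp add: M_def posdef_congruence_posdef)
  have N: "N \<in> posdef" using B by (simp add: N_def)
  show "mat_powr (C ** A ** C) ((t + r) / 2) \<in> posdef" using N by (simp add: N_def B_def)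
  let ?R = "mat_powr N (-1/2)" and ?H = "mat_powr N (1/2)"
  have HR: "?H ** ?R = mat 1" using mat_powr_cancel[OF N, of "1/2"] by simp
  have "?R ** M ** ?R \<in> posdef" using M N by (simp add: posdef_congruence_posdef)
  \<comment> \<open>It suffices to bound by 1 each eigenvalue k i of the normalized matrix.\<close>
  then obtain U k where U: "unitary U" "?R ** M ** ?R = ud U k" by (elim posdef_decomp) blast
  have "k i \<le> 1" for i
  proof -
    define v where "v = column i U"
    define u where "u = ?R *v v"
    define q where "q = qf (mat_powr B r) u"
    \<comment> \<open>Chosen so that both x \<bullet> (N *v u) and
      \<open>qf (mat_powr B t) x\<close> equal q. Writing M as the product of C A^(t/2) and A^(r/2)
      C, Cauchy-Schwarz between x and u then bounds k i * q by q.\<close>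
    define x where "x = mat_powr B ((r - t) / 2) *v u"
    have Hu: "?H *v u = v" unfolding u_def matrix_vector_mul_assoc HR by simp
    have "v \<noteq> 0" using norm_column[OF U(1), of i] by (auto simp: v_def)
    then have "u \<noteq> 0" using Hu by auto
    then have q: "q > 0" using B using posdef_mat_powr[OF B, of r] by (simp add: q_def posdef_iff)
    have "M *v u = ?H *v ((?R ** M ** ?R) *v v)"
      unfolding u_def matrix_vector_mul_assoc matrix_mul_assoc HR by simp
    also have "\<dots> = k i *\<^sub>R (?H *v (?H *v u))"
      using U by (simp add: Hu v_def ud_column matrix_vector_scaleR_right)
    also have "?H *v (?H *v u) = N *v u"
      using N by (simp add: matrix_vector_mul_assoc mat_powr_half)
    finally have Mu: "M *v u = k i *\<^sub>R (N *v u)" .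
    have Bq: "x \<bullet> (N *v u) = q"
    proof -
      have "x \<bullet> (N *v u) = u \<bullet> ((mat_powr B ((r - t) / 2) ** N) *v u)"
        using B by (simp add: x_def inner_posdef_commute flip: matrix_vector_mul_assoc)
      also have "mat_powr B ((r - t) / 2) ** N = mat_powr B r"
        unfolding N_def mat_powr_add[OF B] by (simp flip: add_divide_distrib)
      finally show ?thesis by (simp add: q_def)
    qed
    have Bx: "qf (mat_powr B t) x = q"
    proof -
      have "qf (mat_powr B t) x = u \<bullet> ((mat_powr B ((r - t) / 2) ** mat_powr B t ** mat_powr B ((r - t) / 2)) *v u)"
        using B by (simp add: x_def inner_posdef_commute flip: matrix_vector_mul_assoc)
      also have "mat_powr B ((r - t) / 2) ** mat_powr B t ** mat_powr B ((r - t) / 2) = mat_powr B r"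
        unfolding mat_powr_add[OF B] by (simp add: field_simps)
      finally show ?thesis by (simp add: q_def)
    qed
    have sq: "(norm (mat_powr A (p / 2) *v (C *v z)))\<^sup>2 = qf (C ** mat_powr A p ** C) z" for p z
    proof -
      have "C ** mat_powr A p ** C = C ** mat_powr A (p/2) ** (mat_powr A (p/2) ** C)"
        using A by (simp add: mat_powr_add matrix_mul_assoc flip: matrix_mul_assoc[of C "mat_powr A (p/2)" "mat_powr A (p/2)"])
      then show ?thesis
        using A C by (simp add: inner_posdef_commute flip: dot_square_norm matrix_vector_mul_assoc)
    qed
    have "k i * q = x \<bullet> (M *v u)" by (simp add: Mu Bq)
    also have "\<dots> = (mat_powr A (t / 2) *v (C *v x)) \<bullet> (mat_powr A (r / 2) *v (C *v u))"
    proof -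
      have "M = C ** mat_powr A (t/2) ** (mat_powr A (r/2) ** C)"
        using A unfolding M_def by (simp add: mat_powr_add matrix_mul_assoc add_divide_distrib flip: matrix_mul_assoc[of C "mat_powr A (t/2)" "mat_powr A (r/2)"])
      then show ?thesis
        using A C by (simp add: inner_posdef_commute flip: matrix_vector_mul_assoc)
    qed
    also have "\<dots> \<le> norm (mat_powr A (t / 2) *v (C *v x)) * norm (mat_powr A (r / 2) *v (C *v u))"
      by (rule norm_cauchy_schwarz)
    also have "\<dots> \<le> sqrt q * sqrt q"
    proof (intro mult_mono)
      show "norm (mat_powr A (t / 2) *v (C *v x)) \<le> sqrt q"
        using t[of x] Bx by (intro real_le_rsqrt) (simp add: sq B_def)
      show "norm (mat_powr A (r / 2) *v (C *v u)) \<le> sqrt q"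
        using r[of u] by (intro real_le_rsqrt) (simp add: sq B_def q_def)
    qed (use q in auto)
    finally have "k i * q \<le> q" using q by simp
    then show "k i \<le> 1" using q by simp
  qed
  then have "qf (?R ** M ** ?R) x \<le> x \<bullet> x" for x
    unfolding U using qf_ud_le_iff[OF U(1), of k 1] by simp
  then show "x \<bullet> (mat_powr (mat_powr (C ** A ** C) ((t + r) / 2)) (- 1 / 2) ** (C ** mat_powr A ((t + r) / 2) ** C) **
     mat_powr (mat_powr (C ** A ** C) ((t + r) / 2)) (- 1 / 2) *v x) \<le> x \<bullet> x" for x
    by (simp add: M_def N_def B_def)
qed

lemma hansen:
  assumes A: "A \<in> posdef" and C: "C \<in> posdef" and ge: "\<And>x. x \<bullet> x \<le> (C *v x) \<bullet> (C *v x)"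
    and t: "1 \<le> t" "t \<le> 2"
  shows "qf (C ** mat_powr A t ** C) x \<le> qf (mat_powr (C ** A ** C) t) x"
proof -
  define B where "B = C ** A ** C"
  have B: "B \<in> posdef" using A C by (simp add: B_def posdef_congruence_posdef)
  define S where "S = {t. \<forall>x. x \<bullet> (C ** mat_powr A t ** C *v x) \<le> qf (mat_powr B t) x}"
  have eq: "qf (C ** mat_powr A t ** C) x = qf (mat_powr A t) (C *v x)" for x t
    using C by (simp add: inner_posdef_commute flip: matrix_vector_mul_assoc)
  have "t \<in> S"
  proof (rule closed_midpoint_interval[of S 1 2])
    show "closed S"
      unfolding S_def eq
      by (intro closed_Collect_all closed_Collect_le qf_mat_powr_continuous A B)
    show "1 \<in> S" using A B by (simp add: S_def B_def)
    have two: "mat_powr P 2 = P ** P" if "P \<in> posdef" for P :: "complex^'a^'a"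
      using mat_powr_add[OF that, of 1 1] that by simp
    \<comment> \<open>At exponent 2 the right side is C A C^2 A C, and C^2 \<ge> 1 can be inserted
      between the two factors A.\<close>
    have "qf (mat_powr A 2) (C *v x) \<le> qf (mat_powr B 2) x" for x
    proof -
      have "qf (mat_powr A 2) (C *v x) = (A *v (C *v x)) \<bullet> (A *v (C *v x))"
        using A by (simp add: two inner_posdef_commute flip: matrix_vector_mul_assoc)
      also have "\<dots> \<le> (C *v (A *v (C *v x))) \<bullet> (C *v (A *v (C *v x)))" by (rule ge)
      also have "\<dots> = (B *v x) \<bullet> (B *v x)" by (simp add: B_def matrix_vector_mul_assoc matrix_mul_assoc)
      also have "\<dots> = qf (mat_powr B 2) x"
        using B by (simp add: two inner_posdef_commute flip: matrix_vector_mul_assoc)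
      finally show ?thesis .
    qed
    then show "2 \<in> S" by (simp add: S_def eq)
    show "(x + y) / 2 \<in> S" if "x \<in> S" "y \<in> S" for x y
      using that hansen_midpoint[OF A C, of x y] by (auto simp: S_def B_def)
  qed (use t in auto)
  then show ?thesis by (simp add: S_def B_def)
qed

section \<open>Decreasing enumerations, determinants and traces of logarithms\<close>

lemma decreasing_enumeration:
  fixes d :: "'n::finite \<Rightarrow> real"
  obtains e where "bij_betw e {..<CARD('n)} UNIV" "\<And>i j. i \<le> j \<Longrightarrow> j < CARD('n) \<Longrightarrow> d (e j) \<le> d (e i)"
proof -
  obtain l :: "'n list" where l: "set l = UNIV" "distinct l" using finite_distinct_list[of "UNIV :: 'n set"] finite[of "UNIV :: 'n set"] by blast
  define xs where "xs = sort_key (\<lambda>i. - d i) l"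
  have xs: "set xs = UNIV" "distinct xs" "length xs = CARD('n)"
    using l distinct_card[of l] by (auto simp: xs_def)
  have "bij_betw (\<lambda>i. xs ! i) {..<CARD('n)} UNIV"
    using bij_betw_nth[OF xs(2), of "{..<CARD('n)}" UNIV] xs by simp
  moreover have "d (xs ! j) \<le> d (xs ! i)" if "i \<le> j" "j < CARD('n)" for i j
  proof -
    have "sorted (map (\<lambda>i. - d i) xs)" by (simp add: xs_def)
    from sorted_nth_mono[OF this, of i j] show ?thesis using that xs by simp
  qed
  ultimately show ?thesis by (rule that)
qed

lemma det_ud:
  assumes U: "unitary U"
  shows "det (ud U d) = of_real (\<Prod>i\<in>UNIV. d i)"
proof -
  have "det U * det (ctranspose U) = 1"
    using unitary_right[OF U] by (simp flip: det_mul)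
  moreover have "det (real_diag d :: complex^'a^'a) = of_real (\<Prod>i\<in>UNIV. d i)"
    by (subst det_diagonal) (auto simp: real_diag_nth)
  ultimately show ?thesis
    by (simp add: ud_def det_mul mult_ac)
qed

lemma det_eq_exp_trace_ln:
  assumes "A \<in> posdef"
  shows "det A = of_real (exp (Re (trace (mat_ln A))))"
proof -
  obtain U d where U: "unitary U" "\<And>i. 0 < d i" "A = ud U d" using assms by (elim posdef_decomp) blast
  have "(\<Prod>i\<in>UNIV. d i) = exp (\<Sum>i\<in>UNIV. ln (d i))"
    using U(2) by (simp add: exp_sum)
  then show ?thesis
    using U by (simp add: det_ud mat_ln_ud trace_ud)
qed

text \<open>Logarithms of noncommuting factors do not add, but their traces do, because the
  determinant is multiplicative.\<close>

lemma trace_mat_ln_congruence: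
  assumes A: "A \<in> posdef" and S: "S \<in> posdef"
  shows "Re (trace (mat_ln (S ** A ** S))) = 2 * Re (trace (mat_ln S)) + Re (trace (mat_ln A))"
proof -
  have "complex_of_real (exp (Re (trace (mat_ln (S ** A ** S))))) = det S * det A * det S"
    using A S by (simp add: posdef_congruence_posdef det_mul flip: det_eq_exp_trace_ln)
  also have "\<dots> = of_real (exp (2 * Re (trace (mat_ln S)) + Re (trace (mat_ln A))))"
    using A S by (simp add: det_eq_exp_trace_ln mult_exp_exp flip: of_real_mult)
  finally show ?thesis by (simp only: of_real_eq_iff exp_inj_iff)
qed

subsection \<open>Monotonicity of the gradient of the squared distance\<close>

text \<open>This is \<open>whiten Z A\<close> for the diagonal Z with entries exp (x i), so x is the
  diagonal of \<open>mat_ln Z\<close>.\<close>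

definition exp_conj :: "('n \<Rightarrow> real) \<Rightarrow> complex^'n^'n \<Rightarrow> complex^'n^'n" where
  "exp_conj x A = real_diag (\<lambda>i. exp (- x i / 2)) ** A ** real_diag (\<lambda>i. exp (- x i / 2))"

text \<open>Only the case y = x is wanted. With two separate arguments the relation is additive in
  each of them, which reduces it to indicator functions.\<close>

definition gradient_mono :: "('n::finite \<Rightarrow> real) \<Rightarrow> ('n \<Rightarrow> real) \<Rightarrow> bool" where
  "gradient_mono x y \<longleftrightarrow> (\<forall>A\<in>posdef. (\<Sum>i\<in>UNIV. y i * Re (mat_ln (exp_conj x A) $ i $ i))
     \<le> (\<Sum>i\<in>UNIV. y i * Re (mat_ln A $ i $ i)) - (\<Sum>i\<in>UNIV. x i * y i))"

lemma posdef_real_diag: "(real_diag d :: complex^'n^'n) \<in> posdef \<longleftrightarrow> (\<forall>i. 0 < d i)"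
  using posdef_ud[of "mat 1" d] by simp

lemma posdef_exp_conj: "A \<in> posdef \<Longrightarrow> exp_conj x A \<in> posdef"
  unfolding exp_conj_def by (intro posdef_congruence_posdef) (auto simp: posdef_real_diag)

lemma exp_conj_add: "exp_conj (\<lambda>i. x i + x' i) A = exp_conj x' (exp_conj x A)"
proof -
  let ?D = "\<lambda>x. real_diag (\<lambda>i. exp (- x i / 2)) :: complex^'a^'a"
  have 1: "?D (\<lambda>i. x i + x' i) = ?D x' ** ?D x" and 2: "?D (\<lambda>i. x i + x' i) = ?D x ** ?D x'"
    by (simp_all add: real_diag_mult mult_exp_exp field_simps)
  have "exp_conj (\<lambda>i. x i + x' i) A = (?D x' ** ?D x) ** A ** (?D x ** ?D x')"
    unfolding exp_conj_def by (subst 1, subst 2) (rule refl)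
  then show ?thesis unfolding exp_conj_def by (simp only: matrix_mul_assoc)
qed

text \<open>Since the relation holds for all A, the second hypothesis may be used at
  \<open>exp_conj x A\<close>.\<close>

lemma gradient_mono_add_left:
  assumes "gradient_mono x y" "gradient_mono x' y"
  shows "gradient_mono (\<lambda>i. x i + x' i) y"
  unfolding gradient_mono_def
proof
  fix A :: "complex^'a^'a" assume A: "A \<in> posdef"
  from assms(1) A have "(\<Sum>i\<in>UNIV. y i * Re (mat_ln (exp_conj x A) $ i $ i))
     \<le> (\<Sum>i\<in>UNIV. y i * Re (mat_ln A $ i $ i)) - (\<Sum>i\<in>UNIV. x i * y i)"
    by (simp add: gradient_mono_def)
  moreover from assms(2) posdef_exp_conj[OF A, of x]
  have "(\<Sum>i\<in>UNIV. y i * Re (mat_ln (exp_conj x' (exp_conj x A)) $ i $ i))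
     \<le> (\<Sum>i\<in>UNIV. y i * Re (mat_ln (exp_conj x A) $ i $ i)) - (\<Sum>i\<in>UNIV. x' i * y i)"
    by (simp add: gradient_mono_def)
  ultimately show "(\<Sum>i\<in>UNIV. y i * Re (mat_ln (exp_conj (\<lambda>i. x i + x' i) A) $ i $ i))
     \<le> (\<Sum>i\<in>UNIV. y i * Re (mat_ln A $ i $ i)) - (\<Sum>i\<in>UNIV. (x i + x' i) * y i)"
    by (simp add: exp_conj_add distrib_right sum.distrib)
qed

lemma gradient_mono_add_right: "gradient_mono x y \<Longrightarrow> gradient_mono x y' \<Longrightarrow> gradient_mono x (\<lambda>i. y i + y' i)"
  unfolding gradient_mono_def by (fastforce simp: distrib_right distrib_left sum.distrib)

lemma gradient_mono_zero: "gradient_mono (\<lambda>_. 0) y" "gradient_mono x (\<lambda>_. 0)"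
  by (auto simp: gradient_mono_def exp_conj_def real_diag_const)

lemma gradient_mono_sum_left:
  "finite J \<Longrightarrow> (\<And>j. j \<in> J \<Longrightarrow> gradient_mono (f j) y) \<Longrightarrow> gradient_mono (\<lambda>i. \<Sum>j\<in>J. f j i) y"
  by (induction J rule: finite_induct) (auto simp: gradient_mono_zero gradient_mono_add_left)

lemma gradient_mono_sum_right:
  "finite J \<Longrightarrow> (\<And>j. j \<in> J \<Longrightarrow> gradient_mono x (f j)) \<Longrightarrow> gradient_mono x (\<lambda>i. \<Sum>j\<in>J. f j i)"
  by (induction J rule: finite_induct) (auto simp: gradient_mono_zero gradient_mono_add_right)

lemma gradient_mono_scale_right:
  assumes "gradient_mono x y" "0 \<le> c"
  shows "gradient_mono x (\<lambda>i. c * y i)"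
  unfolding gradient_mono_def
proof
  fix A :: "complex^'a^'a" assume "A \<in> posdef"
  with assms have "c * (\<Sum>i\<in>UNIV. y i * Re (mat_ln (exp_conj x A) $ i $ i))
     \<le> c * ((\<Sum>i\<in>UNIV. y i * Re (mat_ln A $ i $ i)) - (\<Sum>i\<in>UNIV. x i * y i))"
    by (intro mult_left_mono) (auto simp: gradient_mono_def)
  then show "(\<Sum>i\<in>UNIV. c * y i * Re (mat_ln (exp_conj x A) $ i $ i))
     \<le> (\<Sum>i\<in>UNIV. c * y i * Re (mat_ln A $ i $ i)) - (\<Sum>i\<in>UNIV. x i * (c * y i))"
    by (simp add: sum_distrib_left right_diff_distrib mult_ac)
qed

text \<open>A constant is a scalar congruence and shifts the logarithm. Both signs occur: the lowest
  value of x may be negative.\<close>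

lemma gradient_mono_const_left: "gradient_mono (\<lambda>_. c) y"
  unfolding gradient_mono_def
proof
  fix A :: "complex^'a^'a" assume A: "A \<in> posdef"
  have "exp_conj (\<lambda>_. c) A = exp (- c) *\<^sub>R A"
    by (simp add: exp_conj_def real_diag_const matrix_mul_scaleR_left matrix_mul_scaleR_right mult_exp_exp)
  then have "mat_ln (exp_conj (\<lambda>_. c) A) = (- c) *\<^sub>R mat 1 + mat_ln A"
    using A by (simp add: mat_ln_scaleR)
  then have "Re (mat_ln (exp_conj (\<lambda>_. c) A) $ i $ i) = Re (mat_ln A $ i $ i) - c" for i
    by (simp add: mat_def)
  then show "(\<Sum>i\<in>UNIV. y i * Re (mat_ln (exp_conj (\<lambda>_. c) A) $ i $ i))
     \<le> (\<Sum>i\<in>UNIV. y i * Re (mat_ln A $ i $ i)) - (\<Sum>i\<in>UNIV. c * y i)"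
    by (simp add: right_diff_distrib sum_subtractf mult.commute)
qed

lemma trace_exp_conj:
  fixes A :: "complex^'n^'n"
  assumes A: "A \<in> posdef"
  shows "(\<Sum>i\<in>UNIV. Re (mat_ln (exp_conj x A) $ i $ i)) = (\<Sum>i\<in>UNIV. Re (mat_ln A $ i $ i)) - (\<Sum>i\<in>UNIV. x i)"
proof -
  define S :: "complex^'n^'n" where "S = real_diag (\<lambda>i. exp (- x i / 2))"
  have S: "S \<in> posdef" by (simp add: S_def posdef_real_diag)
  have "mat_ln S = real_diag (\<lambda>i. - x i / 2)"
    using mat_ln_ud[of "mat 1" "\<lambda>i. exp (- x i / 2)"] by (simp add: S_def)
  then have "2 * Re (trace (mat_ln S)) = - (\<Sum>i\<in>UNIV. x i)"
    by (simp add: trace_def real_diag_nth sum_distrib_left sum_negf)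
  with trace_mat_ln_congruence[OF A S] show ?thesis
    by (simp add: exp_conj_def S_def trace_def)
qed

lemma gradient_mono_const_right: "gradient_mono x (\<lambda>_. c)"
  unfolding gradient_mono_def
  by (auto simp: trace_exp_conj algebra_simps simp flip: sum_distrib_left sum_distrib_right)

lemma qf_axis: "axis i 1 \<bullet> (M *v axis i 1) = Re (M $ i $ i)"
  by (simp add: inner_axis' column_mult[symmetric] column_def inner_complex_def)

text \<open>If T' is contained in T, its axis vectors are top eigenvectors of W and each diagonal
  entry drops by at least g. If T' contains T, the axis vectors outside T' are bottom eigenvectors,
  where the entries do not drop; the exact trace identity transfers this to T'.\<close>

lemma gradient_mono_indicator:
  assumes g: "0 \<le> g" and nested: "T' \<subseteq> T \<or> T \<subseteq> T'"
  shows "gradient_mono (\<lambda>i. if i \<in> T then g else 0) (\<lambda>i. if i \<in> T' then 1 else 0)"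
  unfolding gradient_mono_def
proof
  fix A :: "complex^'a^'a" assume A: "A \<in> posdef"
  let ?x = "\<lambda>i. if i \<in> T then g else 0"
  define W :: "complex^'a^'a" where "W = real_diag (\<lambda>i. exp (?x i))"
  have W: "W \<in> posdef" by (simp add: W_def posdef_real_diag)
  have "mat_powr W (-1/2) = real_diag (\<lambda>i. exp (- ?x i / 2))"
    using mat_powr_ud[of "mat 1" "\<lambda>i. exp (?x i)" "-1/2"] by (simp add: W_def powr_def)
  then have conj: "exp_conj ?x A = whiten W A"
    by (simp add: exp_conj_def)
  have ev: "W *v axis i 1 = exp (?x i) *\<^sub>R axis i 1" for i
    by (simp add: W_def vec_eq_iff real_diag_vec axis_def scaleR_conv_of_real[where 'a=complex])
  have naxis: "axis i (1::complex) \<bullet> axis i 1 = 1" for i :: 'a by (simp add: inner_axis_axis inner_complex_def)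
  let ?D = "\<lambda>i. Re (mat_ln (exp_conj ?x A) $ i $ i)" and ?L = "\<lambda>i. Re (mat_ln A $ i $ i)"
  have ind: "(\<Sum>i\<in>UNIV. (if i \<in> T' then 1 else 0) * f i) = (\<Sum>i\<in>T'. f i)" for f :: "'a \<Rightarrow> real"
    by (simp add: if_distrib[where f="\<lambda>x. x * _"] sum.If_cases cong: if_cong)
  have "(\<Sum>i\<in>T'. ?D i) \<le> (\<Sum>i\<in>T'. ?L i) - (\<Sum>i\<in>T'. ?x i)"
    using nested
  proof
    assume sub: "T' \<subseteq> T"
    have "?D i \<le> ?L i - ?x i" if "i \<in> T'" for i
    proof -
      have "\<forall>x. x \<bullet> (W *v x) \<le> exp g * (x \<bullet> x)"
        using qf_ud_le_iff[of "mat 1" "\<lambda>i. exp (?x i)" "exp g"] g by (auto simp: W_def)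
      then show ?thesis
        using mat_ln_congruence_top[OF W A, of "exp g" "axis i 1"] ev[of i] that sub
        by (simp add: conj qf_axis naxis subsetD)
    qed
    then have "(\<Sum>i\<in>T'. ?D i) \<le> (\<Sum>i\<in>T'. ?L i - ?x i)" by (rule sum_mono)
    then show ?thesis by (simp add: sum_subtractf)
  next
    assume sub: "T \<subseteq> T'"
    have "?L i \<le> ?D i" if "i \<in> - T'" for i
    proof -
      have "\<forall>x. 1 * (x \<bullet> x) \<le> qf W x"
        using qf_ud_ge_iff[of "mat 1" 1 "\<lambda>i. exp (?x i)"] g by (auto simp: W_def)
      moreover have "i \<notin> T" using that sub by auto
      ultimately show ?thesis
        using mat_ln_congruence_bottom[OF W A, of 1 "axis i 1"] ev[of i]
        by (simp add: conj qf_axis naxis)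
    qed
    then have le: "(\<Sum>i\<in>-T'. ?L i) \<le> (\<Sum>i\<in>-T'. ?D i)" by (rule sum_mono)
    have split: "(\<Sum>i\<in>UNIV. f i) = (\<Sum>i\<in>T'. f i) + (\<Sum>i\<in>-T'. f i)" for f :: "'a \<Rightarrow> real"
      using sum.union_disjoint[of T' "- T'" f] by simp
    have "(\<Sum>i\<in>-T'. ?x i) = 0" using sub by (intro sum.neutral) auto
    then show ?thesis
      using trace_exp_conj[OF A, of ?x] le unfolding split by linarith
  qed
  then show "(\<Sum>i\<in>UNIV. (if i \<in> T' then 1 else 0) * ?D i) \<le>
    (\<Sum>i\<in>UNIV. (if i \<in> T' then 1 else 0) * ?L i) - (\<Sum>i\<in>UNIV. ?x i * (if i \<in> T' then 1 else 0))"
    using ind[of ?x] by (simp add: ind mult.commute)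
qed

text \<open>A real function is a combination of the indicators of its upper level sets, which are nested.\<close>

lemma gradient_mono_self: "gradient_mono x x"
proof -
  let ?n = "CARD('a)"
  obtain e where e: "bij_betw e {..<?n} UNIV" "\<And>i j. i \<le> j \<Longrightarrow> j < ?n \<Longrightarrow> x (e j) \<le> x (e i)"
    using decreasing_enumeration[of x] by blast
  have n: "?n > 0" by simp
  \<comment> \<open>The steps between consecutive values are nonnegative; the last weight is the
    lowest value itself, belongs to the full index set and is treated as a constant.\<close>
  define g where "g j = (if Suc j < ?n then x (e j) - x (e (Suc j)) else x (e j))" for j
  define T where "T j = e ` {..j}" for j
  have T_iff: "e k \<in> T j \<longleftrightarrow> k \<le> j" if "k < ?n" "j < ?n" for k j
  proof -
    have "{..j} \<subseteq> {..<?n}" using that by auto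
    then show ?thesis using inj_on_image_mem_iff[OF bij_betw_imp_inj_on[OF e(1)], of k "{..j}"] that by (simp add: T_def)
  qed
  have tele: "(\<Sum>j\<in>{k..<?n}. g j) = x (e k)" if "k < ?n" for k
    using that
  proof (induction "?n - k" arbitrary: k)
    case (Suc m)
    show ?case
    proof (cases "Suc k < ?n")
      case True
      then have "(\<Sum>j\<in>{Suc k..<?n}. g j) = x (e (Suc k))" using Suc by (intro Suc) auto
      then show ?thesis using True Suc by (simp add: sum.atLeast_Suc_lessThan g_def)
    next
      case False
      then have "{k..<?n} = {k}" using Suc by auto
      then show ?thesis using False by (simp add: g_def)
    qed
  qed simp
  have x_eq: "x i = (\<Sum>j<?n. g j * (if i \<in> T j then 1 else 0))" for i
  proof -
    obtain k where k: "k < ?n" "i = e k" using e(1) by (metis bij_betw_iff_bijections lessThan_iff UNIV_I)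
    have "(\<Sum>j<?n. g j * (if i \<in> T j then 1 else 0)) = (\<Sum>j\<in>{k..<?n}. g j)"
      by (rule sum.mono_neutral_cong_right) (use k in \<open>auto simp: T_iff\<close>)
    then show ?thesis using tele[OF k(1)] k by simp
  qed
  have g0: "0 \<le> g j" if "Suc j < ?n" for j using that e(2)[of j "Suc j"] by (simp add: g_def)
  have T_last: "T j = UNIV" if "\<not> Suc j < ?n" "j < ?n" for j
  proof -
    have "{..j} = {..<?n}" using that by auto
    then show ?thesis using e(1) by (simp add: T_def bij_betw_def)
  qed
  have 1: "gradient_mono (\<lambda>i. g j * (if i \<in> T j then 1 else 0)) (\<lambda>i. if i \<in> T k then 1 else 0)"
    if "j < ?n" "k < ?n" for j k
  proof (cases "Suc j < ?n")
    case True
    have "T k \<subseteq> T j \<or> T j \<subseteq> T k" by (cases "k \<le> j") (auto simp: T_def)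
    then show ?thesis using gradient_mono_indicator[OF g0[OF True]] by (simp add: if_distrib[where f="\<lambda>x. _ * x"] cong: if_cong)
  next
    case False
    then show ?thesis using gradient_mono_const_left[of "g j"] T_last[of j] that by simp
  qed
  have 2: "gradient_mono x (\<lambda>i. if i \<in> T k then 1 else 0)" if "k < ?n" for k
    unfolding x_eq[abs_def] using that 1 by (intro gradient_mono_sum_left) auto
  have 3: "gradient_mono x (\<lambda>i. g k * (if i \<in> T k then 1 else 0))" if "k < ?n" for k
  proof (cases "Suc k < ?n")
    case True
    then show ?thesis using 2[of k] g0[of k] by (intro gradient_mono_scale_right) auto
  next
    case False
    then show ?thesis using gradient_mono_const_right[of x "g k"] T_last[of k] that by simp
  qed
  have "gradient_mono x (\<lambda>i. \<Sum>j<?n. g j * (if i \<in> T j then 1 else 0))"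
    using 3 by (intro gradient_mono_sum_right) auto
  then show ?thesis by (simp flip: x_eq)
qed

text \<open>\<open>gradient_mono_self\<close> in an eigenbasis of Z, with x the logarithms of the
  eigenvalues.\<close>

lemma mat_ln_gradient_mono:
  assumes Z: "Z \<in> posdef" and A: "A \<in> posdef"
  shows "mat_ln Z \<bullet> mat_ln (whiten Z A) \<le> mat_ln Z \<bullet> mat_ln A - mat_ln Z \<bullet> mat_ln Z"
proof -
  obtain U d where U: "unitary U" "\<And>i. 0 < d i" "Z = ud U d" using Z by (elim posdef_decomp) blast
  define x where "x = (\<lambda>i. ln (d i))"
  define A' where "A' = ctranspose U ** A ** U"
  have A': "A' \<in> posdef"
    unfolding A'_def using posdef_congruence[OF A, of "ctranspose U" "ctranspose U"] U by (simp add: unitary_left)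
  have AA': "A = U ** A' ** ctranspose U"
    using U by (simp add: A'_def unitary_cancel unitary_right matrix_mul_assoc flip: matrix_mul_assoc[of _ U "ctranspose U"])
  have lnZ: "mat_ln Z = ud U x" using U by (simp add: x_def mat_ln_ud)
  have Zh: "mat_powr Z (-1/2) = U ** real_diag (\<lambda>i. exp (- x i / 2)) ** ctranspose U"
    using U U(2)[THEN less_imp_neq, symmetric] unfolding ud_def[symmetric] by (simp add: x_def mat_powr_ud powr_def)
  have conj: "whiten Z A = U ** exp_conj x A' ** ctranspose U"
  proof -
    let ?D = "real_diag (\<lambda>i. exp (- x i / 2))"
    have "whiten Z A =
      U ** ?D ** (ctranspose U ** (U ** (A' ** (ctranspose U ** (U ** (?D ** ctranspose U))))))"
      unfolding Zh by (subst AA') (simp only: matrix_mul_assoc)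
    also have "\<dots> = U ** exp_conj x A' ** ctranspose U"
      unfolding unitary_cancel[OF U(1)] exp_conj_def by (simp only: matrix_mul_assoc)
    finally show ?thesis .
  qed
  have col: "qf (U ** M ** ctranspose U) (column i U) = Re (M $ i $ i)" for M i
  proof -
    have "(U ** M ** ctranspose U) *v column i U = U *v (M *v axis i 1)"
      by (simp add: column_unitary[OF U(1)] flip: matrix_vector_mul_assoc)
    then show ?thesis by (simp add: column_mult inner_unitary_vec[OF U(1)] qf_axis)
  qed
  have "mat_ln Z \<bullet> mat_ln (whiten Z A) = (\<Sum>i\<in>UNIV. x i * Re (mat_ln (exp_conj x A') $ i $ i))"
    unfolding conj mat_ln_unitary_conj[OF posdef_exp_conj[OF A'] U(1)] lnZ
    by (subst inner_commute) (simp add: inner_ud col)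
  also have "\<dots> \<le> (\<Sum>i\<in>UNIV. x i * Re (mat_ln A' $ i $ i)) - (\<Sum>i\<in>UNIV. x i * x i)"
    using gradient_mono_self[of x] A' by (auto simp: gradient_mono_def)
  also have "(\<Sum>i\<in>UNIV. x i * Re (mat_ln A' $ i $ i)) = mat_ln Z \<bullet> mat_ln A"
    unfolding lnZ AA' mat_ln_unitary_conj[OF A' U(1)]
    by (subst inner_commute) (simp add: inner_ud col)
  also have "(\<Sum>i\<in>UNIV. x i * x i) = mat_ln Z \<bullet> mat_ln Z"
    using norm_ud[OF U(1), of x] by (simp add: lnZ dot_square_norm power2_eq_square)
  finally show ?thesis .
qed

subsection \<open>The exponential metric increasing property\<close>

lemma ud_sum: "ud V d = (\<Sum>j\<in>UNIV. d j *\<^sub>R ud V (\<lambda>i. if i = j then 1 else 0))"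
proof -
  have "ud V (\<lambda>i. \<Sum>j\<in>J. d j * (if i = j then 1 else 0)) = (\<Sum>j\<in>J. d j *\<^sub>R ud V (\<lambda>i. if i = j then 1 else 0))"
    if "finite J" for J
    using that
  proof (induction J)
    case empty
    have "real_diag (\<lambda>_. 0) = (0 :: complex^'a^'a)" by (simp add: real_diag_const)
    then show ?case by (simp add: ud_def)
  next
    case (insert j J)
    then show ?case by (simp add: ud_scaleR flip: ud_add)
  qed
  note this[of UNIV, OF finite]
  moreover have "(\<lambda>i. \<Sum>j\<in>UNIV. d j * (if i = j then 1 else 0)) = d"
    by (simp add: if_distrib[where f="\<lambda>x. _ * x"] cong: if_cong)
  ultimately show ?thesis by simp
qed

lemma continuous_on_ud:
  assumes "\<And>j. continuous_on S (\<lambda>s. f s j)"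
  shows "continuous_on S (\<lambda>s. ud V (f s))"
  by (subst ud_sum) (intro continuous_intros assms)

lemma ud_has_vector_derivative:
  assumes "\<And>j. ((\<lambda>s. f s j) has_real_derivative f' j) (at x within S)"
  shows "((\<lambda>s. ud V (f s)) has_vector_derivative ud V f') (at x within S)"
  unfolding ud_sum[of V f']
  by (subst ud_sum) (intro has_vector_derivative_sum bounded_linear.has_vector_derivative[OF bounded_linear_scaleR_left]
    assms[unfolded has_real_derivative_iff_has_vector_derivative])

text \<open>At an eigenvector both terms of the product rule equal m * \<open>qf C' u\<close>, and
  the derivative of ln divides by m, so the eigenvalue drops out.\<close>

lemma ln_qf_congruence_derivative:
  assumes V: "unitary V" and M: "M \<in> posdef" and u: "norm u = 1" "M *v u = m *\<^sub>R u" "0 < m"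
  shows "((\<lambda>s. ln (qf (ud V (\<lambda>j. exp (- s * l j / 2)) ** M ** ud V (\<lambda>j. exp (- s * l j / 2))) u))
    has_real_derivative - qf (ud V l) u) (at 0)"
proof -
  let ?C = "\<lambda>s. ud V (\<lambda>j. exp (- s * l j / 2))"
  let ?p = "\<lambda>s. u \<bullet> (?C s ** M ** ?C s *v u)"
  define C' where "C' = ud V (\<lambda>j. - l j / 2)"
  have C0: "?C 0 = mat 1" using V by (simp add: ud_const)
  have 1: "(?C has_vector_derivative C') (at 0)"
    unfolding C'_def by (rule ud_has_vector_derivative) (auto intro!: derivative_eq_intros)
  have 2: "((\<lambda>s. ?C s ** M ** ?C s) has_vector_derivative (?C 0 ** M ** C' + (?C 0 ** 0 + C' ** M) ** ?C 0)) (at 0)"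
    by (intro bounded_bilinear.has_vector_derivative[OF bounded_bilinear_matrix_mult] 1 has_vector_derivative_const)
  have bl: "bounded_linear (\<lambda>X. u \<bullet> (X *v u))"
    by (intro bounded_linear_compose[OF bounded_linear_inner_right]
      bounded_bilinear.bounded_linear_left[OF bounded_bilinear_matrix_vector_mult])
  have 3: "(?p has_vector_derivative (qf (?C 0 ** M ** C' + (?C 0 ** 0 + C' ** M) ** ?C 0) u)) (at 0)"
    by (rule bounded_linear.has_vector_derivative[OF bl 2])
  have C'u: "qf C' u = - qf (ud V l) u / 2"
  proof -
    have "C' = (-1/2) *\<^sub>R ud V l" by (simp add: C'_def ud_scaleR)
    then show ?thesis by (simp add: matrix_vector_scaleR_left matrix_vector_minus_left)
  qed
  have "qf (?C 0 ** M ** C' + (?C 0 ** 0 + C' ** M) ** ?C 0) u = u \<bullet> (M *v (C' *v u)) + u \<bullet> (C' *v (M *v u))"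
    by (simp add: C0 ud_const[OF V] matrix_vector_mult_add_rdistrib inner_add_right matrix_vector_mul_assoc)
  also have "u \<bullet> (M *v (C' *v u)) = m * qf C' u"
    using M u by (simp add: inner_posdef_commute)
  also have "u \<bullet> (C' *v (M *v u)) = m * qf C' u"
    using u by (simp add: matrix_vector_scaleR_right)
  also have "m * qf C' u + m * qf C' u = - m * qf (ud V l) u"
    unfolding C'u by simp
  finally have p': "(?p has_real_derivative - m * qf (ud V l) u) (at 0)"
    using 3 by (simp add: has_real_derivative_iff_has_vector_derivative)
  have p0: "?p 0 = m" using u by (simp add: ud_const[OF V] dot_square_norm)
  have "((\<lambda>s. ln (?p s)) has_real_derivative (1 / ?p 0) * (- m * qf (ud V l) u)) (at 0)"
    by (rule DERIV_chain2[OF DERIV_ln_divide p']) (use p0 u in simp)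
  moreover have "(1 / ?p 0) * (- m * qf (ud V l) u) = - qf (ud V l) u"
    unfolding p0 using u by simp
  ultimately show ?thesis by simp
qed

text \<open>f need not be differentiable: a function touching it from below with nonnegative slope
  suffices, because such a point cannot be a maximum of f plus a strictly increasing linear
  term.\<close>

lemma le_by_lower_support:
  fixes f :: "real \<Rightarrow> real"
  assumes cont: "continuous_on {0..1} f"
    and supp: "\<And>s. 0 \<le> s \<Longrightarrow> s < 1 \<Longrightarrow>
      \<exists>B D. B 0 = f s \<and> (B has_real_derivative D) (at 0) \<and> 0 \<le> D \<and> (\<forall>h. B h \<le> f (s + h))"
  shows "f 0 \<le> f 1"
proof (rule ccontr)
  assume "\<not> f 0 \<le> f 1"
  \<comment> \<open>Half of the supposed drop: f s + k * s is still larger at 0 than at 1, which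
    excludes a maximum at 1.\<close>
  define k where "k = (f 0 - f 1) / 2"
  have k: "k > 0" using \<open>\<not> f 0 \<le> f 1\<close> by (simp add: k_def)
  have "continuous_on {0..1} (\<lambda>s. f s + k * s)" by (intro continuous_intros cont)
  then obtain s where s: "s \<in> {0..1}" "\<And>r. r \<in> {0..1} \<Longrightarrow> f r + k * r \<le> f s + k * s"
    using continuous_attains_sup[of "{0..1::real}" "\<lambda>s. f s + k * s"] by auto
  show False
  proof (cases "s < 1")
    case True
    then obtain B D where B: "B 0 = f s" "(B has_real_derivative D) (at 0)" "0 \<le> D" "\<And>h. B h \<le> f (s + h)"
      using supp[of s] s by auto
    have "((\<lambda>h. B h + k * h) has_real_derivative D + k) (at 0)"
      using B(2) by (auto intro!: derivative_eq_intros)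
    from DERIV_pos_inc_right[OF this] B(3) k obtain d where d: "d > 0" "\<And>h. h > 0 \<Longrightarrow> h < d \<Longrightarrow> B 0 < B h + k * h"
      by auto
    define h where "h = min (d / 2) (1 - s)"
    have h: "h > 0" "h < d" "s + h \<in> {0..1}" using d True s by (auto simp: h_def min_def)
    have "f s < f (s + h) + k * h" using d(2)[OF h(1,2)] B(1) B(4)[of h] by simp
    with s(2)[OF h(3)] show False by (simp add: algebra_simps)
  next
    case False
    then have "f 0 \<le> f 1 + k" using s(2)[of 0] s(1) by auto
    then show False using k unfolding k_def by (simp add: field_simps)
  qed
qed

text \<open>Along the curve \<open>M s = Z\<^sup>-\<^sup>s\<^sup>/\<^sup>2 A Z\<^sup>-\<^sup>s\<^sup>/\<^sup>2\<close>, Jensen's inequality for \<open>M\<close> and for its inverse in an eigenbasis of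
  \<open>M s\<close> yields a differentiable lower bound of the squared norm of \<open>mat_ln (M (s + h))\<close>, so that the operator
  logarithm need not be differentiated.\<close>

lemma exponential_metric_increasing:
  assumes Z: "Z \<in> posdef" and A: "A \<in> posdef"
  shows "norm (mat_ln A - mat_ln Z) \<le> norm (mat_ln (whiten Z A))"
proof -
  obtain V d where V: "unitary V" "\<And>i. 0 < d i" "Z = ud V d" using Z by (elim posdef_decomp) blast
  define l where "l = (\<lambda>i. ln (d i))"
  define L where "L = ud V l"
  have L: "mat_ln Z = L" using V by (simp add: L_def l_def mat_ln_ud)
  define C where "C s = ud V (\<lambda>j. exp (- s * l j / 2))" for s :: real
  have C_powr: "C s = mat_powr Z (- s / 2)" for s
    using V V(2)[THEN less_imp_neq, symmetric] by (simp add: C_def l_def mat_powr_ud powr_def)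
  define M where "M s = C s ** A ** C s" for s
  have Cp: "C s \<in> posdef" for s using Z by (simp add: C_powr)
  have Mp: "M s \<in> posdef" for s unfolding M_def using A Cp by (rule posdef_congruence_posdef)
  have C0: "C 0 = mat 1" using Z by (simp add: C_powr)
  have Cadd: "C s ** C h = C (s + h)" for s h
    using Z by (simp add: C_powr mat_powr_add field_simps)
  have M_add: "M (s + h) = C h ** M s ** C h" for s h
  proof -
    have "M (s + h) = C (h + s) ** A ** C (s + h)" by (simp add: M_def add.commute)
    then show ?thesis by (simp add: M_def matrix_mul_assoc flip: Cadd)
  qed
  \<comment> \<open>The correction terms are chosen so that f 0 \<le> f 1 is the claim after
    expanding the squared norm of \<open>mat_ln A - L\<close>.\<close>
  define f where "f s = (norm (mat_ln (M s)))\<^sup>2 + 2 * s * (L \<bullet> mat_ln A) - s\<^sup>2 * (L \<bullet> L)" for s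
  have "f 0 \<le> f 1"
  proof (rule le_by_lower_support)
    have "continuous_on {0..1} C" unfolding C_def by (intro continuous_on_ud continuous_intros) auto
    then have "continuous_on {0..1} M" unfolding M_def by (intro continuous_intros)
    then have "continuous_on {0..1} (\<lambda>s. mat_ln (M s))"
      by (rule continuous_on_compose2[OF continuous_on_mat_ln]) (auto simp: Mp)
    then show "continuous_on {0..1} f" unfolding f_def by (intro continuous_intros)
  next
    fix s :: real assume s: "0 \<le> s" "s < 1"
    obtain U m where U: "unitary U" "\<And>i. 0 < m i" "M s = ud U m" using Mp[of s] by (elim posdef_decomp) blast
    define u where "u i = column i U" for i
    have u: "norm (u i) = 1" "M s *v u i = m i *\<^sub>R u i" for i
      using U by (auto simp: u_def norm_column ud_column)
    define hi where "hi i h = ln (u i \<bullet> (C h ** M s ** C h *v u i))" for i h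
    define lo where "lo i h = - ln (u i \<bullet> (C (- h) ** mat_powr (M s) (-1) ** C (- h) *v u i))" for i h
    \<comment> \<open>hi bounds the diagonal entry of the moving logarithm from above and lo from
      below; the sign of its coefficient ln (m i) decides which one yields a lower bound of the
      product.\<close>
    define b where "b i = (if ln (m i) < 0 then hi i else lo i)" for i
    have Mi: "mat_powr (M s) (-1) \<in> posdef" "mat_powr (M s) (-1) *v u i = (1 / m i) *\<^sub>R u i" for i
      using Mp mat_powr_eigenvector[OF Mp u(2), of "-1"] U(2)[of i] by (auto simp: powr_minus_divide)
    have hi': "(hi i has_real_derivative - (u i \<bullet> (L *v u i))) (at 0)" for i
      unfolding hi_def C_def L_def using ln_qf_congruence_derivative[OF V(1) Mp u U(2)] by simp
    have lo': "(lo i has_real_derivative - (u i \<bullet> (L *v u i))) (at 0)" for i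
    proof -
      have "0 < 1 / m i" using U(2) by simp
      from DERIV_minus[OF ln_qf_congruence_derivative[OF V(1) Mi(1) u(1) Mi(2) this, of "\<lambda>j. - l j"]]
      show ?thesis unfolding lo_def C_def L_def
        by (simp add: ud_minus[symmetric] matrix_vector_minus_left)
    qed
    have b': "(b i has_real_derivative - (u i \<bullet> (L *v u i))) (at 0)" for i
      using hi' lo' by (simp add: b_def)
    have b0: "b i 0 = ln (m i)" for i
      using U(2)[of i] u[of i] Mi(2)[of i] by (simp add: b_def hi_def lo_def C0 dot_square_norm ln_div)
    have b_le: "ln (m i) * b i h \<le> ln (m i) * (u i \<bullet> (mat_ln (M (s + h)) *v u i))" for i h
    proof (cases "ln (m i) < 0")
      case True
      have "u i \<bullet> (mat_ln (M (s + h)) *v u i) \<le> hi i h"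
        unfolding hi_def M_add[symmetric] by (rule mat_ln_jensen[OF Mp u(1)])
      then show ?thesis using True by (auto simp: b_def intro!: mult_left_mono_neg)
    next
      case False
      have "mat_powr (M (s + h)) (-1) = C (- h) ** mat_powr (M s) (-1) ** C (- h)"
        using mat_powr_inverse_congruence[OF Z Mp, of "- h / 2" s] unfolding M_add by (simp add: C_powr)
      moreover have "mat_powr (M (s + h)) (-1) \<in> posdef" using Mp by simp
      from mat_ln_jensen[OF this u(1), of i]
      have "u i \<bullet> (mat_ln (mat_powr (M (s + h)) (-1)) *v u i) \<le> ln (u i \<bullet> (mat_powr (M (s + h)) (-1) *v u i))" .
      ultimately have "u i \<bullet> (mat_ln (mat_powr (M (s + h)) (-1)) *v u i) \<le> - lo i h"
        by (simp add: lo_def)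
      then have "lo i h \<le> u i \<bullet> (mat_ln (M (s + h)) *v u i)"
        using Mp by (simp add: mat_ln_powr matrix_vector_minus_left)
      then show ?thesis using False by (auto simp: b_def intro!: mult_left_mono)
    qed
    have lnM: "mat_ln (M s) = ud U (\<lambda>i. ln (m i))" using U by (simp add: mat_ln_ud)
    \<comment> \<open>The squared norm of P = \<open>mat_ln (M (s + h))\<close> is at least 2 (P
      \<bullet> Q) minus the squared norm of Q = \<open>mat_ln (M s)\<close>; P \<bullet> Q is
      expanded in the eigenbasis of M s and bounded by b.\<close>
    define B where "B h = 2 * (\<Sum>i\<in>UNIV. ln (m i) * b i h) - (norm (mat_ln (M s)))\<^sup>2
      + 2 * (s + h) * (L \<bullet> mat_ln A) - (s + h)\<^sup>2 * (L \<bullet> L)" for h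
    define D where "D = 2 * (\<Sum>i\<in>UNIV. ln (m i) * - (u i \<bullet> (L *v u i))) + 2 * (L \<bullet> mat_ln A) - 2 * s * (L \<bullet> L)"
    show "\<exists>B D. B 0 = f s \<and> (B has_real_derivative D) (at 0) \<and> 0 \<le> D \<and> (\<forall>h. B h \<le> f (s + h))"
    proof (intro exI[of _ B] exI[of _ D] conjI allI)
      have "(\<Sum>i\<in>UNIV. ln (m i) * ln (m i)) = (norm (mat_ln (M s)))\<^sup>2"
        unfolding lnM norm_ud[OF U(1)] by (simp add: power2_eq_square)
      then show "B 0 = f s" by (simp add: B_def f_def b0)
      show "(B has_real_derivative D) (at 0)"
        unfolding B_def D_def by (auto intro!: derivative_eq_intros b' simp: sum_distrib_left mult_ac)
      have "L \<bullet> mat_ln (M s) \<le> L \<bullet> mat_ln A - s * (L \<bullet> L)"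
      proof (cases "s = 0")
        case True
        then show ?thesis by (simp add: M_def C0)
      next
        case False
        \<comment> \<open>The gradient inequality is used for Z^s, whose logarithm is s times L, and
          then divided by s.\<close>
        have "mat_powr (mat_powr Z s) (-1/2) = C s" using Z by (simp add: C_powr mat_powr_powr)
        then have "s * (L \<bullet> mat_ln (M s)) \<le> s * (L \<bullet> mat_ln A) - s * (s * (L \<bullet> L))"
          using mat_ln_gradient_mono[of "mat_powr Z s" A] Z A by (simp add: mat_ln_powr L M_def)
        then have "s * (L \<bullet> mat_ln (M s)) \<le> s * (L \<bullet> mat_ln A - s * (L \<bullet> L))" by (simp add: right_diff_distrib)
        then show ?thesis using False s by simp
      qed
      moreover have "L \<bullet> mat_ln (M s) = (\<Sum>i\<in>UNIV. ln (m i) * (u i \<bullet> (L *v u i)))"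
        unfolding lnM inner_ud u_def ..
      ultimately show "0 \<le> D" by (simp add: D_def sum_negf)
      fix h
      have "(\<Sum>i\<in>UNIV. ln (m i) * b i h) \<le> (\<Sum>i\<in>UNIV. ln (m i) * (u i \<bullet> (mat_ln (M (s + h)) *v u i)))"
        by (intro sum_mono b_le)
      also have "\<dots> = mat_ln (M (s + h)) \<bullet> mat_ln (M s)"
        unfolding lnM inner_ud u_def ..
      finally have "(\<Sum>i\<in>UNIV. ln (m i) * b i h) \<le> mat_ln (M (s + h)) \<bullet> mat_ln (M s)" .
      moreover have "0 \<le> (norm (mat_ln (M (s + h)) - mat_ln (M s)))\<^sup>2" by simp
      ultimately show "B h \<le> f (s + h)"
        unfolding B_def f_def power2_norm_eq_inner by (simp add: inner_diff_left inner_diff_right inner_commute)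
    qed
  qed
  then have "(norm (mat_ln A))\<^sup>2 - 2 * (L \<bullet> mat_ln A) + L \<bullet> L \<le> (norm (mat_ln (M 1)))\<^sup>2"
    using A by (simp add: f_def M_def C0)
  then have "(norm (mat_ln A - L))\<^sup>2 \<le> (norm (mat_ln (M 1)))\<^sup>2"
    by (simp add: power2_norm_eq_inner inner_diff_left inner_diff_right inner_commute)
  then have "norm (mat_ln A - L) \<le> norm (mat_ln (M 1))" by (rule power2_le_imp_le) simp
  then show ?thesis by (simp add: L M_def C_powr)
qed

subsection \<open>The trace metric\<close>

lemma norm2_hermitian: "hermitian X \<Longrightarrow> norm2 X = norm X"
  by (simp add: norm2_def norm_eq_sqrt_inner inner_matrix hermitian_def)

lemma trace_dist_eq:
  assumes "A \<in> posdef" "B \<in> posdef"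
  shows "trace_dist A B = norm (mat_ln (whiten A B))"
  using assms by (simp add: trace_dist_def norm2_hermitian posdef_congruence_posdef)

lemma trace_dist_mat_1: "A \<in> posdef \<Longrightarrow> trace_dist (mat 1) A = norm (mat_ln A)"
  by (simp add: trace_dist_eq)

lemma trace_dist_nonneg: "A \<in> posdef \<Longrightarrow> B \<in> posdef \<Longrightarrow> 0 \<le> trace_dist A B"
  by (simp add: trace_dist_eq)

lemma same_gram_unitary:
  fixes S T :: "complex^'n^'n"
  assumes "invertible S" and "ctranspose T ** T = ctranspose S ** S"
  obtains U where "unitary U" "T = U ** S"
proof -
  obtain S' where S': "S ** S' = mat 1" "S' ** S = mat 1" using assms(1) by (auto simp: invertible_def)
  have "ctranspose (T ** S') ** (T ** S') = ctranspose S' ** (ctranspose T ** T) ** S'"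
    by (simp only: ctranspose_mult matrix_mul_assoc)
  also have "\<dots> = ctranspose (S ** S') ** (S ** S')"
    unfolding assms(2) by (simp only: ctranspose_mult matrix_mul_assoc)
  finally have "unitary (T ** S')" by (intro unitaryI) (simp add: S')
  moreover have "T = (T ** S') ** S" by (simp add: S' flip: matrix_mul_assoc)
  ultimately show ?thesis by (rule that)
qed

text \<open>T is any root of the inverse of Z, not necessarily Hermitian. It differs from
  \<open>mat_powr Z (-1/2)\<close> by a unitary factor on the left, which passes through the
  logarithm.\<close>

lemma mat_ln_congruence_unitary:
  fixes T Z :: "complex^'n^'n"
  assumes Z: "Z \<in> posdef" and T: "ctranspose T ** T = mat_powr Z (-1)"
  obtains U where "unitary U"
    "\<And>A. A \<in> posdef \<Longrightarrow> mat_ln (T ** A ** ctranspose T) =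
      U ** mat_ln (whiten Z A) ** ctranspose U"
proof -
  let ?R = "mat_powr Z (-1/2)"
  have R: "?R \<in> posdef" using Z by simp
  have "ctranspose T ** T = ctranspose ?R ** ?R" using T Z by (simp add: mat_powr_add)
  then obtain U where U: "unitary U" "T = U ** ?R"
    using same_gram_unitary[OF invertible_posdef[OF R]] by blast
  have "mat_ln (T ** A ** ctranspose T) = U ** mat_ln (?R ** A ** ?R) ** ctranspose U" if A: "A \<in> posdef" for A
  proof -
    have "T ** A ** ctranspose T = U ** (?R ** A ** ?R) ** ctranspose U"
      using Z by (simp only: U(2) ctranspose_mult ctranspose_mat_powr matrix_mul_assoc)
    then show ?thesis using A R U by (simp add: mat_ln_unitary_conj posdef_congruence_posdef)
  qed
  with U(1) show ?thesis by (rule that)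
qed

lemma trace_dist_congruence_root:
  fixes T Z :: "complex^'n^'n"
  assumes Z: "Z \<in> posdef" and A: "A \<in> posdef" and T: "ctranspose T ** T = mat_powr Z (-1)"
  shows "trace_dist Z A = norm (mat_ln (T ** A ** ctranspose T))"
proof -
  obtain U where U: "unitary U" "mat_ln (T ** A ** ctranspose T) =
      U ** mat_ln (whiten Z A) ** ctranspose U"
    using mat_ln_congruence_unitary[OF Z T] A by metis
  then show ?thesis using Z A by (simp add: trace_dist_eq norm_unitary_left norm_unitary_right unitary_ctranspose)
qed

text \<open>\<open>mat_powr Z (-1/2) ** S'\<close> with S' the inverse of S is a root of the inverse
  of the transformed Z and sends the transformed A to \<open>whiten Z A\<close>.\<close>

lemma trace_dist_congruence:
  fixes S :: "complex^'n^'n"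
  assumes Z: "Z \<in> posdef" and A: "A \<in> posdef" and S: "invertible S"
  shows "trace_dist (S ** Z ** ctranspose S) (S ** A ** ctranspose S) = trace_dist Z A"
proof -
  obtain S' where S': "S ** S' = mat 1" "S' ** S = mat 1" using S by (auto simp: invertible_def)
  have cS': "ctranspose S ** ctranspose S' = mat 1" "ctranspose S' ** ctranspose S = mat 1"
    using S' by (simp_all flip: ctranspose_mult)
  let ?R = "mat_powr Z (-1/2)"
  define T where "T = ?R ** S'"
  have cT: "ctranspose T = ctranspose S' ** ?R" using Z by (simp add: T_def ctranspose_mult)
  have "mat_powr (S ** Z ** ctranspose S) (-1) = ctranspose T ** T"
  proof (rule mat_powr_neg_1_unique)
    show "S ** Z ** ctranspose S \<in> posdef" using Z S by (rule posdef_congruence_invertible)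
    have "ctranspose T ** T ** (S ** Z ** ctranspose S) = ctranspose S' ** (?R ** ?R) ** (S' ** S) ** Z ** ctranspose S"
      unfolding cT unfolding T_def by (simp only: matrix_mul_assoc)
    also have "\<dots> = ctranspose S' ** (mat_powr Z (-1) ** mat_powr Z 1) ** ctranspose S"
      using Z by (simp add: S' mat_powr_add matrix_mul_assoc)
    finally show "ctranspose T ** T ** (S ** Z ** ctranspose S) = mat 1"
      using Z by (simp add: mat_powr_add cS' del: mat_powr_1)
  qed
  then have "trace_dist (S ** Z ** ctranspose S) (S ** A ** ctranspose S) =
    norm (mat_ln (T ** (S ** A ** ctranspose S) ** ctranspose T))"
    using Z A S by (intro trace_dist_congruence_root posdef_congruence_invertible) auto
  also have "T ** (S ** A ** ctranspose S) ** ctranspose T = ?R ** (S' ** S) ** A ** (ctranspose S ** ctranspose S') ** ?R"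
    unfolding cT unfolding T_def by (simp only: matrix_mul_assoc)
  finally show ?thesis unfolding S' cS' using Z A by (simp add: trace_dist_eq)
qed

lemma trace_dist_normalize:
  assumes "Z \<in> posdef" "W \<in> posdef" "A \<in> posdef"
  shows "trace_dist W A = trace_dist (mat_powr Z s ** W ** mat_powr Z s) (mat_powr Z s ** A ** mat_powr Z s)"
  using trace_dist_congruence[OF assms(2,3), of "mat_powr Z s"] assms(1)
  by (simp add: invertible_posdef)

lemma mat_powr_half_neg_cancel:
  "Z \<in> posdef \<Longrightarrow> whiten Z Z = mat 1"
  using mat_powr_add[of Z "-1/2" 1] mat_powr_add[of Z "1/2" "-1/2"] by simp

text \<open>Once Z is moved to the identity, exchanging the points inverts a matrix and only negates
  its logarithm.\<close>

lemma trace_dist_commute: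
  assumes Z: "Z \<in> posdef" and A: "A \<in> posdef"
  shows "trace_dist Z A = trace_dist A Z"
proof -
  let ?R = "mat_powr Z (-1/2)"
  have N: "?R ** A ** ?R \<in> posdef" using Z A by (simp add: posdef_congruence_posdef)
  have "trace_dist A Z = trace_dist (?R ** A ** ?R) (?R ** Z ** ?R)"
    by (rule trace_dist_normalize[OF Z A Z])
  also have "\<dots> = norm (mat_ln (mat_powr (?R ** A ** ?R) (-1)))"
    using N Z unfolding mat_powr_half_neg_cancel[OF Z] by (simp add: trace_dist_eq mat_powr_add)
  also have "\<dots> = trace_dist Z A" using N Z A by (simp add: mat_ln_powr trace_dist_eq)
  finally show ?thesis ..
qed

lemma trace_dist_ge_norm_diff:
  "Z \<in> posdef \<Longrightarrow> A \<in> posdef \<Longrightarrow> norm (mat_ln A - mat_ln Z) \<le> trace_dist Z A"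
  using exponential_metric_increasing[of Z A] by (simp add: trace_dist_eq)

text \<open>Move Y to the identity: distances from it are norms of logarithms, and the exponential
  metric inequality reduces the claim to the triangle inequality of the norm.\<close>

lemma trace_dist_triangle:
  assumes Y: "Y \<in> posdef" and Z: "Z \<in> posdef" and A: "A \<in> posdef"
  shows "trace_dist Y A \<le> trace_dist Y Z + trace_dist Z A"
proof -
  let ?c = "\<lambda>X. whiten Y X"
  have p: "?c Z \<in> posdef" "?c A \<in> posdef" using assms by (simp_all add: posdef_congruence_posdef)
  have "norm (mat_ln (?c A)) \<le> norm (mat_ln (?c Z)) + norm (mat_ln (?c A) - mat_ln (?c Z))"
    by (metis add.commute diff_add_cancel norm_triangle_ineq)
  also have "norm (mat_ln (?c A) - mat_ln (?c Z)) \<le> trace_dist (?c Z) (?c A)"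
    by (rule trace_dist_ge_norm_diff[OF p])
  also have "\<dots> = trace_dist Z A" by (rule trace_dist_normalize[OF Y Z A, symmetric])
  finally show ?thesis using assms by (simp add: trace_dist_eq)
qed

subsection \<open>Integrability\<close>

lemma prob1_prob_space: "\<mu> \<in> prob1 \<Longrightarrow> prob_space \<mu>"
  by (simp add: prob1_def)

lemma prob1_sets: "\<mu> \<in> prob1 \<Longrightarrow> sets \<mu> = sets posdef_borel"
  by (simp add: prob1_def)

lemma space_posdef_borel: "space posdef_borel = posdef"
  by (simp add: posdef_borel_def space_restrict_space)

lemma prob1_space: "\<mu> \<in> prob1 \<Longrightarrow> space \<mu> = posdef"
  using prob1_sets sets_eq_imp_space_eq space_posdef_borel by metis

lemma prob1_measurable:
  assumes "\<mu> \<in> prob1" "continuous_on posdef f"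
  shows "f \<in> borel_measurable \<mu>"
proof -
  have "f \<in> borel_measurable posdef_borel"
    unfolding posdef_borel_def using assms(2) by (rule borel_measurable_continuous_on_restrict)
  then show ?thesis using measurable_cong_sets[OF prob1_sets[OF assms(1)] refl] by blast
qed

lemma prob1_integrable_bound:
  fixes f :: "complex^'n^'n \<Rightarrow> 'b::{banach, second_countable_topology}"
  assumes "\<mu> \<in> prob1" "integrable \<mu> g" "continuous_on posdef f" "\<And>X. X \<in> posdef \<Longrightarrow> norm (f X) \<le> g X"
  shows "integrable \<mu> f"
proof (rule Bochner_Integration.integrable_bound[OF assms(2)])
  show "f \<in> borel_measurable \<mu>" using assms(1,3) by (rule prob1_measurable)
  show "AE X in \<mu>. norm (f X) \<le> norm (g X)"
    using assms(4) prob1_space[OF assms(1)] by (intro AE_I2) force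
qed

lemma continuous_on_mat_ln_congruence:
  fixes T :: "complex^'n^'n"
  assumes "invertible T"
  shows "continuous_on posdef (\<lambda>X. mat_ln (T ** X ** ctranspose T))"
  by (rule continuous_on_compose2[OF continuous_on_mat_ln])
    (auto intro!: continuous_intros posdef_congruence_invertible assms)

lemma continuous_on_trace_dist: "W \<in> posdef \<Longrightarrow> continuous_on posdef (trace_dist W)"
proof -
  assume W: "W \<in> posdef"
  have "continuous_on posdef (\<lambda>X. norm (mat_ln (mat_powr W (-1/2) ** X ** ctranspose (mat_powr W (-1/2)))))"
    using W by (intro continuous_intros continuous_on_mat_ln_congruence) (simp add: invertible_posdef)
  then show ?thesis
    by (rule continuous_on_cong[THEN iffD1, rotated -1]) (use W in \<open>auto simp: trace_dist_eq\<close>)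
qed

lemma prob1_integrable_trace_dist:
  assumes \<mu>: "\<mu> \<in> prob1" and W: "W \<in> posdef"
  shows "integrable \<mu> (trace_dist W)"
proof -
  obtain Y where Y: "Y \<in> posdef" "integrable \<mu> (\<lambda>X. trace_dist X Y)" using \<mu> by (auto simp: prob1_def)
  interpret prob_space \<mu> using \<mu> by (rule prob1_prob_space)
  show ?thesis
  proof (rule prob1_integrable_bound[OF \<mu>])
    show "integrable \<mu> (\<lambda>X. trace_dist W Y + trace_dist X Y)" using Y(2) by simp
    show "norm (trace_dist W X) \<le> trace_dist W Y + trace_dist X Y" if "X \<in> posdef" for X
      using trace_dist_triangle[OF W Y(1) that] trace_dist_commute[OF that Y(1)] trace_dist_nonneg[OF W that] by simp
  qed (rule continuous_on_trace_dist[OF W])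
qed

lemma prob1I:
  assumes "prob_space \<mu>" "sets \<mu> = sets posdef_borel" "integrable \<mu> (\<lambda>X. norm (mat_ln X))"
  shows "\<mu> \<in> prob1"
proof -
  have sp: "space \<mu> = posdef" using assms(2) sets_eq_imp_space_eq space_posdef_borel by metis
  have "integrable \<mu> (\<lambda>X. trace_dist X (mat 1))"
    using assms(3) by (rule Bochner_Integration.integrable_cong[THEN iffD1, rotated -1])
      (auto simp: sp trace_dist_mat_1 trace_dist_commute[of _ "mat 1"])
  then show ?thesis using assms(1,2) posdef_mat_1 by (auto simp: prob1_def)
qed

lemma measurable_mat_powr: "\<mu> \<in> prob1 \<Longrightarrow> (\<lambda>X. mat_powr X t) \<in> measurable \<mu> posdef_borel"
  unfolding posdef_borel_def
  by (intro measurable_restrict_space2 prob1_measurable continuous_on_mat_powr) (auto simp: prob1_space)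

text \<open>The norm of the integrand is the distance from X to the inverse of
  \<open>ctranspose T ** T\<close>, which is integrable.\<close>

lemma prob1_integrable_mat_ln_congruence:
  fixes T :: "complex^'n^'n"
  assumes \<mu>: "\<mu> \<in> prob1" and T: "invertible T"
  shows "integrable \<mu> (\<lambda>X. mat_ln (T ** X ** ctranspose T))"
proof -
  obtain T' where T': "T ** T' = mat 1" "T' ** T = mat 1" using T by (auto simp: invertible_def)
  have "T' ** ctranspose (ctranspose T) = mat 1" using T' by simp
  then have "ctranspose T ** mat 1 ** ctranspose (ctranspose T) \<in> posdef" by (intro posdef_congruence) auto
  then have P: "ctranspose T ** T \<in> posdef" by simp
  define Z where "Z = mat_powr (ctranspose T ** T) (-1)"
  have Z: "Z \<in> posdef" "ctranspose T ** T = mat_powr Z (-1)"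
    using P by (simp_all add: Z_def mat_powr_powr)
  show ?thesis
    by (rule prob1_integrable_bound[OF \<mu> prob1_integrable_trace_dist[OF \<mu> Z(1)]])
      (auto simp: continuous_on_mat_ln_congruence[OF T] trace_dist_congruence_root[OF Z(1) _ Z(2)])
qed

lemma prob1_integrable_mat_ln:
  "\<mu> \<in> prob1 \<Longrightarrow> integrable \<mu> mat_ln"
  using prob1_integrable_mat_ln_congruence[of \<mu> "mat 1"] by (simp add: invertible_posdef)

lemma measure_powr_prob1:
  assumes \<mu>: "\<mu> \<in> prob1"
  shows "measure_powr \<mu> t \<in> prob1"
proof (rule prob1I)
  interpret prob_space \<mu> using \<mu> by (rule prob1_prob_space)
  show "prob_space (measure_powr \<mu> t)"
    unfolding measure_powr_def by (intro prob_space_distr measurable_mat_powr \<mu>)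
  show "sets (measure_powr \<mu> t) = sets posdef_borel" by (simp add: measure_powr_def)
  have "continuous_on posdef (\<lambda>X. norm (mat_ln X))" by (intro continuous_intros continuous_on_mat_ln)
  then have m: "(\<lambda>X. norm (mat_ln X)) \<in> borel_measurable posdef_borel"
    unfolding posdef_borel_def by (rule borel_measurable_continuous_on_restrict)
  have "integrable \<mu> (\<lambda>X. \<bar>t\<bar> * norm (mat_ln X))"
    using prob1_integrable_mat_ln[OF \<mu>] by simp
  then have "integrable \<mu> (\<lambda>X. norm (mat_ln (mat_powr X t)))"
    by (rule Bochner_Integration.integrable_cong[THEN iffD1, rotated -1])
      (auto simp: prob1_space[OF \<mu>] mat_ln_powr)
  then show "integrable (measure_powr \<mu> t) (\<lambda>X. norm (mat_ln X))"
    unfolding measure_powr_def by (subst integrable_distr_eq[OF measurable_mat_powr[OF \<mu>] m]) auto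
qed

lemma integral_measure_powr:
  fixes f :: "complex^'n^'n \<Rightarrow> 'b::{banach, second_countable_topology}"
  assumes \<mu>: "\<mu> \<in> prob1" and f: "continuous_on posdef f"
  shows "(\<integral>X. f X \<partial>measure_powr \<mu> t) = (\<integral>X. f (mat_powr X t) \<partial>\<mu>)"
proof -
  have "f \<in> borel_measurable posdef_borel"
    unfolding posdef_borel_def using f by (rule borel_measurable_continuous_on_restrict)
  then show ?thesis unfolding measure_powr_def by (intro integral_distr measurable_mat_powr \<mu>)
qed

lemma bounded_linear_qf: "bounded_linear (\<lambda>X. x \<bullet> (X *v x))" for x :: "complex^'n"
  by (intro bounded_linear_compose[OF bounded_linear_inner_right]
      bounded_bilinear.bounded_linear_left[OF bounded_bilinear_matrix_vector_mult])

lemma qf_integral: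
  fixes f :: "'a \<Rightarrow> complex^'n^'n"
  assumes "integrable \<mu> f"
  shows "qf (\<integral>X. f X \<partial>\<mu>) x = (\<integral>X. x \<bullet> (f X *v x) \<partial>\<mu>)"
  using integral_bounded_linear[OF bounded_linear_qf assms] by simp

subsection \<open>The Karcher equation\<close>

definition karcher :: "(complex^'n^'n) measure \<Rightarrow> complex^'n^'n \<Rightarrow> bool" where
  "karcher \<mu> Z \<longleftrightarrow> Z \<in> posdef \<and> (\<integral>X. mat_ln (whiten Z X) \<partial>\<mu>) = 0"

lemma prob1_integrable_mat_ln_normalized:
  "\<mu> \<in> prob1 \<Longrightarrow> Z \<in> posdef \<Longrightarrow> integrable \<mu> (\<lambda>X. mat_ln (mat_powr Z s ** X ** mat_powr Z s))"
  using prob1_integrable_mat_ln_congruence[of \<mu> "mat_powr Z s"] by (simp add: invertible_posdef)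

text \<open>Only first moments are available, but in the factored difference of squares one factor
  is bounded by \<open>trace_dist W Y\<close>.\<close>

lemma prob1_integrable_trace_dist_sq_diff:
  assumes \<mu>: "\<mu> \<in> prob1" and W: "W \<in> posdef" and Y: "Y \<in> posdef"
  shows "integrable \<mu> (\<lambda>X. (trace_dist W X)\<^sup>2 - (trace_dist Y X)\<^sup>2)"
proof (rule prob1_integrable_bound[OF \<mu>])
  show "integrable \<mu> (\<lambda>X. trace_dist W Y * (trace_dist W X + trace_dist Y X))"
    using prob1_integrable_trace_dist[OF \<mu>] W Y by simp
  show "continuous_on posdef (\<lambda>X. (trace_dist W X)\<^sup>2 - (trace_dist Y X)\<^sup>2)"
    using W Y by (intro continuous_intros continuous_on_trace_dist)
  fix X :: "complex^'a^'a" assume X: "X \<in> posdef"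
  have "\<bar>trace_dist W X - trace_dist Y X\<bar> \<le> trace_dist W Y"
    using trace_dist_triangle[OF W Y X] trace_dist_triangle[OF Y W X] trace_dist_commute[OF W Y] by simp
  then have "\<bar>trace_dist W X - trace_dist Y X\<bar> * (trace_dist W X + trace_dist Y X) \<le>
    trace_dist W Y * (trace_dist W X + trace_dist Y X)"
    using trace_dist_nonneg[OF W X] trace_dist_nonneg[OF Y X] by (intro mult_right_mono) auto
  moreover have "\<bar>(trace_dist W X)\<^sup>2 - (trace_dist Y X)\<^sup>2\<bar> =
    \<bar>trace_dist W X - trace_dist Y X\<bar> * (trace_dist W X + trace_dist Y X)"
  proof -
    have "(trace_dist W X)\<^sup>2 - (trace_dist Y X)\<^sup>2 = (trace_dist W X - trace_dist Y X) * (trace_dist W X + trace_dist Y X)"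
      by (simp add: power2_eq_square algebra_simps)
    moreover have "0 \<le> trace_dist W X + trace_dist Y X" using trace_dist_nonneg[OF W X] trace_dist_nonneg[OF Y X] by simp
    ultimately show ?thesis by (simp add: abs_mult)
  qed
  ultimately show "norm ((trace_dist W X)\<^sup>2 - (trace_dist Y X)\<^sup>2) \<le> trace_dist W Y * (trace_dist W X + trace_dist Y X)"
    by simp
qed

text \<open>After Z is moved to the identity, the squared exponential metric inequality bounds the
  integrand from below by an expression linear in the logarithm of X, whose integral vanishes by the
  Karcher equation. The additional squared distance yields uniqueness.\<close>

lemma karcher_variance:
  assumes \<mu>: "\<mu> \<in> prob1" and Z: "karcher \<mu> Z" and W: "W \<in> posdef" and Y: "Y \<in> posdef"
  shows "(\<integral>X. (trace_dist Z X)\<^sup>2 - (trace_dist Y X)\<^sup>2 \<partial>\<mu>) + (trace_dist Z W)\<^sup>2 \<le>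
    (\<integral>X. (trace_dist W X)\<^sup>2 - (trace_dist Y X)\<^sup>2 \<partial>\<mu>)"
proof -
  interpret prob_space \<mu> using \<mu> by (rule prob1_prob_space)
  have Zp: "Z \<in> posdef" using Z by (simp add: karcher_def)
  let ?c = "\<lambda>X. whiten Z X"
  have cp: "?c X \<in> posdef" if "X \<in> posdef" for X using that Zp by (simp add: posdef_congruence_posdef)
  let ?L = "mat_ln (?c W)"
  have int: "integrable \<mu> (\<lambda>X. mat_ln (?c X))" using \<mu> Zp by (rule prob1_integrable_mat_ln_normalized)
  have "(trace_dist Z W)\<^sup>2 = (\<integral>X. (norm ?L)\<^sup>2 - 2 * (?L \<bullet> mat_ln (?c X)) \<partial>\<mu>)"
    using Zp W Z int by (simp add: trace_dist_eq karcher_def prob_space)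
  also have "\<dots> \<le> (\<integral>X. (trace_dist W X)\<^sup>2 - (trace_dist Z X)\<^sup>2 \<partial>\<mu>)"
  proof (rule integral_mono)
    show "integrable \<mu> (\<lambda>X. (norm ?L)\<^sup>2 - 2 * (?L \<bullet> mat_ln (?c X)))" using int by simp
    show "integrable \<mu> (\<lambda>X. (trace_dist W X)\<^sup>2 - (trace_dist Z X)\<^sup>2)"
      using \<mu> W Zp by (rule prob1_integrable_trace_dist_sq_diff)
    fix X assume "X \<in> space \<mu>"
    then have X: "X \<in> posdef" by (simp add: prob1_space[OF \<mu>])
    have "(norm (mat_ln (?c X) - ?L))\<^sup>2 \<le> (trace_dist (?c W) (?c X))\<^sup>2"
      using trace_dist_ge_norm_diff[OF cp[OF W] cp[OF X]] by (intro power_mono) auto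
    also have "trace_dist (?c W) (?c X) = trace_dist W X" by (rule trace_dist_normalize[OF Zp W X, symmetric])
    finally show "(norm ?L)\<^sup>2 - 2 * (?L \<bullet> mat_ln (?c X)) \<le> (trace_dist W X)\<^sup>2 - (trace_dist Z X)\<^sup>2"
      using Zp X by (simp add: trace_dist_eq power2_norm_eq_inner inner_diff_left inner_diff_right inner_commute)
  qed
  also have "\<dots> = (\<integral>X. ((trace_dist W X)\<^sup>2 - (trace_dist Y X)\<^sup>2) - ((trace_dist Z X)\<^sup>2 - (trace_dist Y X)\<^sup>2) \<partial>\<mu>)"
    by simp
  also have "\<dots> = (\<integral>X. (trace_dist W X)\<^sup>2 - (trace_dist Y X)\<^sup>2 \<partial>\<mu>) - (\<integral>X. (trace_dist Z X)\<^sup>2 - (trace_dist Y X)\<^sup>2 \<partial>\<mu>)"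
    using \<mu> W Y Zp by (intro Bochner_Integration.integral_diff prob1_integrable_trace_dist_sq_diff)
  finally show ?thesis by simp
qed

lemma trace_dist_eq_0:
  assumes Z: "Z \<in> posdef" and W: "W \<in> posdef" and 0: "trace_dist Z W = 0"
  shows "W = Z"
proof -
  let ?R = "mat_powr Z (-1/2)" and ?H = "mat_powr Z (1/2)"
  have HR: "?H ** ?R = mat 1" "?R ** ?H = mat 1" using mat_powr_cancel[OF Z, of "1/2"] by simp_all
  have "?R ** W ** ?R \<in> posdef" using Z W by (simp add: posdef_congruence_posdef)
  then have "?R ** W ** ?R = mat 1" using 0 Z W by (simp add: trace_dist_eq mat_ln_eq_0)
  then have "?H ** (?R ** W ** ?R) ** ?H = Z" using Z by (simp add: mat_powr_half)
  moreover have "?H ** (?R ** W ** ?R) ** ?H = (?H ** ?R) ** W ** (?R ** ?H)" by (simp only: matrix_mul_assoc)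
  ultimately show ?thesis by (simp only: HR) simp
qed

lemma cartan_barycenter_karcher:
  assumes \<mu>: "\<mu> \<in> prob1" and Z: "karcher \<mu> Z"
  shows "cartan_barycenter \<mu> = Z"
  unfolding cartan_barycenter_def
proof (rule the_equality)
  have Zp: "Z \<in> posdef" using Z by (simp add: karcher_def)
  show "\<forall>Y\<in>posdef. is_arg_min (\<lambda>Z. \<integral>X. (trace_dist Z X)\<^sup>2 - (trace_dist Y X)\<^sup>2 \<partial>\<mu>) (\<lambda>Z. Z \<in> posdef) Z"
  proof
    fix Y :: "complex^'a^'a" assume Y: "Y \<in> posdef"
    show "is_arg_min (\<lambda>Z. \<integral>X. (trace_dist Z X)\<^sup>2 - (trace_dist Y X)\<^sup>2 \<partial>\<mu>) (\<lambda>Z. Z \<in> posdef) Z"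
      unfolding is_arg_min_def
    proof (intro conjI notI Zp)
      assume "\<exists>W. W \<in> posdef \<and> (\<integral>X. (trace_dist W X)\<^sup>2 - (trace_dist Y X)\<^sup>2 \<partial>\<mu>) < (\<integral>X. (trace_dist Z X)\<^sup>2 - (trace_dist Y X)\<^sup>2 \<partial>\<mu>)"
      then obtain W where W: "W \<in> posdef"
        "(\<integral>X. (trace_dist W X)\<^sup>2 - (trace_dist Y X)\<^sup>2 \<partial>\<mu>) < (\<integral>X. (trace_dist Z X)\<^sup>2 - (trace_dist Y X)\<^sup>2 \<partial>\<mu>)"
        by blast
      have "0 \<le> (trace_dist Z W)\<^sup>2" by simp
      then show False using karcher_variance[OF \<mu> Z W(1) Y] W(2) by linarith
    qed
  qed
  fix W assume "\<forall>Y\<in>posdef. is_arg_min (\<lambda>Z. \<integral>X. (trace_dist Z X)\<^sup>2 - (trace_dist Y X)\<^sup>2 \<partial>\<mu>) (\<lambda>Z. Z \<in> posdef) W"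
  \<comment> \<open>With base point Y = Z the functional vanishes at Z, so a minimizer W has a
    nonpositive value, which the variance inequality turns into zero distance.\<close>
  then have "is_arg_min (\<lambda>W. \<integral>X. (trace_dist W X)\<^sup>2 - (trace_dist Z X)\<^sup>2 \<partial>\<mu>) (\<lambda>Z. Z \<in> posdef) W" using Zp by blast
  then have W: "W \<in> posdef" and
    "\<not> (\<integral>X. (trace_dist Z X)\<^sup>2 - (trace_dist Z X)\<^sup>2 \<partial>\<mu>) < (\<integral>X. (trace_dist W X)\<^sup>2 - (trace_dist Z X)\<^sup>2 \<partial>\<mu>)"
    using Zp unfolding is_arg_min_def by blast+
  then have "(trace_dist Z W)\<^sup>2 \<le> 0" using karcher_variance[OF \<mu> Z W Zp] by linarith
  then have "trace_dist Z W = 0" by simp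
  then show "W = Z" using Zp W by (rule trace_dist_eq_0[rotated 2])
qed

text \<open>Existence: on the order interval between \<open>exp (- R)\<close> and \<open>exp R\<close> the gradient field \<open>V\<close> points
  inwards at eigenvectors for the extreme eigenvalues, so a Brouwer fixed point of \<open>Z \<mapsto> proj (Z + V Z)\<close>
  is a zero of \<open>V\<close>.\<close>

lemma karcher_exists:
  fixes \<mu> :: "(complex^'n^'n) measure"
  assumes \<mu>: "\<mu> \<in> prob1"
  shows "\<exists>Z. karcher \<mu> Z"
proof -
  interpret prob_space \<mu> using \<mu> by (rule prob1_prob_space)
  define V where "V Z = (\<integral>X. mat_ln (whiten Z X) \<partial>\<mu>)" for Z
  define M where "M = (\<integral>X. mat_ln X \<partial>\<mu>)"
  obtain K where K: "K > 0" "\<And>(A::complex^'n^'n) x. norm (A *v x) \<le> norm A * norm x * K"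
    using bounded_bilinear.pos_bounded[OF bounded_bilinear_matrix_vector_mult[where 'n='n and 'm='n]] by blast
  have qf_le: "\<bar>qf A x\<bar> \<le> norm A * K * (x \<bullet> x)" for A :: "complex^'n^'n" and x
  proof -
    have "\<bar>qf A x\<bar> \<le> norm x * norm (A *v x)" by (rule Cauchy_Schwarz_ineq2)
    also have "\<dots> \<le> norm x * (norm A * norm x * K)" by (intro mult_left_mono K) auto
    finally show ?thesis by (simp add: dot_square_norm power2_eq_square mult_ac)
  qed
  \<comment> \<open>At unit vectors the mean logarithm M has form at most R - 1 in modulus, too
    little to compensate the shift R that an eigenvalue exp R or exp (- R) produces.\<close>
  define R where "R = norm M * K + 1"
  have R: "R > 0" using K by (simp add: R_def add_nonneg_pos)
  define S where "S = {Z :: complex^'n^'n. ctranspose Z = Z \<and> (\<forall>x. exp (- R) * (x \<bullet> x) \<le> qf Z x) \<and>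
     (\<forall>x. x \<bullet> (Z *v x) \<le> exp R * (x \<bullet> x))}"
  have S_ud: "ud U d \<in> S \<longleftrightarrow> (\<forall>i. exp (- R) \<le> d i \<and> d i \<le> exp R)" if "unitary U" for U d
    unfolding S_def using qf_ud_le_iff[OF that] qf_ud_ge_iff[OF that] by auto
  have S_decomp: "\<exists>U d. unitary U \<and> Z = ud U d" if "Z \<in> S" for Z
  proof -
    have "hermitian Z" using that by (simp add: S_def hermitian_def)
    then show ?thesis by (elim spectral_theorem) blast
  qed
  have S_posdef: "Z \<in> posdef" if Z: "Z \<in> S" for Z
  proof -
    obtain U d where U: "unitary U" "Z = ud U d" using S_decomp[OF Z] by blast
    have "0 < d i" for i using Z S_ud[OF U(1), of d] U(2) exp_gt_zero[of "- R"] less_le_trans by blast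
    then show ?thesis using U by (simp add: posdef_ud)
  qed
  have closedS: "closed S"
    unfolding S_def
    by (intro closed_Collect_conj closed_Collect_all closed_Collect_le closed_Collect_eq continuous_intros
      linear_continuous_on bounded_linear_ctranspose)
  have convexS: "convex S"
    unfolding convex_def
  proof (intro ballI allI impI)
    fix Z W and u v :: real assume Z: "Z \<in> S" and W: "W \<in> S" and uv: "0 \<le> u" "0 \<le> v" "u + v = 1"
    have eq: "qf (u *\<^sub>R Z + v *\<^sub>R W) x = u * qf Z x + v * qf W x" for x
      by (simp add: matrix_vector_mult_add_rdistrib matrix_vector_scaleR_left inner_add_right)
    have c: "u * c + v * c = c" for c using uv(3) by (metis distrib_right mult_1)
    have "u * (exp (- R) * (x \<bullet> x)) + v * (exp (- R) * (x \<bullet> x)) \<le> qf (u *\<^sub>R Z + v *\<^sub>R W) x" for x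
      unfolding eq using Z W uv by (intro add_mono mult_left_mono) (auto simp: S_def)
    moreover have "qf (u *\<^sub>R Z + v *\<^sub>R W) x \<le> u * (exp R * (x \<bullet> x)) + v * (exp R * (x \<bullet> x))" for x
      unfolding eq using Z W uv by (intro add_mono mult_left_mono) (auto simp: S_def)
    ultimately show "u *\<^sub>R Z + v *\<^sub>R W \<in> S"
      using Z W by (simp add: S_def ctranspose_add ctranspose_scaleR c)
  qed
  have "norm Z \<le> CARD('n) * exp R" if Z: "Z \<in> S" for Z
  proof -
    obtain U d where U: "unitary U" "Z = ud U d" using S_decomp[OF Z] by blast
    then have d: "exp (- R) \<le> d i" "d i \<le> exp R" for i using Z S_ud[OF U(1)] by auto
    have "0 \<le> d i" for i using d(1)[of i] exp_gt_zero[of "- R"] by linarith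
    then have "(norm Z)\<^sup>2 \<le> (\<Sum>i\<in>(UNIV::'n set). (exp R)\<^sup>2)"
      unfolding U(2) norm_ud[OF U(1)] using d(2) by (intro sum_mono power_mono) auto
    also have "\<dots> = CARD('n) * (exp R)\<^sup>2" by simp
    also have "\<dots> \<le> CARD('n) * (CARD('n) * (exp R)\<^sup>2)"
    proof -
      have "1 * (exp R)\<^sup>2 \<le> CARD('n) * (exp R)\<^sup>2"
        by (intro mult_right_mono) (auto simp: Suc_le_eq)
      then show ?thesis by (intro mult_left_mono) auto
    qed
    finally have "(norm Z)\<^sup>2 \<le> (CARD('n) * exp R)\<^sup>2" by (simp add: power2_eq_square mult_ac)
    then show ?thesis by (rule power2_le_imp_le) simp
  qed
  then have "bounded S" unfolding bounded_iff by blast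
  with closedS have compactS: "compact S" by (simp add: compact_eq_bounded_closed)
  have "ud (mat 1) (\<lambda>_. 1) \<in> S" using S_ud[of "mat 1" "\<lambda>_. 1"] R by simp
  then have neS: "S \<noteq> {}" by blast
  have int: "integrable \<mu> (\<lambda>X. mat_ln (whiten Z X))" if "Z \<in> S" for Z
    using \<mu> S_posdef[OF that] by (rule prob1_integrable_mat_ln_normalized)
  have contV: "continuous_on S V"
  proof (rule continuous_on_sequentiallyI)
    fix u Z assume u: "\<forall>n. u n \<in> S" and Z: "Z \<in> S" and lim: "u \<longlonglongrightarrow> Z"
    have "compact (mat_ln ` S)"
      using S_posdef by (intro compact_continuous_image compactS continuous_on_subset[OF continuous_on_mat_ln]) auto
    then have "bounded (mat_ln ` S)" by (rule compact_imp_bounded)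
    then obtain c where c: "\<And>Z. Z \<in> S \<Longrightarrow> norm (mat_ln Z) \<le> c" unfolding bounded_iff by blast
    show "(\<lambda>n. V (u n)) \<longlonglongrightarrow> V Z"
      unfolding V_def
    \<comment> \<open>The majorant comes from the triangle inequality through the identity matrix; c
      bounds the distance of the compact set S from it.\<close>
    proof (rule integral_dominated_convergence[where w = "\<lambda>X. c + trace_dist (mat 1) X"])
      show "integrable \<mu> (\<lambda>X. c + trace_dist (mat 1) X)"
        using prob1_integrable_trace_dist[OF \<mu> posdef_mat_1] by simp
      show "AE X in \<mu>. (\<lambda>n. mat_ln (whiten (u n) X))
        \<longlonglongrightarrow> mat_ln (whiten Z X)"
      proof (rule AE_I2)
        fix X assume "X \<in> space \<mu>"
        then have X: "X \<in> posdef" by (simp add: prob1_space[OF \<mu>])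
        have "continuous_on posdef (\<lambda>Z. mat_ln (whiten Z X))"
          by (rule continuous_on_compose2[OF continuous_on_mat_ln])
            (auto intro!: continuous_intros continuous_on_mat_powr posdef_congruence_posdef X)
        then show "(\<lambda>n. mat_ln (whiten (u n) X))
          \<longlonglongrightarrow> mat_ln (whiten Z X)"
          by (rule continuous_on_tendsto_compose[OF _ lim]) (use Z u S_posdef in auto)
      qed
      show "AE X in \<mu>. norm (mat_ln (whiten (u n) X)) \<le> c + trace_dist (mat 1) X" for n
      proof (rule AE_I2)
        fix X assume "X \<in> space \<mu>"
        then have X: "X \<in> posdef" by (simp add: prob1_space[OF \<mu>])
        have un: "u n \<in> posdef" using u S_posdef by blast
        have "trace_dist (u n) (mat 1) \<le> c"
          using c[of "u n"] u un by (simp add: trace_dist_commute[of "u n"] trace_dist_mat_1)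
        then show "norm (mat_ln (whiten (u n) X)) \<le> c + trace_dist (mat 1) X"
          using trace_dist_triangle[OF un posdef_mat_1 X] trace_dist_eq[OF un X] by simp
      qed
      show "(\<lambda>X. mat_ln (whiten Z X)) \<in> borel_measurable \<mu>"
        "(\<lambda>X. mat_ln (whiten (u n) X)) \<in> borel_measurable \<mu>" for n
        using int Z u by (auto intro: borel_measurable_integrable)
    qed
  qed
  define f where "f Z = closest_point S (Z + V Z)" for Z
  have "continuous_on S f"
    unfolding f_def
    by (rule continuous_on_compose2[OF continuous_on_closest_point[OF convexS closedS neS, of UNIV]])
      (auto intro!: continuous_intros contV)
  moreover have "f \<in> S \<rightarrow> S" unfolding f_def using closest_point_in_set[OF closedS neS] by auto
  ultimately obtain Z where Z: "Z \<in> S" "f Z = Z"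
    using brouwer[OF compactS convexS neS] by metis
  \<comment> \<open>The fixed point property: Z is the point of S closest to Z + V Z.\<close>
  have var: "V Z \<bullet> (W - Z) \<le> 0" if "W \<in> S" for W
    using closest_point_dot[OF convexS closedS that, of "Z + V Z"] Z(2) by (simp add: f_def)
  have Zp: "Z \<in> posdef" using Z S_posdef by blast
  obtain U z where U: "unitary U" "Z = ud U z" using S_decomp Z by blast
  have z: "exp (- R) \<le> z i" "z i \<le> exp R" for i using Z S_ud[OF U(1)] U(2) by auto
  have nrm: "column i U \<bullet> column i U = 1" for i using U by (simp add: dot_square_norm norm_column)
  have Mi: "\<bar>qf M (column i U)\<bar> < R" for i
    using qf_le[of "column i U" M] nrm[of i] by (simp add: R_def)
  have Vi: "qf (V Z) (column i U) =
     (\<integral>X. column i U \<bullet> (mat_ln (whiten Z X) *v column i U) \<partial>\<mu>)" for i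
    unfolding V_def by (rule qf_integral[OF int[OF Z(1)]])
  have Mi': "qf M (column i U) = (\<integral>X. column i U \<bullet> (mat_ln X *v column i U) \<partial>\<mu>)" for i
    unfolding M_def by (rule qf_integral[OF prob1_integrable_mat_ln[OF \<mu>]])
  have intV: "integrable \<mu> (\<lambda>X. column i U \<bullet> (mat_ln (whiten Z X) *v column i U))" for i
    using integrable_bounded_linear[OF bounded_linear_qf int[OF Z(1)]] .
  have intM: "integrable \<mu> (\<lambda>X. column i U \<bullet> (mat_ln X *v column i U))" for i
    using integrable_bounded_linear[OF bounded_linear_qf prob1_integrable_mat_ln[OF \<mu>]] .
  \<comment> \<open>Test the variational inequality with Z after a single eigenvalue is moved to
    c.\<close>
  have var_i: "(c - z i) * qf (V Z) (column i U) \<le> 0" if c: "exp (- R) \<le> c" "c \<le> exp R" for c i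
  proof -
    have "ud U (z(i := c)) \<in> S" using z c by (simp add: S_ud[OF U(1)])
    moreover have "ud U (z(i := c)) - Z = ud U (\<lambda>j. if j = i then c - z i else 0)"
      unfolding U(2) ud_diff by (rule arg_cong[where f="ud U"]) auto
    ultimately have "V Z \<bullet> ud U (\<lambda>j. if j = i then c - z i else 0) \<le> 0" using var by metis
    then show ?thesis by (simp add: inner_ud if_distrib[where f="\<lambda>x. x * _"] cong: if_cong)
  qed
  have expR: "exp (- R) < exp R" using R by simp
  \<comment> \<open>If an eigenvalue were exp R, lowering it would show that V Z has nonnegative
    form at its eigenvector, whereas the top bound makes that form at most \<open>qf M\<close> minus
    R, which is negative.\<close>
  have top: "z i < exp R" for i
  proof (rule ccontr)
    assume "\<not> z i < exp R"
    then have zi: "z i = exp R" using z(2)[of i] by simp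
    have "0 \<le> qf (V Z) (column i U)"
      using var_i[of "exp (- R)" i] expR zi by (simp add: mult_le_0_iff)
    also have "\<dots> \<le> (\<integral>X. column i U \<bullet> (mat_ln X *v column i U) - R \<partial>\<mu>)"
      unfolding Vi
    proof (rule integral_mono[OF intV])
      fix X assume "X \<in> space \<mu>"
      then have X: "X \<in> posdef" by (simp add: prob1_space[OF \<mu>])
      have "qf (mat_ln (whiten Z X)) (column i U)
        \<le> qf (mat_ln X) (column i U) - ln (exp R) * (column i U \<bullet> column i U)"
        using Z(1) U by (intro mat_ln_congruence_top[OF Zp X]) (auto simp: ud_column zi[symmetric], auto simp: zi S_def)
      then show "qf (mat_ln (whiten Z X)) (column i U)
        \<le> qf (mat_ln X) (column i U) - R" by (simp add: nrm)
    qed (use intM in simp)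
    also have "\<dots> = qf M (column i U) - R"
      using intM by (simp add: Mi' prob_space)
    finally show False using Mi[of i] by simp
  qed
  have bot: "exp (- R) < z i" for i
  proof (rule ccontr)
    assume "\<not> exp (- R) < z i"
    then have zi: "z i = exp (- R)" using z(1)[of i] by simp
    have "qf M (column i U) + R = (\<integral>X. column i U \<bullet> (mat_ln X *v column i U) + R \<partial>\<mu>)"
      using intM by (simp add: Mi' prob_space)
    also have "\<dots> \<le> qf (V Z) (column i U)"
      unfolding Vi
    proof (rule integral_mono[OF _ intV])
      fix X assume "X \<in> space \<mu>"
      then have X: "X \<in> posdef" by (simp add: prob1_space[OF \<mu>])
      have "qf (mat_ln X) (column i U) - ln (exp (- R)) * (column i U \<bullet> column i U) \<le>
         qf (mat_ln (whiten Z X)) (column i U)"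
        using Z(1) U by (intro mat_ln_congruence_bottom[OF Zp X]) (auto simp: ud_column zi[symmetric], auto simp: zi S_def)
      then show "qf (mat_ln X) (column i U) + R \<le>
         qf (mat_ln (whiten Z X)) (column i U)" by (simp add: nrm)
    qed (use intM in simp)
    also have "\<dots> \<le> 0"
      using var_i[of "exp R" i] expR zi by (simp add: mult_le_0_iff)
    finally show False using Mi[of i] by simp
  qed
  define lo where "lo = Min (range z)"
  define hi where "hi = Max (range z)"
  have lo: "exp (- R) < lo" "\<And>i. lo \<le> z i" using bot by (auto simp: lo_def)
  have hi: "hi < exp R" "\<And>i. z i \<le> hi" using top by (auto simp: hi_def)
  \<comment> \<open>The spectrum of Z keeps the distance g from both endpoints, and e is small
    enough for Z + e V Z to stay in S. Testing with that point makes V Z vanish.\<close>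
  define g where "g = min (lo - exp (- R)) (exp R - hi)"
  define e where "e = g / (norm (V Z) * K + 1)"
  have g: "g > 0" using lo hi by (simp add: g_def)
  have den: "norm (V Z) * K + 1 > 0" using K by (simp add: add_nonneg_pos)
  have e: "e > 0" using g den by (simp add: e_def)
  have eK: "e * (norm (V Z) * K) \<le> g"
  proof -
    have "e * (norm (V Z) * K) \<le> e * (norm (V Z) * K + 1)" using e by (intro mult_left_mono) auto
    then show ?thesis using den by (simp add: e_def)
  qed
  have Vh: "ctranspose (V Z) = V Z"
  proof -
    have "ctranspose (V Z) = (\<integral>X. ctranspose (mat_ln (whiten Z X)) \<partial>\<mu>)"
      unfolding V_def using integral_bounded_linear[OF bounded_linear_ctranspose int[OF Z(1)]] by simp
    also have "\<dots> = V Z"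
      unfolding V_def
      by (rule Bochner_Integration.integral_cong) (auto simp: prob1_space[OF \<mu>] Zp posdef_congruence_posdef)
    finally show ?thesis .
  qed
  have "Z + e *\<^sub>R V Z \<in> S"
    unfolding S_def
  proof (intro CollectI conjI allI)
    show "ctranspose (Z + e *\<^sub>R V Z) = Z + e *\<^sub>R V Z"
      using Zp by (simp add: ctranspose_add ctranspose_scaleR Vh posdef_ctranspose)
    fix x
    have q: "qf (Z + e *\<^sub>R V Z) x = qf Z x + e * qf (V Z) x"
      by (simp add: matrix_vector_mult_add_rdistrib matrix_vector_scaleR_left inner_add_right)
    have "\<bar>e * qf (V Z) x\<bar> \<le> e * (norm (V Z) * K * (x \<bullet> x))"
      unfolding abs_mult using e qf_le by (intro mult_mono) auto
    also have "\<dots> \<le> g * (x \<bullet> x)"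
      using mult_right_mono[OF eK, of "x \<bullet> x"] by (simp add: mult.assoc)
    finally have b: "\<bar>e * qf (V Z) x\<bar> \<le> g * (x \<bullet> x)" .
    have l: "lo * (x \<bullet> x) \<le> qf Z x" using qf_ud_ge_iff[OF U(1), of lo z] lo(2) U(2) by blast
    have h: "qf Z x \<le> hi * (x \<bullet> x)" using qf_ud_le_iff[OF U(1), of z hi] hi(2) U(2) by blast
    have "exp (- R) * (x \<bullet> x) \<le> (lo - g) * (x \<bullet> x)" by (intro mult_right_mono) (auto simp: g_def)
    then show "exp (- R) * (x \<bullet> x) \<le> qf (Z + e *\<^sub>R V Z) x"
      using b l unfolding q by (simp add: left_diff_distrib abs_le_iff)
    have "(hi + g) * (x \<bullet> x) \<le> exp R * (x \<bullet> x)" by (intro mult_right_mono) (auto simp: g_def)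
    then show "qf (Z + e *\<^sub>R V Z) x \<le> exp R * (x \<bullet> x)"
      using b h unfolding q by (simp add: distrib_right abs_le_iff)
  qed
  from var[OF this] have "e * (V Z \<bullet> V Z) \<le> 0" by simp
  then have "V Z \<bullet> V Z \<le> 0" using e by (simp add: mult_le_0_iff)
  then have "V Z = 0" using inner_ge_zero[of "V Z"] inner_eq_zero_iff[of "V Z"] by linarith
  then show ?thesis using Zp by (auto simp: karcher_def V_def)
qed

lemma karcher_cartan_barycenter: "\<mu> \<in> prob1 \<Longrightarrow> karcher \<mu> (cartan_barycenter \<mu>)"
  using karcher_exists cartan_barycenter_karcher by metis

text \<open>The Karcher equation for an arbitrary root of the inverse of Z: the unitary factors move
  out of the integral.\<close>

lemma karcher_root:
  fixes T Z :: "complex^'n^'n"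
  assumes \<mu>: "\<mu> \<in> prob1" and Z: "karcher \<mu> Z" and T: "ctranspose T ** T = mat_powr Z (-1)"
  shows "(\<integral>X. mat_ln (T ** X ** ctranspose T) \<partial>\<mu>) = 0"
proof -
  have Zp: "Z \<in> posdef" using Z by (simp add: karcher_def)
  obtain U where U: "unitary U" "\<And>A. A \<in> posdef \<Longrightarrow> mat_ln (T ** A ** ctranspose T) =
      U ** mat_ln (whiten Z A) ** ctranspose U"
    using mat_ln_congruence_unitary[OF Zp T] by metis
  have bl: "bounded_linear (\<lambda>X. U ** X ** ctranspose U)"
    by (intro bounded_linear_compose[OF bounded_bilinear.bounded_linear_left[OF bounded_bilinear_matrix_mult]]
      bounded_bilinear.bounded_linear_right[OF bounded_bilinear_matrix_mult])
  have "(\<integral>X. mat_ln (T ** X ** ctranspose T) \<partial>\<mu>) =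
    (\<integral>X. U ** mat_ln (whiten Z X) ** ctranspose U \<partial>\<mu>)"
    by (rule Bochner_Integration.integral_cong) (auto simp: prob1_space[OF \<mu>] U(2))
  also have "\<dots> = U ** (\<integral>X. mat_ln (whiten Z X) \<partial>\<mu>) ** ctranspose U"
    using integral_bounded_linear[OF bl prob1_integrable_mat_ln_normalized[OF \<mu> Zp]] .
  finally show ?thesis using Z by (simp add: karcher_def)
qed

subsection \<open>The Ando--Hiai inequality\<close>

text \<open>What the argument uses of the exterior power. \<psi> plays the role of the derivative of
  \<phi> at the identity; its linearity lets it commute with the Karcher integrals.\<close>

locale matrix_representation =
  fixes \<phi> :: "complex^'n^'n \<Rightarrow> complex^'m^'m" and \<psi> :: "complex^'n^'n \<Rightarrow> complex^'m^'m"
  assumes mult: "\<phi> (A ** B) = \<phi> A ** \<phi> B"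
    and one: "\<phi> (mat 1) = mat 1"
    and adj: "\<phi> (ctranspose A) = ctranspose (\<phi> A)"
    and bounded_linear: "bounded_linear \<psi>"
    and ln: "A \<in> posdef \<Longrightarrow> mat_ln (\<phi> A) = \<psi> (mat_ln A)"
    and powr: "A \<in> posdef \<Longrightarrow> mat_powr (\<phi> A) t = \<phi> (mat_powr A t)"
begin

lemma posdef: 
  assumes A: "A \<in> posdef"
  shows "\<phi> A \<in> posdef"
proof -
  let ?H = "mat_powr A (1/2)"
  have "\<phi> ?H ** \<phi> (mat_powr A (-1/2)) = mat 1"
    using mat_powr_cancel[OF A, of "1/2"] by (simp add: one flip: mult)
  then have "invertible (\<phi> ?H)" by (rule invertible_right_inverse[THEN iffD2, OF exI])
  then have "\<phi> ?H ** mat 1 ** ctranspose (\<phi> ?H) \<in> posdef"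
    by (rule posdef_congruence_invertible[OF posdef_mat_1])
  then show ?thesis using A by (simp add: mat_powr_half flip: adj mult)
qed

lemma bounded_linear_qf_deriv: "bounded_linear (\<lambda>X. v \<bullet> (\<psi> X *v v))"
  using bounded_linear_compose[OF bounded_linear_qf[of v] bounded_linear] by simp

text \<open>Compare the Karcher integrands of the two measures at a top eigenvector v of \<phi> W0,
  where W0 is Z' whitened by X'. The integrand for Z is at most t times the one for X minus ln lam;
  both have integral 0, so lam \<le> 1. Hence \<phi> Z' \<le> \<phi> X' \<le> 1.\<close>

lemma ando_hiai_step:
  assumes \<mu>: "\<mu> \<in> prob1" and X: "karcher \<mu> X" and Z: "karcher (measure_powr \<mu> t) Z"
    and t: "1 \<le> t" "t \<le> 2" and c: "0 < c"
    and le: "\<And>x. x \<bullet> (\<phi> (c *\<^sub>R X) *v x) \<le> x \<bullet> x"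
  shows "qf (\<phi> ((c powr t) *\<^sub>R Z)) x \<le> x \<bullet> x"
proof -
  interpret prob_space \<mu> using \<mu> by (rule prob1_prob_space)
  have Xp: "X \<in> posdef" and Zp: "Z \<in> posdef" using X Z by (auto simp: karcher_def)
  define X' where "X' = c *\<^sub>R X"
  define Z' where "Z' = (c powr t) *\<^sub>R Z"
  have X'p: "X' \<in> posdef" and Z'p: "Z' \<in> posdef" using Xp Zp c by (auto simp: X'_def Z'_def posdef_scaleR)
  define R where "R = mat_powr X' (-1/2)"
  have Rp: "R \<in> posdef" using X'p by (simp add: R_def)
  define W0 where "W0 = R ** Z' ** R"
  have W0p: "W0 \<in> posdef" using Rp Z'p by (simp add: W0_def posdef_congruence_posdef)
  define Q where "Q = mat_powr W0 (-1/2)"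
  have Qp: "Q \<in> posdef" using W0p by (simp add: Q_def)
  define C where "C = \<phi> R"
  have Cp: "C \<in> posdef" using Rp by (simp add: C_def posdef)
  have \<phi>X: "\<phi> X' \<in> posdef" using X'p by (rule posdef)
  \<comment> \<open>The square of C is the inverse of \<phi> X', which is at least 1 because \<phi>
    X' \<le> 1; this is the hypothesis of Hansen's inequality.\<close>
  have C_expansive: "x \<bullet> x \<le> (C *v x) \<bullet> (C *v x)" for x
  proof -
    obtain U d where U: "unitary U" "\<And>i. 0 < d i" "\<phi> X' = ud U d" using \<phi>X by (elim posdef_decomp) blast
    have "\<forall>i. d i \<le> 1" using qf_ud_le_iff[OF U(1), of d 1] le unfolding U(3)[symmetric] X'_def by simp
    then have "\<forall>i. 1 \<le> d i powr - 1" using U(2) by (simp add: powr_minus_divide less_imp_le)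
    then have "1 * (x \<bullet> x) \<le> qf (ud U (\<lambda>i. d i powr - 1)) x"
      using qf_ud_ge_iff[OF U(1), of 1 "\<lambda>i. d i powr -1"] by blast
    also have "ud U (\<lambda>i. d i powr - 1) = mat_powr (\<phi> X') (-1)"
      using U by (simp add: mat_powr_ud)
    also have "\<dots> = C ** C"
      using X'p by (simp add: powr C_def R_def mat_powr_add flip: mult)
    finally show ?thesis using Cp by (simp add: inner_posdef_commute flip: matrix_vector_mul_assoc)
  qed
  \<comment> \<open>J1 is the Karcher integrand of \<mu> at X, where the scaling by c cancels. J3 is
    that of the powered measure at Z, up to a unitary conjugation.\<close>
  define J1 where "J1 A = mat_ln (R ** (c *\<^sub>R A) ** R)" for A
  define J3 where "J3 A = mat_ln (Q ** (R ** mat_powr (c *\<^sub>R A) t ** R) ** Q)" for A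
  have J1_eq: "J1 A = mat_ln (whiten X A)" for A
  proof -
    have "(c powr (-1/2) * c powr (-1/2)) * c = 1"
      using c by (simp add: powr_minus_divide flip: powr_add)
    then show ?thesis using Xp c
      by (simp add: J1_def R_def X'_def mat_powr_scaleR matrix_mul_scaleR_left matrix_mul_scaleR_right mult_ac)
  qed
  have intJ1: "integrable \<mu> J1"
    unfolding J1_eq[abs_def] using \<mu> Xp by (rule prob1_integrable_mat_ln_normalized)
  have J1_0: "(\<integral>A. J1 A \<partial>\<mu>) = 0" unfolding J1_eq using X by (simp add: karcher_def)
  \<comment> \<open>A root of the inverse of Z that is Hermitian only if Q and R commute. It passes
    through R, so that J1 and J3 share the inner congruence.\<close>
  define T1 where "T1 = (c powr (t/2)) *\<^sub>R (Q ** R)"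
  have cT1: "ctranspose T1 = (c powr (t/2)) *\<^sub>R (R ** Q)"
    using Qp Rp by (simp add: T1_def ctranspose_scaleR ctranspose_mult posdef_ctranspose)
  have ct: "c powr (t/2) * c powr (t/2) = c powr t" using c by (simp flip: powr_add)
  have J3_eq: "J3 A = mat_ln (T1 ** mat_powr A t ** ctranspose T1)" if "A \<in> posdef" for A
  proof -
    have "T1 ** mat_powr A t ** ctranspose T1 = (c powr t) *\<^sub>R (Q ** R ** mat_powr A t ** (R ** Q))"
      unfolding cT1 unfolding T1_def by (simp add: matrix_mul_scaleR_left matrix_mul_scaleR_right ct)
    also have "\<dots> = Q ** (R ** mat_powr (c *\<^sub>R A) t ** R) ** Q"
      using that c by (simp add: mat_powr_scaleR matrix_mul_scaleR_left matrix_mul_scaleR_right matrix_mul_assoc)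
    finally show ?thesis by (simp add: J3_def)
  qed
  have T1: "ctranspose T1 ** T1 = mat_powr Z (-1)"
  proof (rule mat_powr_neg_1_unique[OF Zp, symmetric])
    have QQ: "Q ** Q = mat_powr W0 (-1)" using W0p by (simp add: Q_def mat_powr_add)
    let ?H = "mat_powr X' (1/2)"
    have RH: "R ** ?H = mat 1" "?H ** R = mat 1"
      using mat_powr_cancel[OF X'p, of "1/2"] by (simp_all add: R_def)
    have "ctranspose T1 ** T1 ** Z = R ** (Q ** Q) ** R ** Z'"
      unfolding cT1 unfolding T1_def Z'_def
      by (simp add: matrix_mul_scaleR_left matrix_mul_scaleR_right ct matrix_mul_assoc)
    also have "\<dots> = R ** (mat_powr W0 (-1) ** (R ** Z' ** R)) ** ?H"
      unfolding QQ using RH by (simp flip: matrix_mul_assoc)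
    also have "\<dots> = R ** ?H" using mat_powr_cancel(2)[OF W0p, of 1] W0p by (simp flip: W0_def)
    finally show "ctranspose T1 ** T1 ** Z = mat 1" using RH by simp
  qed
  have T1_inv: "invertible T1"
  proof -
    have "(mat_powr Z 1 ** ctranspose T1) ** T1 = mat 1"
      using mat_powr_cancel(1)[OF Zp, of 1] by (simp add: T1 flip: matrix_mul_assoc)
    then show ?thesis using invertible_left_inverse by blast
  qed
  have "(\<integral>A. mat_ln (T1 ** A ** ctranspose T1) \<partial>measure_powr \<mu> t) = 0"
    by (rule karcher_root[OF measure_powr_prob1[OF \<mu>] Z T1])
  then have "(\<integral>A. mat_ln (T1 ** mat_powr A t ** ctranspose T1) \<partial>\<mu>) = 0"
    by (subst (asm) integral_measure_powr[OF \<mu> continuous_on_mat_ln_congruence[OF T1_inv]])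
  moreover have "(\<integral>A. J3 A \<partial>\<mu>) = (\<integral>A. mat_ln (T1 ** mat_powr A t ** ctranspose T1) \<partial>\<mu>)"
    by (rule Bochner_Integration.integral_cong) (auto simp: prob1_space[OF \<mu>] J3_eq)
  ultimately have J3_0: "(\<integral>A. J3 A \<partial>\<mu>) = 0" by simp
  have intJ3: "integrable \<mu> J3"
  proof -
    have "integrable (distr \<mu> posdef_borel (\<lambda>X. mat_powr X t)) (\<lambda>A. mat_ln (T1 ** A ** ctranspose T1))"
      using prob1_integrable_mat_ln_congruence[OF measure_powr_prob1[OF \<mu>] T1_inv] by (simp add: measure_powr_def)
    then have "integrable \<mu> (\<lambda>A. mat_ln (T1 ** mat_powr A t ** ctranspose T1))"
      by (rule integrable_distr[OF measurable_mat_powr[OF \<mu>]])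
    then show ?thesis
      by (rule Bochner_Integration.integrable_cong[THEN iffD1, rotated -1]) (auto simp: prob1_space[OF \<mu>] J3_eq)
  qed
  have W: "\<phi> W0 \<in> posdef" using W0p by (rule posdef)
  obtain U w where U: "unitary U" "\<And>i. 0 < w i" "\<phi> W0 = ud U w" using W by (elim posdef_decomp) blast
  define lam where "lam = Max (range w)"
  have w_le: "w i \<le> lam" for i by (simp add: lam_def)
  have "lam \<in> range w" unfolding lam_def by (rule Max_in) auto
  then obtain i where i: "w i = lam" by auto
  define v where "v = column i U"
  have vv: "v \<bullet> v = 1" using U by (simp add: v_def dot_square_norm norm_column)
  have lam: "lam > 0" using U(2)[of i] i by simp
  have key: "qf (\<psi> (J3 A)) v \<le> t * qf (\<psi> (J1 A)) v - Transcendental.ln lam" if A: "A \<in> posdef" for A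
  proof -
    define a where "a = c *\<^sub>R A"
    have a: "a \<in> posdef" using A c by (simp add: a_def posdef_scaleR)
    have RaR: "R ** a ** R \<in> posdef" "R ** mat_powr a t ** R \<in> posdef"
      using a Rp by (simp_all add: posdef_congruence_posdef)
    have "qf (\<psi> (J3 A)) v = v \<bullet> (mat_ln (\<phi> (Q ** (R ** mat_powr a t ** R) ** Q)) *v v)"
      unfolding J3_def a_def[symmetric] by (subst ln) (use RaR Qp in \<open>auto intro: posdef_congruence_posdef\<close>)
    also have "\<phi> (Q ** (R ** mat_powr a t ** R) ** Q) =
      mat_powr (\<phi> W0) (-1/2) ** \<phi> (R ** mat_powr a t ** R) ** mat_powr (\<phi> W0) (-1/2)"
      using powr[OF W0p, of "-1/2"] by (simp add: mult Q_def)
    also have "qf (mat_ln \<dots>) v \<le> qf (mat_ln (\<phi> (R ** mat_powr a t ** R))) v - Transcendental.ln lam * (v \<bullet> v)"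
    proof (rule mat_ln_congruence_top[OF W posdef[OF RaR(2)] lam])
      show "\<phi> W0 *v v = lam *\<^sub>R v" using U i by (simp add: v_def ud_column)
      show "qf (\<phi> W0) x \<le> lam * (x \<bullet> x)" for x
        using qf_ud_le_iff[OF U(1), of w lam] w_le U(3) by simp
    qed
    \<comment> \<open>Hansen's inequality for the expansive C = \<phi> R, followed by monotonicity
      of the logarithm.\<close>
    also have "qf (mat_ln (\<phi> (R ** mat_powr a t ** R))) v \<le> v \<bullet> (mat_ln (mat_powr (\<phi> (R ** a ** R)) t) *v v)"
    proof (rule mat_ln_mono)
      show "\<phi> (R ** mat_powr a t ** R) \<in> posdef" "mat_powr (\<phi> (R ** a ** R)) t \<in> posdef"
        using RaR by (simp_all add: posdef)
      show "qf (\<phi> (R ** mat_powr a t ** R)) x \<le> qf (mat_powr (\<phi> (R ** a ** R)) t) x" for x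
        using hansen[OF posdef[OF a] Cp C_expansive t, of x] by (simp add: mult C_def powr[OF a])
    qed
    also have "mat_ln (mat_powr (\<phi> (R ** a ** R)) t) = t *\<^sub>R \<psi> (J1 A)"
      using RaR by (simp add: mat_ln_powr posdef ln J1_def a_def)
    finally show ?thesis by (simp add: vv matrix_vector_scaleR_left)
  qed
  have int1: "integrable \<mu> (\<lambda>A. v \<bullet> (\<psi> (J1 A) *v v))" and int3: "integrable \<mu> (\<lambda>A. v \<bullet> (\<psi> (J3 A) *v v))"
    using integrable_bounded_linear[OF bounded_linear_qf_deriv] intJ1 intJ3 by auto
  have zero: "qf (\<psi> 0) v = 0"
    using linear_0[OF bounded_linear.linear[OF bounded_linear_qf_deriv[of v]]] .
  have "0 = (\<integral>A. v \<bullet> (\<psi> (J3 A) *v v) \<partial>\<mu>)"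
    using integral_bounded_linear[OF bounded_linear_qf_deriv intJ3, of v] zero by (simp add: J3_0)
  also have "\<dots> \<le> (\<integral>A. t * qf (\<psi> (J1 A)) v - Transcendental.ln lam \<partial>\<mu>)"
    using int1 int3 key by (intro integral_mono) (auto simp: prob1_space[OF \<mu>])
  also have "\<dots> = - Transcendental.ln lam"
    using integral_bounded_linear[OF bounded_linear_qf_deriv intJ1, of v] zero int1 by (simp add: J1_0 prob_space)
  finally have "lam \<le> 1" using lam by simp
  then have "\<forall>i. w i \<le> 1" using w_le order_trans by blast
  then have W_le: "qf (\<phi> W0) x \<le> x \<bullet> x" for x
    using qf_ud_le_iff[OF U(1), of w 1] U(3) by simp
  have "qf (\<phi> Z') x \<le> qf (\<phi> X') x"
  proof (rule qf_le_of_normalized[OF \<phi>X])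
    show "qf (mat_powr (\<phi> X') (-1/2) ** \<phi> Z' ** mat_powr (\<phi> X') (-1/2)) x \<le> x \<bullet> x" for x
      using W_le[of x] powr[OF X'p, of "-1/2"] by (simp add: W0_def R_def mult)
  qed
  also have "\<dots> \<le> x \<bullet> x" unfolding X'_def by (rule le)
  finally show ?thesis by (simp add: Z'_def)
qed

end

subsection \<open>Antisymmetric tensor powers\<close>

text \<open>The tensor product of one matrix for each element of 'n; a basis tensor is a function
  that assigns a coordinate to every factor.\<close>

definition tens :: "('n \<Rightarrow> complex^'n^'n) \<Rightarrow> complex^('n \<Rightarrow> 'n)^('n \<Rightarrow> 'n)" where
  "tens B = (\<chi> f g. \<Prod>i\<in>UNIV. B i $ f i $ g i)"

lemma tens_mult: "tens B ** tens B' = tens (\<lambda>i. B i ** B' i)"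
proof -
  have "(\<Sum>g\<in>UNIV. (\<Prod>i\<in>UNIV. B i $ f i $ g i) * (\<Prod>i\<in>UNIV. B' i $ g i $ h i)) =
    (\<Prod>i\<in>UNIV. \<Sum>j\<in>UNIV. B i $ f i $ j * B' i $ j $ h i)" for f h
    by (subst prod_sum_PiE) (simp_all add: prod.distrib)
  then show ?thesis by (simp add: vec_eq_iff tens_def matrix_matrix_mult_def)
qed

lemma prod_if_all: "finite I \<Longrightarrow> (\<Prod>i\<in>I. if P i then 1 else 0 :: 'a::comm_semiring_1) = (if \<forall>i\<in>I. P i then 1 else 0)"
  by (induction I rule: finite_induct) auto

lemma tens_one: "tens (\<lambda>_. mat 1) = mat 1"
  by (simp add: vec_eq_iff tens_def mat_def prod_if_all fun_eq_iff)

lemma ctranspose_tens: "ctranspose (tens B) = tens (\<lambda>i. ctranspose (B i))"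
  by (simp add: vec_eq_iff tens_def)

lemma tens_real_diag: "tens (\<lambda>i. real_diag (d i)) = real_diag (\<lambda>f. \<Prod>i\<in>UNIV. d i (f i))"
proof -
  have "(\<Prod>i\<in>UNIV. real_diag (d i) $ f i $ g i) = real_diag (\<lambda>f. \<Prod>i\<in>UNIV. d i (f i)) $ f $ g" for f g
  proof (cases "f = g")
    case False
    then obtain i where "f i \<noteq> g i" by auto
    then have "(\<Prod>i\<in>UNIV. real_diag (d i) $ f i $ g i) = 0"
      by (intro prod_zero) (auto simp: real_diag_nth)
    then show ?thesis using False by (simp add: real_diag_nth)
  qed (simp add: real_diag_nth)
  then show ?thesis by (simp add: vec_eq_iff tens_def)
qed

text \<open>The tensor power of order \<open>card S\<close>; identity factors outside S keep the
  index type the same for all orders.\<close>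

definition tens_on :: "'n set \<Rightarrow> complex^'n^'n \<Rightarrow> complex^('n \<Rightarrow> 'n)^('n \<Rightarrow> 'n)" where
  "tens_on S A = tens (\<lambda>i. if i \<in> S then A else mat 1)"

lemma tens_on_mult: "tens_on S (A ** B) = tens_on S A ** tens_on S B"
  unfolding tens_on_def tens_mult by (rule arg_cong[where f=tens]) auto

lemma tens_on_one: "tens_on S (mat 1) = mat 1"
  by (simp add: tens_on_def tens_one)

lemma ctranspose_tens_on: "ctranspose (tens_on S A) = tens_on S (ctranspose A)"
  unfolding tens_on_def ctranspose_tens by (rule arg_cong[where f=tens]) auto

lemma tens_on_real_diag: "tens_on S (real_diag d) = real_diag (\<lambda>f. \<Prod>i\<in>S. d (f i))"
proof -
  have "(\<lambda>i. if i \<in> S then real_diag d else mat 1) = (\<lambda>i. real_diag (if i \<in> S then d else (\<lambda>_. 1)))"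
    by (auto simp: real_diag_const)
  moreover have "(\<Prod>i\<in>UNIV. (if i \<in> S then d else (\<lambda>_. 1)) (f i)) = (\<Prod>i\<in>S. d (f i))" for f
    by (rule prod.mono_neutral_cong_right) auto
  ultimately show ?thesis by (simp add: tens_on_def tens_real_diag)
qed

text \<open>The derivative of \<open>tens_on S\<close> at the identity in the direction H.\<close>

definition tens_deriv :: "'n set \<Rightarrow> complex^'n^'n \<Rightarrow> complex^('n \<Rightarrow> 'n)^('n \<Rightarrow> 'n)" where
  "tens_deriv S H = (\<Sum>i\<in>S. tens (\<lambda>j. if j = i then H else mat 1))"

lemma linear_tens_single: "linear (\<lambda>H. tens (\<lambda>j. if j = i then H else mat 1))"
proof -
  have eq: "tens (\<lambda>j. if j = i then H else mat 1) $ f $ g = H $ f i $ g i * (\<Prod>j\<in>UNIV - {i}. mat 1 $ f j $ g j)"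
    for H :: "complex^'a^'a" and f g
  proof -
    have "(\<Prod>j\<in>UNIV - {i}. (if j = i then H else mat 1) $ f j $ g j) = (\<Prod>j\<in>UNIV - {i}. mat 1 $ f j $ g j)"
      by (rule prod.cong) auto
    then show ?thesis by (simp add: tens_def prod.remove[of UNIV i])
  qed
  show ?thesis
    by (rule linearI) (simp_all add: vec_eq_iff eq distrib_right)
qed

lemma linear_tens_deriv: "linear (tens_deriv S)"
  unfolding tens_deriv_def[abs_def] by (intro linear_compose_sum ballI linear_tens_single)

lemma tens_deriv_conj:
  assumes U: "unitary U"
  shows "tens_deriv S (U ** H ** ctranspose U) = tens_on S U ** tens_deriv S H ** ctranspose (tens_on S U)"
proof -
  have "tens_on S U ** tens (\<lambda>j. if j = i then H else mat 1) ** ctranspose (tens_on S U) =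
    tens (\<lambda>j. if j = i then U ** H ** ctranspose U else mat 1)" if "i \<in> S" for i
    unfolding tens_on_def ctranspose_tens tens_mult
    by (rule arg_cong[where f=tens]) (use that U in \<open>auto simp: unitary_right\<close>)
  moreover have "tens_on S U ** tens_deriv S H ** ctranspose (tens_on S U) =
    (\<Sum>i\<in>S. tens_on S U ** tens (\<lambda>j. if j = i then H else mat 1) ** ctranspose (tens_on S U))"
    unfolding tens_deriv_def
    by (simp add: bounded_bilinear.sum_left[OF bounded_bilinear_matrix_mult]
      bounded_bilinear.sum_right[OF bounded_bilinear_matrix_mult])
  ultimately show ?thesis by (simp add: tens_deriv_def)
qed

lemma tens_deriv_real_diag: "tens_deriv S (real_diag l) = real_diag (\<lambda>f. \<Sum>i\<in>S. l (f i))"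
proof -
  have "tens (\<lambda>j. if j = i then real_diag l else mat 1) = real_diag (\<lambda>f. l (f i))" for i
    using tens_on_real_diag[of "{i}" l] by (simp add: tens_on_def)
  moreover have "(\<Sum>i\<in>S. real_diag (\<lambda>f. l (f i))) = real_diag (\<lambda>f. \<Sum>i\<in>S. l (f i))"
    by (simp add: vec_eq_iff real_diag_nth)
  ultimately show ?thesis by (simp add: tens_deriv_def)
qed

definition perm_op :: "('n::finite \<Rightarrow> 'n) \<Rightarrow> complex^('n \<Rightarrow> 'n)^('n \<Rightarrow> 'n)" where
  "perm_op \<sigma> = (\<chi> f g. if g = f \<circ> \<sigma> then 1 else 0)"

lemma perm_op_mult_left: "(perm_op \<sigma> ** M) $ f $ h = M $ (f \<circ> \<sigma>) $ h"
  by (simp add: perm_op_def matrix_matrix_mult_def if_distrib[where f="\<lambda>x. x * _"] cong: if_cong)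

lemma perm_op_vec: "(perm_op \<sigma> *v x) $ f = x $ (f \<circ> \<sigma>)"
  by (simp add: perm_op_def matrix_vector_mult_def if_distrib[where f="\<lambda>x. x * _"] cong: if_cong)

lemma perm_op_mult_right:
  assumes "bij \<sigma>"
  shows "(M ** perm_op \<sigma>) $ f $ h = M $ f $ (h \<circ> inv \<sigma>)"
proof -
  have eq: "h = g \<circ> \<sigma> \<longleftrightarrow> g = h \<circ> inv \<sigma>" for g
    using assms by (metis bij_is_inj bij_is_surj comp_assoc comp_id inv_o_cancel surj_iff)
  show ?thesis
    by (simp add: perm_op_def matrix_matrix_mult_def eq if_distrib[where f="\<lambda>x. _ * x"] cong: if_cong)
qed

lemma perm_op_compose: "perm_op \<sigma> ** perm_op \<tau> = perm_op (\<sigma> \<circ> \<tau>)"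
  by (simp add: vec_eq_iff perm_op_mult_left) (simp add: perm_op_def comp_assoc)

lemma ctranspose_perm_op:
  assumes "bij \<sigma>"
  shows "ctranspose (perm_op \<sigma>) = perm_op (inv \<sigma>)"
proof -
  have eq: "f = g \<circ> \<sigma> \<longleftrightarrow> g = f \<circ> inv \<sigma>" for f g :: "'a \<Rightarrow> 'a"
    using assms by (metis bij_is_inj bij_is_surj comp_assoc comp_id inv_o_cancel surj_iff)
  show ?thesis by (simp add: vec_eq_iff perm_op_def eq)
qed

text \<open>The factors in S are all equal to A, and \<sigma> only rearranges these.\<close>

lemma perm_op_tens_on:
  assumes "\<sigma> permutes S"
  shows "perm_op \<sigma> ** tens_on S A = tens_on S A ** perm_op \<sigma>"
proof -
  have bij: "bij \<sigma>" using assms by (rule permutes_bij)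
  have U: "\<sigma> permutes UNIV" using assms by (simp add: permutes_def bij[unfolded bij_iff])
  have "(\<Prod>i\<in>UNIV. (if i \<in> S then A else mat 1) $ f (\<sigma> i) $ h i) =
    (\<Prod>i\<in>UNIV. (if i \<in> S then A else mat 1) $ f i $ h (inv \<sigma> i))" for f h
    by (subst (2) prod.permute[OF U])
      (simp add: comp_def permutes_in_image[OF assms] inv_f_f[OF bij_is_inj[OF bij]])
  then show ?thesis
    by (simp add: vec_eq_iff perm_op_mult_left perm_op_mult_right[OF bij]) (simp add: tens_on_def tens_def)
qed

text \<open>The orthogonal projection onto the tensors that are antisymmetric in the factors of
  S.\<close>

definition antisym_op :: "'n::finite set \<Rightarrow> complex^('n \<Rightarrow> 'n)^('n \<Rightarrow> 'n)" where
  "antisym_op S = (1 / fact (card S)) *\<^sub>R (\<Sum>\<sigma> | \<sigma> permutes S. real_of_int (sign \<sigma>) *\<^sub>R perm_op \<sigma>)"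

lemma perm_op_antisym_op:
  fixes S :: "'n::finite set"
  assumes "\<sigma> permutes S"
  shows "perm_op \<sigma> ** antisym_op S = real_of_int (sign \<sigma>) *\<^sub>R antisym_op S"
proof -
  have p: "permutation \<tau>" if "\<tau> permutes S" for \<tau> using that permutes_imp_permutation[of S] by simp
  have ss: "real_of_int (sign \<sigma>) * real_of_int (sign \<sigma>) = 1" by (metis of_int_1 of_int_mult sign_idempotent)
  have "perm_op \<sigma> ** (\<Sum>\<tau> | \<tau> permutes S. real_of_int (sign \<tau>) *\<^sub>R perm_op \<tau>)
    = (\<Sum>\<tau> | \<tau> permutes S. real_of_int (sign \<tau>) *\<^sub>R perm_op (\<sigma> \<circ> \<tau>))"
    by (simp add: bounded_bilinear.sum_right[OF bounded_bilinear_matrix_mult] matrix_mul_scaleR_right perm_op_compose)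
  also have "\<dots> = (\<Sum>\<tau> | \<tau> permutes S. (real_of_int (sign \<sigma>) * real_of_int (sign (\<sigma> \<circ> \<tau>))) *\<^sub>R perm_op (\<sigma> \<circ> \<tau>))"
    using ss by (intro sum.cong refl) (auto simp: sign_compose p assms simp flip: mult.assoc)
  also have "\<dots> = real_of_int (sign \<sigma>) *\<^sub>R (\<Sum>\<tau> | \<tau> permutes S. real_of_int (sign (\<sigma> \<circ> \<tau>)) *\<^sub>R perm_op (\<sigma> \<circ> \<tau>))"
    by (simp add: scaleR_right.sum)
  also have "(\<Sum>\<tau> | \<tau> permutes S. real_of_int (sign (\<sigma> \<circ> \<tau>)) *\<^sub>R perm_op (\<sigma> \<circ> \<tau>))
    = (\<Sum>\<tau> | \<tau> permutes S. real_of_int (sign \<tau>) *\<^sub>R perm_op \<tau>)"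
    by (rule setum_permutations_compose_left[OF assms, symmetric])
  finally show ?thesis by (simp add: antisym_op_def matrix_mul_scaleR_right)
qed

lemma antisym_op_idem: "antisym_op S ** antisym_op S = antisym_op S" for S :: "'n::finite set"
proof -
  have ss: "real_of_int (sign \<sigma>) * real_of_int (sign \<sigma>) = 1" for \<sigma> :: "'n \<Rightarrow> 'n"
    by (metis of_int_1 of_int_mult sign_idempotent)
  have "antisym_op S ** antisym_op S = (1 / fact (card S)) *\<^sub>R (\<Sum>\<sigma> | \<sigma> permutes S. real_of_int (sign \<sigma>) *\<^sub>R (perm_op \<sigma> ** antisym_op S))"
    by (subst antisym_op_def)
      (simp add: bounded_bilinear.sum_left[OF bounded_bilinear_matrix_mult] matrix_mul_scaleR_left)
  also have "\<dots> = (1 / fact (card S)) *\<^sub>R (\<Sum>\<sigma> | \<sigma> permutes S. antisym_op S)"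
    using ss by (simp add: perm_op_antisym_op)
  also have "\<dots> = antisym_op S" by (simp add: card_permutations[of S, OF refl] sum_constant_scaleR del: sum_constant)
  finally show ?thesis .
qed

lemma ctranspose_antisym_op: "ctranspose (antisym_op S) = antisym_op S" for S :: "'n::finite set"
proof -
  have p: "permutation \<tau>" if "\<tau> permutes S" for \<tau> using that permutes_imp_permutation[of S] by simp
  have "(\<Sum>\<sigma> | \<sigma> permutes S. ctranspose (real_of_int (sign \<sigma>) *\<^sub>R perm_op \<sigma>)) =
    (\<Sum>\<sigma> | \<sigma> permutes S. real_of_int (sign (inv \<sigma>)) *\<^sub>R perm_op (inv \<sigma>))"
    by (intro sum.cong refl) (auto simp: ctranspose_scaleR ctranspose_perm_op permutes_bij sign_inverse p)
  also have "\<dots> = (\<Sum>\<sigma> | \<sigma> permutes S. real_of_int (sign \<sigma>) *\<^sub>R perm_op \<sigma>)"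
    by (rule sum_permutations_inverse[symmetric])
  finally show ?thesis by (simp add: antisym_op_def ctranspose_scaleR ctranspose_sum)
qed

lemma antisym_op_tens_on: "antisym_op S ** tens_on S A = tens_on S A ** antisym_op S"
  by (simp add: antisym_op_def matrix_mul_scaleR_left matrix_mul_scaleR_right perm_op_tens_on
    bounded_bilinear.sum_left[OF bounded_bilinear_matrix_mult] bounded_bilinear.sum_right[OF bounded_bilinear_matrix_mult])

text \<open>Exchanging two factors with the same coordinate fixes the index f but changes the sign.
  Thus an eigenvalue is never selected twice.\<close>

lemma antisym_op_vec_zero:
  fixes f :: "'n::finite \<Rightarrow> 'n"
  assumes "\<not> inj_on f S"
  shows "(antisym_op S *v x) $ f = 0"
proof -
  obtain a b where ab: "a \<in> S" "b \<in> S" "a \<noteq> b" "f a = f b" using assms by (auto simp: inj_on_def)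
  let ?\<sigma> = "Transposition.transpose a b"
  have p: "?\<sigma> permutes S" using ab by (simp add: permutes_swap_id)
  have "(perm_op ?\<sigma> *v (antisym_op S *v x)) $ f = - (antisym_op S *v x) $ f"
    using perm_op_antisym_op[OF p] ab
    by (simp add: matrix_vector_mul_assoc sign_swap_id matrix_vector_minus_left)
  moreover have "f \<circ> ?\<sigma> = f" using ab by (auto simp: fun_eq_iff Transposition.transpose_def)
  ultimately show ?thesis by (simp add: perm_op_vec)
qed

text \<open>Only the identity permutation fixes an index that is injective on S. The entry being
  nonzero, the antisymmetrized basis tensor does not vanish.\<close>

lemma antisym_op_diagonal_entry:
  fixes f :: "'n::finite \<Rightarrow> 'n"
  assumes "inj_on f S"
  shows "antisym_op S $ f $ f = of_real (1 / fact (card S))"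
proof -
  have id: "\<sigma> = id" if p: "\<sigma> permutes S" and f: "f = f \<circ> \<sigma>" for \<sigma>
  proof
    fix i show "\<sigma> i = id i"
    proof (cases "i \<in> S")
      case True
      then have "\<sigma> i \<in> S" using p by (simp add: permutes_in_image)
      moreover have "f i = f (\<sigma> i)" using f by (metis comp_apply)
      ultimately show ?thesis using assms True by (auto simp: inj_on_def)
    next
      case False
      then show ?thesis using p by (simp add: permutes_def)
    qed
  qed
  have "(\<Sum>\<sigma> | \<sigma> permutes S. real_of_int (sign \<sigma>) *\<^sub>R (perm_op \<sigma> $ f $ f)) = (\<Sum>\<sigma>\<in>{id :: 'n \<Rightarrow> 'n}. (1::complex))"
    by (rule sum.mono_neutral_cong_right)
      (use id in \<open>auto simp: perm_op_def permutes_id finite_permutations sign_id\<close>)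
  then show ?thesis by (simp add: antisym_op_def scaleR_conv_of_real[where 'a=complex])
qed

text \<open>\<open>ext_power S A\<close> is the exterior power of order \<open>card S\<close> on antisymmetric tensors and the identity on
  their orthogonal complement, so \<open>ext_power S A \<le> 1\<close> bounds the products of \<open>card S\<close> eigenvalues of \<open>A\<close> by 1.\<close>

definition ext_power :: "'n::finite set \<Rightarrow> complex^'n^'n \<Rightarrow> complex^('n \<Rightarrow> 'n)^('n \<Rightarrow> 'n)" where
  "ext_power S A = tens_on S A ** antisym_op S + (mat 1 - antisym_op S)"

text \<open>No summand on the complement: there \<open>ext_power S A\<close> is the identity, with
  logarithm 0.\<close>

definition ext_deriv :: "'n::finite set \<Rightarrow> complex^'n^'n \<Rightarrow> complex^('n \<Rightarrow> 'n)^('n \<Rightarrow> 'n)" where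
  "ext_deriv S H = antisym_op S ** tens_deriv S H ** antisym_op S"

lemma matrix_diff_ldistrib: "A ** (B - C) = A ** B - A ** (C :: 'a::ring_1^'k^'n)"
  by (simp add: vec_eq_iff matrix_matrix_mult_def right_diff_distrib sum_subtractf)

lemma matrix_diff_rdistrib: "(A - B) ** C = A ** C - B ** (C :: 'a::ring_1^'k^'n)"
  by (simp add: vec_eq_iff matrix_matrix_mult_def left_diff_distrib sum_subtractf)

lemmas matrix_distribs = matrix_add_ldistrib matrix_add_rdistrib' matrix_diff_ldistrib matrix_diff_rdistrib

lemma ext_power_mult: "ext_power S (A ** B) = ext_power S A ** ext_power S B" for S :: "'n::finite set"
proof -
  let ?E = "antisym_op S"
  have 1: "tens_on S A ** ?E ** (tens_on S B ** ?E) = tens_on S A ** tens_on S B ** ?E"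
    by (metis antisym_op_idem antisym_op_tens_on matrix_mul_assoc)
  have 2: "?E ** (tens_on S B ** ?E) = tens_on S B ** ?E"
    by (metis antisym_op_idem antisym_op_tens_on matrix_mul_assoc)
  have 3: "tens_on S A ** ?E ** ?E = tens_on S A ** ?E"
    by (metis antisym_op_idem matrix_mul_assoc)
  show ?thesis
    by (simp add: ext_power_def matrix_distribs tens_on_mult 1 2 3 antisym_op_idem)
qed

lemma ext_power_one: "ext_power S (mat 1) = mat 1"
  by (simp add: ext_power_def tens_on_one)

lemma ctranspose_ext_power: "ext_power S (ctranspose A) = ctranspose (ext_power S A)" for S :: "'n::finite set"
  by (simp add: ext_power_def ctranspose_add ctranspose_diff ctranspose_mult ctranspose_antisym_op
    ctranspose_tens_on antisym_op_tens_on)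

lemma unitary_ext_power: "unitary U \<Longrightarrow> unitary (ext_power S U)" for S :: "'n::finite set"
  by (simp add: unitary_def ext_power_one flip: ctranspose_ext_power ext_power_mult)

lemma ext_power_ud: "ext_power S (ud U d) = ext_power S U ** ext_power S (real_diag d) ** ctranspose (ext_power S U)"
  for S :: "'n::finite set"
  by (simp add: ud_def ext_power_mult ctranspose_ext_power)

lemma hermitian_ext_power_real_diag: "hermitian (ext_power S (real_diag d))" for S :: "'n::finite set"
  by (simp add: hermitian_def flip: ctranspose_ext_power)

text \<open>A nonzero entry of E forces equal values of \<tau>, hence of g \<circ> \<tau>, at its
  row and column.\<close>

lemma real_diag_fun_commute:
  assumes "E ** real_diag \<tau> = real_diag \<tau> ** E"
  shows "E ** real_diag (g \<circ> \<tau>) = real_diag (g \<circ> \<tau>) ** (E :: complex^'n^'n)"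
proof -
  have "E $ i $ j * of_real (\<tau> j) = of_real (\<tau> i) * E $ i $ j" for i j
    using assms by (metis real_diag_mult_left real_diag_mult_right)
  then have "\<tau> i = \<tau> j \<or> E $ i $ j = 0" for i j
    by (metis mult.commute mult_cancel_right of_real_eq_iff)
  then have "E $ i $ j * of_real (g (\<tau> j)) = of_real (g (\<tau> i)) * E $ i $ j" for i j
    by (metis mult.commute mult_zero_left)
  then show ?thesis by (simp add: vec_eq_iff real_diag_mult_left real_diag_mult_right)
qed

lemma ext_power_real_diag_commute:
  "antisym_op S ** real_diag (\<lambda>f. \<Prod>i\<in>S. d (f i)) = real_diag (\<lambda>f. \<Prod>i\<in>S. d (f i)) ** antisym_op S"
  using antisym_op_tens_on[of S "real_diag d"] by (simp add: tens_on_real_diag)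

text \<open>\<open>antisym_op S\<close> is not diagonal, so no diagonalization is at hand. Each
  eigenvector x splits into its antisymmetric part and the rest, both satisfying the eigenvalue
  equation; a nonzero rest forces the eigenvalue 1.\<close>

lemma herm_fun_ext_power_real_diag:
  fixes S :: "'n::finite set"
  shows "herm_fun g (ext_power S (real_diag d)) =
    real_diag (\<lambda>f. g (\<Prod>i\<in>S. d (f i))) ** antisym_op S + g 1 *\<^sub>R (mat 1 - antisym_op S)"
proof (rule herm_fun_eigenI[OF hermitian_ext_power_real_diag])
  fix l and x :: "complex^('n \<Rightarrow> 'n)"
  let ?E = "antisym_op S"
  define \<tau> where "\<tau> = (\<lambda>f::'n\<Rightarrow>'n. \<Prod>i\<in>S. d (f i))"
  assume "ext_power S (real_diag d) *v x = l *\<^sub>R x"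
  then have e: "real_diag \<tau> *v (?E *v x) + (x - ?E *v x) = l *\<^sub>R x"
    by (simp add: ext_power_def tens_on_real_diag \<tau>_def matrix_vector_mult_add_rdistrib matrix_vector_mult_diff_rdistrib
      flip: matrix_vector_mul_assoc)
  have EE: "?E *v (?E *v x) = ?E *v x" by (simp add: matrix_vector_mul_assoc antisym_op_idem)
  have Et: "?E *v (real_diag \<tau> *v y) = real_diag \<tau> *v (?E *v y)" for y
    using ext_power_real_diag_commute[of S d] by (simp add: matrix_vector_mul_assoc \<tau>_def)
  have "?E *v (real_diag \<tau> *v (?E *v x) + (x - ?E *v x)) = real_diag \<tau> *v (?E *v x)"
    by (simp add: matrix_vector_right_distrib matrix_vector_mult_diff_distrib EE Et)
  then have 1: "real_diag \<tau> *v (?E *v x) = l *\<^sub>R (?E *v x)"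
    by (simp add: e matrix_vector_scaleR_right)
  then have 2: "x - ?E *v x = l *\<^sub>R (x - ?E *v x)" using e by (simp add: scaleR_right_diff_distrib algebra_simps)
  have 3: "real_diag (\<lambda>f. g (\<tau> f)) *v (?E *v x) = g l *\<^sub>R (?E *v x)"
    using herm_fun_eigenvector[OF _ 1, of g] herm_fun_ud[of "mat 1" g \<tau>]
    by (simp add: comp_def hermitian_def)
  have 4: "g 1 *\<^sub>R (x - ?E *v x) = g l *\<^sub>R (x - ?E *v x)"
  proof (cases "x - ?E *v x = 0")
    case False
    have "(1 - l) *\<^sub>R (x - ?E *v x) = 0" using 2 by (simp add: scaleR_left_diff_distrib)
    then have "l = 1" using False by (metis diff_eq_diff_eq eq_iff_diff_eq_0 scaleR_eq_0_iff)
    then show ?thesis by simp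
  next
    case True
    then show ?thesis by (simp only: True) simp
  qed
  have "(real_diag (\<lambda>f. g (\<tau> f)) ** ?E + g 1 *\<^sub>R (mat 1 - ?E)) *v x = real_diag (\<lambda>f. g (\<tau> f)) *v (?E *v x) + g 1 *\<^sub>R (x - ?E *v x)"
    by (simp add: matrix_vector_mult_add_rdistrib matrix_vector_scaleR_left matrix_vector_mult_diff_rdistrib
      flip: matrix_vector_mul_assoc)
  also have "\<dots> = g l *\<^sub>R x" unfolding 3 4 by (simp flip: scaleR_add_right)
  finally show "(real_diag (\<lambda>f. g (\<Prod>i\<in>S. d (f i))) ** ?E + g 1 *\<^sub>R (mat 1 - ?E)) *v x = g l *\<^sub>R x"
    by (simp add: \<tau>_def)
qed

lemma ext_power_representation: "matrix_representation (ext_power S) (ext_deriv S)" for S :: "'n::finite set"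
proof (rule matrix_representation.intro)
  show "ext_power S (A ** B) = ext_power S A ** ext_power S B" for A B by (rule ext_power_mult)
  show "ext_power S (mat 1) = mat 1" by (rule ext_power_one)
  show "ext_power S (ctranspose A) = ctranspose (ext_power S A)" for A by (rule ctranspose_ext_power)
  have "bounded_linear (tens_deriv S)" using linear_tens_deriv by (simp add: linear_conv_bounded_linear)
  from bounded_linear_compose[OF bounded_bilinear.bounded_linear_right[OF bounded_bilinear_matrix_mult, of "antisym_op S"] this]
  have "bounded_linear (\<lambda>H. antisym_op S ** tens_deriv S H)" by simp
  from bounded_linear_compose[OF bounded_bilinear.bounded_linear_left[OF bounded_bilinear_matrix_mult, of "antisym_op S"] this]
  show "bounded_linear (ext_deriv S)" by (simp add: ext_deriv_def[abs_def])
  fix A :: "complex^'n^'n" assume A: "A \<in> posdef"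
  obtain U d where U: "unitary U" "\<And>i. 0 < d i" "A = ud U d" "\<And>i. d i \<noteq> 0" using A by (elim posdef_decomp) blast
  let ?E = "antisym_op S" and ?V = "ext_power S U"
  have V: "unitary ?V" using U by (simp add: unitary_ext_power)
  have hf: "herm_fun g (ext_power S A) = ?V ** herm_fun g (ext_power S (real_diag d)) ** ctranspose ?V" for g
    unfolding U(3) ext_power_ud by (rule herm_fun_unitary_conj[OF hermitian_ext_power_real_diag V])
  show "mat_powr (ext_power S A) t = ext_power S (mat_powr A t)" for t
  proof -
    have "mat_powr A t = ud U (\<lambda>i. d i powr t)" using U by (simp add: mat_powr_ud)
    then have "ext_power S (mat_powr A t) = ?V ** ext_power S (real_diag (\<lambda>i. d i powr t)) ** ctranspose ?V"
      by (simp add: ext_power_ud)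
    also have "ext_power S (real_diag (\<lambda>i. d i powr t)) = herm_fun (\<lambda>x. x powr t) (ext_power S (real_diag d))"
      unfolding herm_fun_ext_power_real_diag by (simp add: ext_power_def tens_on_real_diag prod_powr_distrib)
    finally show ?thesis by (simp add: mat_powr_def hf)
  qed
  show "mat_ln (ext_power S A) = ext_deriv S (mat_ln A)"
  proof -
    let ?l = "\<lambda>i. ln (d i)" and ?D = "real_diag (\<lambda>f. \<Sum>i\<in>S. ln (d (f i)))"
    have lnp: "(\<lambda>f. ln (\<Prod>i\<in>S. d (f i))) = (\<lambda>f. \<Sum>i\<in>S. ln (d (f i)))" for f :: "'n \<Rightarrow> 'n"
      using U by (intro ext ln_prod) auto
    have comm: "?E ** ?D = ?D ** ?E"
      using real_diag_fun_commute[OF ext_power_real_diag_commute[of S d], of ln] lnp by (simp add: comp_def)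
    have EDE: "?E ** ?D ** ?E = ?D ** ?E" by (metis comm antisym_op_idem matrix_mul_assoc)
    have VE: "?V ** ?E = tens_on S U ** ?E"
      by (simp add: ext_power_def matrix_distribs antisym_op_idem flip: matrix_mul_assoc)
    then have EV: "?E ** ctranspose ?V = ?E ** ctranspose (tens_on S U)"
      by (metis ctranspose_antisym_op ctranspose_mult)
    have "mat_ln A = U ** real_diag ?l ** ctranspose U" using U(1) by (simp add: U(3) mat_ln_ud flip: ud_def)
    then have "ext_deriv S (mat_ln A) = ?E ** (tens_on S U ** ?D ** ctranspose (tens_on S U)) ** ?E"
      using U(1) by (simp add: ext_deriv_def tens_deriv_conj tens_deriv_real_diag)
    also have "\<dots> = (?E ** tens_on S U) ** ?D ** (tens_on S (ctranspose U) ** ?E)"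
      by (simp only: ctranspose_tens_on matrix_mul_assoc)
    also have "\<dots> = (tens_on S U ** ?E) ** ?D ** (?E ** ctranspose (tens_on S U))"
      by (simp only: antisym_op_tens_on ctranspose_tens_on)
    also have "\<dots> = ?V ** (?E ** ?D ** ?E) ** ctranspose ?V"
      by (simp only: VE[symmetric] EV[symmetric]) (metis (no_types) EV VE matrix_mul_assoc antisym_op_idem)
    also have "?E ** ?D ** ?E = herm_fun ln (ext_power S (real_diag d))"
      unfolding EDE herm_fun_ext_power_real_diag using lnp by simp
    finally show ?thesis by (simp add: mat_ln_def hf)
  qed
qed

text \<open>On antisymmetric tensors the eigenvalues are products over injective choices of
  \<open>card S\<close> eigenvalues; on the complement the operator is 1 and meets the bound with
  equality.\<close>

lemma ext_power_le_iff:
  fixes S :: "'n::finite set"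
  assumes U: "unitary U"
  shows "(\<forall>x. x \<bullet> (ext_power S (ud U d) *v x) \<le> x \<bullet> x) \<longleftrightarrow> (\<forall>f. inj_on f S \<longrightarrow> (\<Prod>i\<in>S. d (f i)) \<le> 1)"
proof -
  let ?V = "ext_power S U" and ?D = "ext_power S (real_diag d)" and ?E = "antisym_op S"
  define \<tau> where "\<tau> = (\<lambda>f::'n\<Rightarrow>'n. \<Prod>i\<in>S. d (f i))"
  have V: "unitary ?V" using U by (rule unitary_ext_power)
  have "(\<forall>x. x \<bullet> (ext_power S (ud U d) *v x) \<le> x \<bullet> x) \<longleftrightarrow> (\<forall>x. x \<bullet> (?D *v x) \<le> x \<bullet> x)"
  proof (intro iffI allI)
    fix x assume *: "\<forall>x. x \<bullet> (ext_power S (ud U d) *v x) \<le> x \<bullet> x"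
    have "qf (ext_power S (ud U d)) (?V *v x) = qf ?D x"
      by (simp add: ext_power_ud inner_matrix_vector_left[of ?V] unitary_cancel_vec[OF V] flip: matrix_vector_mul_assoc)
    then show "qf ?D x \<le> x \<bullet> x" using *[rule_format, of "?V *v x"] by (simp add: inner_unitary_vec[OF V])
  next
    fix x assume *: "\<forall>x. x \<bullet> (?D *v x) \<le> x \<bullet> x"
    have "qf (ext_power S (ud U d)) x = qf ?D (ctranspose ?V *v x)"
      by (simp add: ext_power_ud inner_matrix_vector_right[of x ?V] flip: matrix_vector_mul_assoc)
    also have "\<dots> \<le> (ctranspose ?V *v x) \<bullet> (ctranspose ?V *v x)" using * by blast
    finally show "qf (ext_power S (ud U d)) x \<le> x \<bullet> x"
      using V by (simp add: inner_unitary_vec unitary_ctranspose)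
  qed
  also have "\<dots> \<longleftrightarrow> (\<forall>f. inj_on f S \<longrightarrow> \<tau> f \<le> 1)"
  proof
    have Dx: "?D *v x = real_diag \<tau> *v (?E *v x) + (x - ?E *v x)" for x
      by (simp add: ext_power_def tens_on_real_diag \<tau>_def matrix_vector_mult_add_rdistrib matrix_vector_mult_diff_rdistrib
        flip: matrix_vector_mul_assoc)
    have EE: "?E *v (?E *v x) = ?E *v x" for x by (simp add: matrix_vector_mul_assoc antisym_op_idem)
    have Et: "?E *v (real_diag \<tau> *v y) = real_diag \<tau> *v (?E *v y)" for y
      using ext_power_real_diag_commute[of S d] by (simp add: matrix_vector_mul_assoc \<tau>_def)
    have Einner: "x \<bullet> (?E *v y) = (?E *v x) \<bullet> y" for x y
      by (simp add: inner_matrix_vector_right ctranspose_antisym_op)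
    {
      assume *: "\<forall>x. x \<bullet> (?D *v x) \<le> x \<bullet> x"
      show "\<forall>f. inj_on f S \<longrightarrow> \<tau> f \<le> 1"
      proof (intro allI impI)
        fix f :: "'n \<Rightarrow> 'n" assume f: "inj_on f S"
        \<comment> \<open>The antisymmetrized basis tensor is a nonzero eigenvector with eigenvalue
          \<tau> f.\<close>
        define x where "x = ?E *v axis f 1"
        have "x $ f = of_real (1 / fact (card S))"
          using antisym_op_diagonal_entry[OF f] by (simp add: x_def column_mult[symmetric] column_def)
        then have "x \<noteq> 0" by auto
        have "real_diag \<tau> *v axis f 1 = \<tau> f *\<^sub>R axis f 1"
          by (simp add: vec_eq_iff real_diag_vec axis_def scaleR_conv_of_real[where 'a=complex])
        then have "real_diag \<tau> *v x = \<tau> f *\<^sub>R x"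
          by (simp add: x_def matrix_vector_scaleR_right flip: Et)
        moreover have "?E *v x = x" by (simp add: x_def EE)
        ultimately have "?D *v x = \<tau> f *\<^sub>R x" by (simp add: Dx)
        then have "\<tau> f * (x \<bullet> x) \<le> x \<bullet> x" using * by (metis inner_scaleR_right)
        moreover have "x \<bullet> x > 0" using \<open>x \<noteq> 0\<close> by simp
        ultimately show "\<tau> f \<le> 1" by simp
      qed
    next
      assume *: "\<forall>f. inj_on f S \<longrightarrow> \<tau> f \<le> 1"
      show "\<forall>x. x \<bullet> (?D *v x) \<le> x \<bullet> x"
      proof
        fix x
        define w where "w = ?E *v x"
        have "x \<bullet> (real_diag \<tau> *v w) = x \<bullet> (?E *v (real_diag \<tau> *v w))" by (simp add: Et EE w_def)
        also have "\<dots> = qf (real_diag \<tau>) w" by (simp add: Einner w_def)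
        also have "\<dots> = (\<Sum>f\<in>UNIV. \<tau> f * (cmod (w $ f))\<^sup>2)" using qf_ud[of w "mat 1" \<tau>] by simp
        also have "\<dots> \<le> (\<Sum>f\<in>UNIV. (cmod (w $ f))\<^sup>2)"
        proof (rule sum_mono)
          fix f
          show "\<tau> f * (cmod (w $ f))\<^sup>2 \<le> (cmod (w $ f))\<^sup>2"
          proof (cases "inj_on f S")
            case True
            then have "\<tau> f * (cmod (w $ f))\<^sup>2 \<le> 1 * (cmod (w $ f))\<^sup>2" using * by (intro mult_right_mono) auto
            then show ?thesis by simp
          next
            case False
            then show ?thesis by (simp add: w_def antisym_op_vec_zero)
          qed
        qed
        also have "\<dots> = w \<bullet> w" by (simp add: dot_square_norm norm_vec_sq)
        also have "\<dots> = x \<bullet> w" by (simp add: w_def Einner[symmetric] EE)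
        finally show "qf ?D x \<le> x \<bullet> x" unfolding Dx w_def[symmetric] by (simp add: inner_add_right inner_diff_right)
      qed
    }
  qed
  finally show ?thesis by (simp add: \<tau>_def)
qed

subsection \<open>Products of eigenvalues\<close>

definition enumerates_decreasingly :: "(nat \<Rightarrow> 'n::finite) \<Rightarrow> ('n \<Rightarrow> real) \<Rightarrow> bool" where
  "enumerates_decreasingly e d \<longleftrightarrow> bij_betw e {..<CARD('n)} UNIV \<and>
     (\<forall>i j. i \<le> j \<and> j < CARD('n) \<longrightarrow> d (e j) \<le> d (e i))"

lemma enumerates_decreasingly_exists: "\<exists>e. enumerates_decreasingly e d"
  using decreasing_enumeration[of d] unfolding enumerates_decreasingly_def by metis

lemma enumerates_decreasingly_bij: "enumerates_decreasingly e d \<Longrightarrow> bij_betw e {..<CARD('n)} UNIV"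
  for d :: "'n::finite \<Rightarrow> real"
  by (simp add: enumerates_decreasingly_def)

lemma enumerates_decreasingly_le:
  "enumerates_decreasingly e d \<Longrightarrow> i \<le> j \<Longrightarrow> j < CARD('n) \<Longrightarrow> d (e j) \<le> d (e i)"
  for d :: "'n::finite \<Rightarrow> real"
  by (simp add: enumerates_decreasingly_def)

lemma enumerates_decreasingly_inj_on:
  "enumerates_decreasingly e d \<Longrightarrow> k \<le> CARD('n) \<Longrightarrow> inj_on e {..<k}"
  for d :: "'n::finite \<Rightarrow> real"
  by (auto simp: enumerates_decreasingly_def bij_betw_def intro: inj_on_subset)

lemma enumerates_decreasingly_mono:
  assumes "enumerates_decreasingly e d" and "\<And>i j. d i \<le> d j \<Longrightarrow> d' i \<le> d' j"
  shows "enumerates_decreasingly e d'"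
  using assms by (simp add: enumerates_decreasingly_def)

text \<open>Bounding the products over all index sets of size k avoids ordering the eigenvalues; one
  diagonalization suffices because the multiset of eigenvalues does not depend on it.\<close>

definition subset_prod_le :: "complex^'n^'n \<Rightarrow> nat \<Rightarrow> real \<Rightarrow> bool" where
  "subset_prod_le A k p \<longleftrightarrow> (\<exists>U d. unitary U \<and> A = ud U d \<and> (\<forall>T. card T = k \<longrightarrow> (\<Prod>i\<in>T. d i) \<le> p))"

lemma subset_prod_le_step:
  fixes \<mu> :: "(complex^'n^'n) measure"
  assumes \<mu>: "\<mu> \<in> prob1" and t: "1 \<le> t" "t \<le> 2" and k: "0 < k" "k \<le> CARD('n)" and p: "0 < p"
    and X: "subset_prod_le (cartan_barycenter \<mu>) k p"
  shows "subset_prod_le (cartan_barycenter (measure_powr \<mu> t)) k (p powr t)"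
proof -
  let ?X = "cartan_barycenter \<mu>" and ?Z = "cartan_barycenter (measure_powr \<mu> t)"
  have KX: "karcher \<mu> ?X" and KZ: "karcher (measure_powr \<mu> t) ?Z"
    using \<mu> measure_powr_prob1 karcher_cartan_barycenter by blast+
  obtain S :: "'n set" where S: "card S = k" using obtain_subset_with_card_n[OF k(2)] by blast
  interpret matrix_representation "ext_power S" "ext_deriv S" by (rule ext_power_representation)
  \<comment> \<open>The k factors c contribute 1 / p, which turns the bound p into the bound 1
    required by the Ando-Hiai step.\<close>
  define c where "c = p powr (- 1 / k)"
  have c: "c > 0" "c ^ k = 1 / p"
  proof -
    show c0: "c > 0" using p by (simp add: c_def)
    have "c ^ k = c powr k" using c0 by (simp add: powr_realpow)
    also have "\<dots> = p powr (- 1 / k * k)" unfolding c_def by (rule powr_powr)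
    finally show "c ^ k = 1 / p" using p k by (simp add: powr_minus_divide)
  qed
  obtain U d where U: "unitary U" "?X = ud U d" "\<And>T. card T = k \<Longrightarrow> (\<Prod>i\<in>T. d i) \<le> p"
    using X by (auto simp: subset_prod_le_def)
  have inj: "(\<Prod>i\<in>S. g (f i)) = (\<Prod>i\<in>f ` S. g i)" "card (f ` S) = k" if "inj_on f S" for f and g :: "'n \<Rightarrow> real"
    using that S by (simp_all add: prod.reindex card_image)
  have "(\<Prod>i\<in>S. c * d (f i)) \<le> 1" if "inj_on f S" for f
  proof -
    have "(\<Prod>i\<in>S. c * d (f i)) = (1 / p) * (\<Prod>i\<in>f ` S. d i)"
      using inj[OF that] S by (simp add: prod.distrib c)
    also have "\<dots> \<le> (1 / p) * p" using U(3)[of "f ` S"] inj[OF that] p by (intro mult_left_mono) auto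
    finally show ?thesis using p by simp
  qed
  then have le: "qf (ext_power S (c *\<^sub>R ?X)) x \<le> x \<bullet> x" for x
    using ext_power_le_iff[OF U(1), of S "\<lambda>i. c * d i"] by (simp add: U(2) ud_scaleR)
  have Z: "qf (ext_power S ((c powr t) *\<^sub>R ?Z)) x \<le> x \<bullet> x" for x
    by (rule ando_hiai_step[OF \<mu> KX KZ t c(1) le])
  have "?Z \<in> posdef" using KZ by (simp add: karcher_def)
  then obtain V z where V: "unitary V" "\<And>i. 0 < z i" "?Z = ud V z" by (elim posdef_decomp) blast
  have Z': "inj_on f S \<Longrightarrow> (\<Prod>i\<in>S. (c powr t) * z (f i)) \<le> 1" for f
    using Z ext_power_le_iff[OF V(1), of S "\<lambda>i. (c powr t) * z i"] by (simp add: V(3) ud_scaleR)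
  have "(\<Prod>i\<in>T. z i) \<le> p powr t" if T: "card T = k" for T
  proof -
    have "finite S" "finite T" by auto
    then obtain f where f: "bij_betw f S T" using S T by (metis finite_same_card_bij)
    have ckt: "(c powr t) ^ k = 1 / (p powr t)"
    proof -
      have "(c powr t) ^ k = (c powr t) powr k" using c by (simp add: powr_realpow)
      also have "\<dots> = (c powr k) powr t" by (simp add: powr_powr mult.commute)
      also have "c powr k = c ^ k" using c by (simp add: powr_realpow)
      finally show ?thesis using p by (simp add: c powr_divide)
    qed
    have "(\<Prod>i\<in>S. (c powr t) * z (f i)) \<le> 1" using f by (intro Z') (simp add: bij_betw_def)
    moreover have "(\<Prod>i\<in>S. (c powr t) * z (f i)) = (1 / (p powr t)) * (\<Prod>i\<in>T. z i)"
      using f S by (simp add: prod.distrib ckt prod.reindex_bij_betw)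
    ultimately show ?thesis using p by (simp add: divide_le_eq)
  qed
  then show ?thesis using V unfolding subset_prod_le_def by blast
qed

lemma measure_powr_powr:
  fixes \<mu> :: "(complex^'n^'n) measure"
  assumes \<mu>: "\<mu> \<in> prob1"
  shows "measure_powr (measure_powr \<mu> s) t = measure_powr \<mu> (s * t)"
proof -
  have "measure_powr (measure_powr \<mu> s) t = distr \<mu> posdef_borel ((\<lambda>X. mat_powr X t) \<circ> (\<lambda>X. mat_powr X s))"
    unfolding measure_powr_def
  proof (rule distr_distr)
    show "(\<lambda>X. mat_powr X s) \<in> measurable \<mu> posdef_borel" by (rule measurable_mat_powr[OF \<mu>])
    have "measurable (measure_powr \<mu> s) (posdef_borel :: (complex^'n^'n) measure) = measurable posdef_borel posdef_borel"
      by (rule measurable_cong_sets) (simp_all add: measure_powr_def)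
    then show "(\<lambda>X. mat_powr X t) \<in> measurable (posdef_borel :: (complex^'n^'n) measure) posdef_borel"
      using measurable_mat_powr[OF measure_powr_prob1[OF \<mu>, of s], of t] by simp
  qed
  also have "\<dots> = measure_powr \<mu> (s * t)"
    unfolding measure_powr_def
    by (rule distr_cong) (auto simp: prob1_space[OF \<mu>] mat_powr_powr)
  finally show ?thesis .
qed

lemma subset_prod_le_powr:
  fixes \<mu> :: "(complex^'n^'n) measure"
  assumes \<mu>: "\<mu> \<in> prob1" and t: "1 \<le> t" and k: "0 < k" "k \<le> CARD('n)" and p: "0 < p"
    and X: "subset_prod_le (cartan_barycenter \<mu>) k p"
  shows "subset_prod_le (cartan_barycenter (measure_powr \<mu> t)) k (p powr t)"
proof -
  obtain n where "t \<le> 2 ^ n" using real_arch_pow[of 2 t] by (auto intro: less_imp_le)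
  then show ?thesis using t
  proof (induction n arbitrary: t)
    case 0
    then show ?case using subset_prod_le_step[OF \<mu> _ _ k p X, of t] by simp
  next
    case (Suc n)
    show ?case
    proof (cases "t \<le> 2")
      case True
      then show ?thesis using subset_prod_le_step[OF \<mu> _ _ k p X, of t] Suc by simp
    next
      case False
      \<comment> \<open>For t > 2 the exponent t / 2 is still at least 1, and one more step with
        exponent 2 reaches t.\<close>
      then have "subset_prod_le (cartan_barycenter (measure_powr \<mu> (t / 2))) k (p powr (t / 2))"
        using Suc.prems by (intro Suc.IH) auto
      then have "subset_prod_le (cartan_barycenter (measure_powr (measure_powr \<mu> (t / 2)) 2)) k ((p powr (t / 2)) powr 2)"
        using p by (intro subset_prod_le_step[OF measure_powr_prob1[OF \<mu>] _ _ k]) auto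
      then show ?thesis using \<mu> by (simp add: measure_powr_powr powr_powr)
    qed
  qed
qed

text \<open>An exchange argument: T and the top k indices A leave equally many elements outside each
  other, and \<theta>, the k-th largest value, separates them.\<close>

lemma sum_subset_le_top:
  fixes d :: "'n::finite \<Rightarrow> real"
  assumes e: "enumerates_decreasingly e d"
    and T: "card T = k"
  shows "(\<Sum>i\<in>T. d i) \<le> (\<Sum>i<k. d (e i))"
proof (cases "k = 0")
  case True
  then show ?thesis using T by (simp add: card_eq_0_iff)
next
  case False
  have kn: "k \<le> CARD('n)" using T card_mono[of UNIV T] by simp
  define A where "A = e ` {..<k}"
  define \<theta> where "\<theta> = d (e (k - 1))"
  have inj: "inj_on e {..<k}" using e kn by (rule enumerates_decreasingly_inj_on)
  have cA: "card A = k" using inj by (simp add: A_def card_image)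
  have "card (T - A) = card T - card (T \<inter> A)" "card (A - T) = card A - card (A \<inter> T)"
    by (simp_all add: card_Diff_subset_Int)
  then have eq: "card (T - A) = card (A - T)" using cA T by (simp add: Int_commute)
  have "d i \<le> \<theta>" if "i \<in> T - A" for i
  proof -
    obtain j where j: "j < CARD('n)" "i = e j" using enumerates_decreasingly_bij[OF e] by (metis bij_betw_iff_bijections lessThan_iff UNIV_I)
    then have "\<not> j < k" using that by (auto simp: A_def)
    then show ?thesis using enumerates_decreasingly_le[OF e, of "k - 1" j] j by (simp add: \<theta>_def)
  qed
  then have "(\<Sum>i\<in>T - A. d i) \<le> (\<Sum>i\<in>T - A. \<theta>)" by (rule sum_mono)
  also have "\<dots> = (\<Sum>i\<in>A - T. \<theta>)" by (simp add: eq)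
  also have "\<dots> \<le> (\<Sum>i\<in>A - T. d i)"
  proof (rule sum_mono)
    fix i assume "i \<in> A - T"
    then obtain j where "j < k" "i = e j" by (auto simp: A_def)
    then show "\<theta> \<le> d i" using enumerates_decreasingly_le[OF e, of j "k - 1"] kn False by (simp add: \<theta>_def)
  qed
  finally have "(\<Sum>i\<in>T - A. d i) + (\<Sum>i\<in>T \<inter> A. d i) \<le> (\<Sum>i\<in>A - T. d i) + (\<Sum>i\<in>A \<inter> T. d i)"
    by (simp add: Int_commute)
  then have "(\<Sum>i\<in>T. d i) \<le> (\<Sum>i\<in>A. d i)"
    by (simp add: sum.Int_Diff[of T d A] sum.Int_Diff[of A d T] add.commute)
  also have "(\<Sum>i\<in>A. d i) = (\<Sum>i<k. d (e i))" unfolding A_def using inj by (simp add: sum.reindex)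
  finally show ?thesis .
qed

lemma prod_subset_le_top:
  fixes d :: "'n::finite \<Rightarrow> real"
  assumes e: "enumerates_decreasingly e d"
    and T: "card T = k" and d: "\<And>i. 0 < d i"
  shows "(\<Prod>i\<in>T. d i) \<le> (\<Prod>i<k. d (e i))"
proof -
  have "d i \<noteq> 0" for i using d[of i] by simp
  moreover have "(\<Sum>i\<in>T. ln (d i)) \<le> (\<Sum>i<k. ln (d (e i)))"
  proof (rule sum_subset_le_top[OF _ T])
    show "enumerates_decreasingly e (\<lambda>i. ln (d i))"
      using e by (rule enumerates_decreasingly_mono) (simp add: d)
  qed
  ultimately have "ln (\<Prod>i\<in>T. d i) \<le> ln (\<Prod>i<k. d (e i))" by (simp add: ln_prod)
  then show ?thesis using d by (simp add: prod_pos)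
qed

subsection \<open>Eigenvalue lists\<close>

text \<open>Constant polynomial entries, so that the conjugation by U can be carried out under the
  determinant that defines \<open>charpoly\<close>.\<close>

definition cpoly_mat :: "complex^'n^'n \<Rightarrow> complex poly^'n^'n" where
  "cpoly_mat A = (\<chi> i j. [:A $ i $ j:])"

lemma cpoly_mat_mult: "cpoly_mat (A ** B) = cpoly_mat A ** cpoly_mat B"
  by (simp add: vec_eq_iff cpoly_mat_def matrix_matrix_mult_def mult.commute flip: sum_to_poly)

lemma cpoly_mat_one: "cpoly_mat (mat 1) = mat 1"
  by (simp add: vec_eq_iff cpoly_mat_def mat_def one_pCons)

lemma charpoly_alt: "charpoly A = det (mat [:0, 1:] - cpoly_mat A)"
  unfolding charpoly_def by (rule arg_cong[where f=det]) (simp add: vec_eq_iff mat_def cpoly_mat_def)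

lemma charpoly_ud:
  fixes U :: "complex^'n^'n"
  assumes U: "unitary U"
  shows "charpoly (ud U d) = (\<Prod>i\<in>UNIV. [:- of_real (d i), 1:])"
proof -
  let ?x = "mat [:0, 1:] :: complex poly^'n^'n"
  have comm: "A ** ?x = ?x ** A" for A
    by (simp add: vec_eq_iff matrix_matrix_mult_def mat_def if_distrib[where f="\<lambda>x. _ * x"]
      if_distrib[where f="\<lambda>x. x * _"] mult.commute cong: if_cong)
  have UU: "cpoly_mat U ** cpoly_mat (ctranspose U) = mat 1"
    using U by (simp add: unitary_right cpoly_mat_one flip: cpoly_mat_mult)
  have "cpoly_mat U ** (?x - cpoly_mat (real_diag d)) ** cpoly_mat (ctranspose U) =
    cpoly_mat U ** ?x ** cpoly_mat (ctranspose U) - cpoly_mat (ud U d)"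
    by (simp add: ud_def cpoly_mat_mult matrix_diff_ldistrib matrix_diff_rdistrib)
  also have "cpoly_mat U ** ?x ** cpoly_mat (ctranspose U) = ?x"
    by (simp add: comm UU flip: matrix_mul_assoc)
  finally have eq: "?x - cpoly_mat (ud U d) = cpoly_mat U ** (?x - cpoly_mat (real_diag d)) ** cpoly_mat (ctranspose U)" ..
  have "det (cpoly_mat U) * det (cpoly_mat (ctranspose U)) = 1"
    using UU by (simp flip: det_mul)
  then have "charpoly (ud U d) = det (?x - cpoly_mat (real_diag d))"
    by (simp add: charpoly_alt eq det_mul mult_ac)
  also have "\<dots> = (\<Prod>i\<in>UNIV. [:- of_real (d i), 1:])"
    by (subst det_diagonal) (auto simp: mat_def cpoly_mat_def real_diag_nth)
  finally show ?thesis .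
qed

text \<open>The roots of the characteristic polynomial form the multiset of the d i, and reversing
  the increasing sort lists them as e does. \<open>eigenvalue\<close> counts from 1, e from
  0.\<close>

lemma eigenvalue_ud:
  fixes U :: "complex^'n^'n"
  assumes U: "unitary U"
    and e: "enumerates_decreasingly e d"
    and k: "1 \<le> k" "k \<le> CARD('n)"
  shows "eigenvalue k (ud U d) = d (e (k - 1))"
proof -
  let ?l = "map (\<lambda>i. d (e i)) [0..<CARD('n)]"
  have "proots (charpoly (ud U d)) = (\<Sum>i\<in>UNIV. proots [:- complex_of_real (d i), 1:])"
    unfolding charpoly_ud[OF U] by (rule proots_prod) simp
  also have "\<dots> = image_mset (\<lambda>i. complex_of_real (d i)) (mset_set UNIV)"
    by (simp add: sum_unfold_sum_mset)
  finally have "image_mset Re (proots (charpoly (ud U d))) = image_mset d (mset_set UNIV)"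
    by (simp add: multiset.map_comp comp_def)
  also have "mset_set (UNIV :: 'n set) = image_mset e (mset_set {..<CARD('n)})"
    using enumerates_decreasingly_bij[OF e] by (metis bij_betw_def image_mset_mset_set)
  also have "image_mset d \<dots> = mset ?l"
    by (simp add: multiset.map_comp comp_def atLeast0LessThan[symmetric] mset_set_upto_eq_mset_upto
      flip: lessThan_atLeast0 mset_upt)
  finally have M: "image_mset Re (proots (charpoly (ud U d))) = mset (rev ?l)" by simp
  have "eigenvalue_list (ud U d) = rev (sort (rev ?l))"
    unfolding eigenvalue_list_def M sorted_list_of_multiset_mset by (rule refl)
  moreover have "sorted (rev ?l)"
    unfolding sorted_rev_iff_nth_mono using enumerates_decreasingly_le[OF e] by auto
  ultimately have "eigenvalue_list (ud U d) = ?l" by (simp add: sorted_sort_id)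
  moreover have "k - 1 < CARD('n)" using k by linarith
  ultimately show ?thesis by (simp add: eigenvalue_def)
qed

subsection \<open>Unitarily invariant norms\<close>

text \<open>The partial sums of h = ln b - ln a are nonnegative and the weights g * a decrease, so
  the weighted sum of h is nonnegative; ln x \<le> x - 1 then replaces a * h by b - a.\<close>

lemma weighted_log_majorization:
  fixes a b g :: "nat \<Rightarrow> real"
  assumes a: "\<And>i. i < n \<Longrightarrow> 0 < a i" and b: "\<And>i. i < n \<Longrightarrow> 0 < b i"
    and g: "\<And>i. i < n \<Longrightarrow> 0 \<le> g i" and dec: "\<And>i j. i \<le> j \<Longrightarrow> j < n \<Longrightarrow> g j \<le> g i" "\<And>i j. i \<le> j \<Longrightarrow> j < n \<Longrightarrow> a j \<le> a i"
    and le: "\<And>k. k \<le> n \<Longrightarrow> (\<Prod>i<k. a i) \<le> (\<Prod>i<k. b i)"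
  shows "(\<Sum>i<n. g i * a i) \<le> (\<Sum>i<n. g i * b i)"
proof -
  define h where "h i = ln (b i) - ln (a i)" for i
  define s where "s k = (\<Sum>i<k. h i)" for k
  have s: "0 \<le> s k" if "k \<le> n" for k
  proof -
    have nz: "a i \<noteq> 0" "b i \<noteq> 0" if "i < k" for i using a[of i] b[of i] that \<open>k \<le> n\<close> by auto
    have "ln (\<Prod>i<k. b i) = (\<Sum>i<k. ln (b i))" by (rule ln_prod) (simp_all add: nz)
    moreover have "ln (\<Prod>i<k. a i) = (\<Sum>i<k. ln (a i))" by (rule ln_prod) (simp_all add: nz)
    ultimately have "s k = ln (\<Prod>i<k. b i) - ln (\<Prod>i<k. a i)"
      by (simp add: s_def h_def sum_subtractf)
    moreover have "0 < (\<Prod>i<k. a i)" using a that by (intro prod_pos) auto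
    ultimately show ?thesis using le[OF that] by simp
  qed
  text \<open>Abel summation with the nonnegative decreasing weights \<open>g i * a i\<close>.\<close>
  have abel: "w (k - 1) * s k \<le> (\<Sum>i<k. w i * h i)"
    if "k \<le> n" "\<And>i. i < n \<Longrightarrow> 0 \<le> w i" "\<And>i j. i \<le> j \<Longrightarrow> j < n \<Longrightarrow> w j \<le> w i" for k and w :: "nat \<Rightarrow> real"
    using that(1)
  proof (induction k)
    case 0
    then show ?case by (simp add: s_def)
  next
    case (Suc k)
    have "w k * s k \<le> w (k - 1) * s k"
      using that Suc.prems s[of k] by (intro mult_right_mono that(3)) auto
    with Suc show ?case by (simp add: s_def algebra_simps)
  qed
  have "0 \<le> (\<Sum>i<n. (g i * a i) * h i)"
  proof (cases "n = 0")
    case False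
    have "0 \<le> (g (n - 1) * a (n - 1)) * s n" using False g a s by (intro mult_nonneg_nonneg) (auto simp: less_imp_le)
    also have "\<dots> \<le> (\<Sum>i<n. (g i * a i) * h i)"
    proof (rule abel)
      show "0 \<le> g i * a i" if "i < n" for i using g[OF that] a[OF that] by simp
      show "g j * a j \<le> g i * a i" if "i \<le> j" "j < n" for i j
        using that g[of j] g[of i] a[of j] dec by (intro mult_mono) (auto simp: less_imp_le)
    qed simp
    finally show ?thesis .
  qed simp
  also have "\<dots> \<le> (\<Sum>i<n. g i * (b i - a i))"
  proof (rule sum_mono)
    fix i assume "i \<in> {..<n}"
    then have i: "i < n" by simp
    have "h i \<le> b i / a i - 1"
      using ln_le_minus_one[of "b i / a i"] a[OF i] b[OF i] by (simp add: h_def ln_div)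
    then have "a i * h i \<le> b i - a i" using a[OF i] by (simp add: field_simps)
    then have "g i * (a i * h i) \<le> g i * (b i - a i)" using g[OF i] by (rule mult_left_mono)
    then show "g i * a i * h i \<le> g i * (b i - a i)" by (simp add: mult.assoc)
  qed
  finally show ?thesis by (simp add: right_diff_distrib sum_subtractf)
qed

lemma map_matrix_of_real: "map_matrix ((*) (complex_of_real c)) X = c *\<^sub>R X"
  by (simp add: vec_eq_iff map_matrix_def scaleR_conv_of_real[where 'a=complex])

lemma unitarily_invariant_norm_ud:
  assumes N: "unitarily_invariant_norm N" and U: "unitary U"
  shows "N (ud U d) = N (real_diag d)"
  unfolding ud_def using N U by (simp add: unitarily_invariant_norm_def unitary_ctranspose)

text \<open>The permutation acts by conjugation, the signs by a diagonal unitary on the left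
  only.\<close>

lemma unitarily_invariant_norm_signed_permutation:
  fixes N :: "complex^'n^'n \<Rightarrow> real"
  assumes N: "unitarily_invariant_norm N" and \<pi>: "bij \<pi>" and s: "\<And>i. \<bar>s i\<bar> = 1"
  shows "N (real_diag (\<lambda>i. s i * b (\<pi> i))) = N (real_diag b)"
proof -
  define P :: "complex^'n^'n" where "P = (\<chi> i j. if j = \<pi> i then 1 else 0)"
  define D :: "complex^'n^'n" where "D = real_diag s"
  have ss: "s i * s i = 1" for i using s[of i] by (metis abs_mult_self_eq mult_1)
  have inj: "\<pi> i = \<pi> j \<longleftrightarrow> i = j" for i j using \<pi> by (metis bij_pointE)
  have D: "unitary D"
    by (rule unitaryI) (simp add: D_def real_diag_mult ss real_diag_const)
  have "ctranspose (ctranspose P) ** ctranspose P = mat 1"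
    by (simp add: vec_eq_iff matrix_matrix_mult_def P_def mat_def if_distrib[where f="\<lambda>x. x * _"] inj cong: if_cong)
  then have "unitary (ctranspose P)" by (rule unitaryI)
  then have P: "unitary P" by (simp add: unitary_ctranspose)
  have Pb: "(P ** real_diag b) $ i $ j = (if j = \<pi> i then of_real (b j) else 0)" for i j
    by (simp add: real_diag_mult_right) (simp add: P_def)
  have "(P ** real_diag b ** ctranspose P) $ i $ j = (if i = j then of_real (b (\<pi> i)) else 0)" for i j
    unfolding matrix_matrix_mult_def[of "P ** real_diag b"]
    by (simp add: Pb if_distrib[where f="\<lambda>x. x * _"] cong: if_cong) (simp add: P_def inj)
  then have "P ** real_diag b ** ctranspose P = real_diag (b \<circ> \<pi>)"
    by (simp add: vec_eq_iff real_diag_nth)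
  then have "real_diag (\<lambda>i. s i * b (\<pi> i)) = (D ** P) ** real_diag b ** ctranspose P"
    by (simp add: D_def real_diag_mult comp_def flip: matrix_mul_assoc)
  then show ?thesis
    using N D P unitary_mult[OF D P] by (simp add: unitarily_invariant_norm_def unitary_ctranspose)
qed

text \<open>By separation, \<open>a\<close> lies in the convex hull of the signed permutations of \<open>b\<close>.\<close>

lemma unitarily_invariant_norm_mono:
  fixes N :: "complex^'n^'n \<Rightarrow> real" and a b :: "'n \<Rightarrow> real"
  assumes N: "unitarily_invariant_norm N" and a: "\<And>i. 0 < a i" and b: "\<And>i. 0 < b i"
    and ea: "enumerates_decreasingly ea a" and eb: "enumerates_decreasingly eb b"
    and le: "\<And>k. k \<le> CARD('n) \<Longrightarrow> (\<Prod>i<k. a (ea i)) \<le> (\<Prod>i<k. b (eb i))"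
  shows "N (real_diag a) \<le> N (real_diag b)"
proof -
  let ?n = "CARD('n)"
  define V where "V = {\<chi> i. s i * b (\<pi> i) | s \<pi>. bij \<pi> \<and> (\<forall>i::'n. s i \<in> {-1, 1 :: real})}"
  have "V \<subseteq> (\<lambda>(s, \<pi>). \<chi> i. s i * b (\<pi> i)) ` ((UNIV \<rightarrow>\<^sub>E {-1, 1}) \<times> UNIV)"
    by (auto simp: V_def PiE_def image_iff)
  then have finV: "finite V" by (rule finite_subset) (intro finite_imageI finite_cartesian_product finite_PiE, auto)
  have vl: "($) (vec_lambda f) = f" for f :: "'n \<Rightarrow> real" by (rule ext) simp
  have "(\<chi> i. a i) \<in> convex hull V"
  proof (rule ccontr)
    assume "(\<chi> i. a i) \<notin> convex hull V"
    moreover have "closed (convex hull V)"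
      using finite_imp_compact_convex_hull[OF finV] by (rule compact_imp_closed)
    ultimately obtain w \<beta> where w: "w \<bullet> (\<chi> i. a i) < \<beta>" "\<forall>x\<in>convex hull V. \<beta> < w \<bullet> x"
      using separating_hyperplane_closed_point[OF convex_convex_hull] by blast
    obtain ew where ew': "enumerates_decreasingly ew (\<lambda>i. \<bar>w $ i\<bar>)"
      using enumerates_decreasingly_exists by blast
    have ew: "bij_betw ew {..<?n} UNIV" "\<And>i j. i \<le> j \<Longrightarrow> j < ?n \<Longrightarrow> \<bar>w $ ew j\<bar> \<le> \<bar>w $ ew i\<bar>"
      using enumerates_decreasingly_bij[OF ew'] enumerates_decreasingly_le[OF ew'] by auto
    define g where "g i = \<bar>w $ ew i\<bar>" for i
    \<comment> \<open>Signs opposite to w make every term of the inner product nonpositive; with eb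
      \<circ> iw, which pairs the largest values of b with the largest weights, this is the vertex
      of V that contradicts the separation.\<close>
    define s where "s i = (if w $ i < 0 then 1 else - 1 :: real)" for i
    define iw where "iw = the_inv_into {..<?n} ew"
    have iw: "iw (ew i) = i" if "i < ?n" for i
      using ew(1) that by (simp add: iw_def bij_betw_def the_inv_into_f_f)
    have "bij_betw iw UNIV {..<?n}" unfolding iw_def using ew(1) by (rule bij_betw_the_inv_into)
    from bij_betw_trans[OF this enumerates_decreasingly_bij[OF eb]] have bij: "bij (eb \<circ> iw)" .
    have sumw: "(\<Sum>i\<in>UNIV. f i) = (\<Sum>i<?n. f (ew i))" for f :: "'n \<Rightarrow> real"
      using sum.reindex_bij_betw[OF ew(1), of f] by simp
    have sw: "w $ i * (s i * c) = - (\<bar>w $ i\<bar> * c)" for i c by (simp add: s_def)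
    have "(\<chi> i. s i * b ((eb \<circ> iw) i)) \<in> V"
      unfolding V_def using bij by (auto simp: s_def intro!: exI[of _ s] exI[of _ "eb \<circ> iw"])
    then have "w \<bullet> (\<chi> i. a i) < w \<bullet> (\<chi> i. s i * b ((eb \<circ> iw) i))"
      using w hull_inc by (metis less_trans)
    also have "w \<bullet> (\<chi> i. s i * b ((eb \<circ> iw) i)) = - (\<Sum>i<?n. g i * b (eb i))"
      by (simp add: inner_vec_def sw sumw sum_negf g_def iw)
    finally have "(\<Sum>i<?n. g i * b (eb i)) < - (w \<bullet> (\<chi> i. a i))" by simp
    also have "- (w \<bullet> (\<chi> i. a i)) \<le> (\<Sum>i<?n. g i * a (ew i))"
    proof -
      have "- (w $ i * a i) \<le> \<bar>w $ i\<bar> * a i" for i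
        using a[of i] mult_right_mono[of "- (w $ i)" "\<bar>w $ i\<bar>" "a i"] by simp
      then have "(\<Sum>i\<in>UNIV. - (w $ i * a i)) \<le> (\<Sum>i\<in>UNIV. \<bar>w $ i\<bar> * a i)" by (intro sum_mono)
      then show ?thesis by (simp add: inner_vec_def sum_negf sumw[of "\<lambda>i. \<bar>w $ i\<bar> * a i"] g_def)
    qed
    \<comment> \<open>Rearrangement: pairing decreasing weights with the decreasing order of a can
      only increase the sum, again by Abel summation.\<close>
    also have "\<dots> \<le> (\<Sum>i<?n. g i * a (ea i))"
    proof -
      have gd: "g j \<le> g i" if "i \<le> j" "j < ?n" for i j using ew(2)[OF that] by (simp add: g_def)
      have part: "(\<Sum>i<k. a (ew i)) \<le> (\<Sum>i<k. a (ea i))" if "k \<le> ?n" for k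
      proof -
        have inj: "inj_on ew {..<k}" using ew' that by (rule enumerates_decreasingly_inj_on)
        have "(\<Sum>i<k. a (ew i)) = (\<Sum>i\<in>ew ` {..<k}. a i)" using inj by (simp add: sum.reindex)
        also have "\<dots> \<le> (\<Sum>i<k. a (ea i))"
          using inj by (intro sum_subset_le_top[OF ea]) (auto simp: card_image)
        finally show ?thesis .
      qed
      have "g (k - 1) * (\<Sum>i<k. a (ea i) - a (ew i)) \<le> (\<Sum>i<k. g i * (a (ea i) - a (ew i)))" if "k \<le> ?n" for k
        using that
      proof (induction k)
        case (Suc k)
        have "g k * (\<Sum>i<k. a (ea i) - a (ew i)) \<le> g (k - 1) * (\<Sum>i<k. a (ea i) - a (ew i))"
          using part[of k] Suc.prems by (intro mult_right_mono gd) (auto simp: sum_subtractf)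
        with Suc show ?case by (simp add: algebra_simps)
      qed simp
      note this[of ?n, OF order_refl]
      moreover have "0 \<le> g (?n - 1) * (\<Sum>i<?n. a (ea i) - a (ew i))"
        using part[of ?n] by (intro mult_nonneg_nonneg) (auto simp: g_def sum_subtractf)
      ultimately have "0 \<le> (\<Sum>i<?n. g i * (a (ea i) - a (ew i)))" by linarith
      then show ?thesis by (simp add: right_diff_distrib sum_subtractf)
    qed
    also have "\<dots> \<le> (\<Sum>i<?n. g i * b (eb i))"
      using a b enumerates_decreasingly_le[OF ea] ew(2) le by (intro weighted_log_majorization) (auto simp: g_def)
    finally show False by simp
  qed
  \<comment> \<open>A sublevel set of a norm is convex and contains V by invariance, hence contains
    the convex hull of V.\<close>
  moreover have "convex {x :: real^'n. N (real_diag (\<lambda>i. x $ i)) \<le> N (real_diag b)}"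
    unfolding convex_def
  proof (intro ballI allI impI CollectI)
    fix x y :: "real^'n" and u v :: real
    assume x: "x \<in> {x. N (real_diag (\<lambda>i. x $ i)) \<le> N (real_diag b)}"
      and y: "y \<in> {x. N (real_diag (\<lambda>i. x $ i)) \<le> N (real_diag b)}" and uv: "0 \<le> u" "0 \<le> v" "u + v = 1"
    have sc: "N (c *\<^sub>R X) = \<bar>c\<bar> * N X" for c X
      using N unfolding unitarily_invariant_norm_def by (metis map_matrix_of_real norm_of_real)
    have "real_diag (\<lambda>i. (u *\<^sub>R x + v *\<^sub>R y) $ i) = u *\<^sub>R real_diag (\<lambda>i. x $ i) + v *\<^sub>R real_diag (\<lambda>i. y $ i)"
      by (simp add: vec_eq_iff real_diag_nth scaleR_conv_of_real[where 'a=complex])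
    then have "N (real_diag (\<lambda>i. (u *\<^sub>R x + v *\<^sub>R y) $ i)) \<le> u * N (real_diag (\<lambda>i. x $ i)) + v * N (real_diag (\<lambda>i. y $ i))"
      using N uv sc unfolding unitarily_invariant_norm_def by (metis abs_of_nonneg)
    also have "\<dots> \<le> u * N (real_diag b) + v * N (real_diag b)"
      using x y uv by (intro add_mono mult_left_mono) auto
    also have "\<dots> = N (real_diag b)" using uv by (metis distrib_right mult_1)
    finally show "N (real_diag (\<lambda>i. (u *\<^sub>R x + v *\<^sub>R y) $ i)) \<le> N (real_diag b)" .
  qed
  moreover have "V \<subseteq> {x. N (real_diag (\<lambda>i. x $ i)) \<le> N (real_diag b)}"
  proof
    fix x assume "x \<in> V"
    then obtain s \<pi> where "x = (\<chi> i. s i * b (\<pi> i))" "bij \<pi>" "\<forall>i. s i \<in> {-1, 1}" by (auto simp: V_def)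
    moreover from this(3) have "\<bar>s i\<bar> = 1" for i by (metis abs_1 abs_minus_cancel insertE singletonD)
    ultimately show "x \<in> {x. N (real_diag (\<lambda>i. x $ i)) \<le> N (real_diag b)}"
      using unitarily_invariant_norm_signed_permutation[OF N, of \<pi> s b] by (simp add: vl)
  qed
  ultimately have "(\<chi> i. a i) \<in> {x. N (real_diag (\<lambda>i. x $ i)) \<le> N (real_diag b)}"
    using hull_minimal by blast
  then show ?thesis by (simp add: vl)
qed

subsection \<open>Log-majorization\<close>

text \<open>The trace of the Karcher equation: log det is additive under congruence, so log det of
  the barycenter is the mean of log det. This gives the equality of determinants.\<close>

lemma karcher_trace_ln:
  assumes \<mu>: "\<mu> \<in> prob1" and X: "karcher \<mu> X"
  shows "Re (trace (mat_ln X)) = (\<integral>A. Re (trace (mat_ln A)) \<partial>\<mu>)"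
proof -
  interpret prob_space \<mu> using \<mu> by (rule prob1_prob_space)
  have Xp: "X \<in> posdef" using X by (simp add: karcher_def)
  have bl: "bounded_linear (\<lambda>M :: complex^'a^'a. Re (trace M))"
    unfolding linear_conv_bounded_linear[symmetric]
    by (rule linearI) (simp_all add: trace_def sum.distrib sum_distrib_left)
  let ?c = "\<lambda>A. whiten X A"
  have "0 = (\<integral>A. Re (trace (mat_ln (?c A))) \<partial>\<mu>)"
    using integral_bounded_linear[OF bl prob1_integrable_mat_ln_normalized[OF \<mu> Xp, of "-1/2"]] X
    by (simp add: karcher_def trace_def)
  also have "\<dots> = (\<integral>A. Re (trace (mat_ln A)) - Re (trace (mat_ln X)) \<partial>\<mu>)"
  proof (rule Bochner_Integration.integral_cong[OF refl])
    fix A assume "A \<in> space \<mu>"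
    then have A: "A \<in> posdef" by (simp add: prob1_space[OF \<mu>])
    have "trace (c *\<^sub>R M) = c *\<^sub>R trace M" for c and M :: "complex^'a^'a"
      by (simp add: trace_def scaleR_right.sum)
    moreover have "trace (- M) = - trace M" for M :: "complex^'a^'a"
      by (simp add: trace_def sum_negf)
    ultimately have "2 * Re (trace (mat_ln (mat_powr X (-1/2)))) = - Re (trace (mat_ln X))"
      using Xp by (simp add: mat_ln_powr)
    then show "Re (trace (mat_ln (?c A))) = Re (trace (mat_ln A)) - Re (trace (mat_ln X))"
      using trace_mat_ln_congruence[OF A, of "mat_powr X (-1/2)"] Xp by simp
  qed
  also have "\<dots> = (\<integral>A. Re (trace (mat_ln A)) \<partial>\<mu>) - Re (trace (mat_ln X))"
    using integrable_bounded_linear[OF bl prob1_integrable_mat_ln[OF \<mu>]] by (simp add: prob_space)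
  finally show ?thesis by simp
qed

lemma det_cartan_barycenter_powr:
  assumes \<mu>: "\<mu> \<in> prob1"
  shows "det (cartan_barycenter (measure_powr \<mu> t)) = det (mat_powr (cartan_barycenter \<mu>) t)"
proof -
  let ?X = "cartan_barycenter \<mu>" and ?Z = "cartan_barycenter (measure_powr \<mu> t)"
  have KX: "karcher \<mu> ?X" and KZ: "karcher (measure_powr \<mu> t) ?Z"
    using \<mu> measure_powr_prob1 karcher_cartan_barycenter by blast+
  have p: "?X \<in> posdef" "?Z \<in> posdef" using KX KZ by (simp_all add: karcher_def)
  have tr: "Re (trace (c *\<^sub>R M)) = c * Re (trace M)" for c and M :: "complex^'a^'a"
    by (simp add: trace_def sum_distrib_left)
  have cont: "continuous_on posdef (\<lambda>A :: complex^'a^'a. Re (trace (mat_ln A)))"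
    unfolding trace_def by (intro continuous_intros continuous_on_mat_ln)
  have "Re (trace (mat_ln ?Z)) = (\<integral>A. Re (trace (mat_ln (mat_powr A t))) \<partial>\<mu>)"
    unfolding karcher_trace_ln[OF measure_powr_prob1[OF \<mu>] KZ] by (rule integral_measure_powr[OF \<mu> cont])
  also have "\<dots> = (\<integral>A. t * Re (trace (mat_ln A)) \<partial>\<mu>)"
    by (rule Bochner_Integration.integral_cong) (auto simp: prob1_space[OF \<mu>] mat_ln_powr tr)
  also have "\<dots> = Re (trace (mat_ln (mat_powr ?X t)))"
    using p by (simp add: karcher_trace_ln[OF \<mu> KX, symmetric] mat_ln_powr tr)
  finally show ?thesis using p by (simp add: det_eq_exp_trace_ln)
qed

theorem theorem4p4:
  fixes \<mu> :: "(complex^'n^'n) measure" and t :: real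
  assumes "\<mu> \<in> prob1" and "t \<ge> 1"
  shows "log_majorized (cartan_barycenter (measure_powr \<mu> t)) (mat_powr (cartan_barycenter \<mu>) t) \<and>
    (\<forall>N. unitarily_invariant_norm N \<longrightarrow>
      N (cartan_barycenter (measure_powr \<mu> t)) \<le> N (mat_powr (cartan_barycenter \<mu>) t))"
proof -
  let ?X = "cartan_barycenter \<mu>" and ?Z = "cartan_barycenter (measure_powr \<mu> t)" and ?n = "CARD('n)"
  note \<mu> = assms(1)
  have p: "?X \<in> posdef" "?Z \<in> posdef"
    using karcher_cartan_barycenter[OF \<mu>] karcher_cartan_barycenter[OF measure_powr_prob1[OF \<mu>]]
    by (simp_all add: karcher_def)
  obtain U x where U: "unitary U" "\<And>i. 0 < x i" "?X = ud U x" using p(1) by (elim posdef_decomp) blast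
  obtain V z where V: "unitary V" "\<And>i. 0 < z i" "?Z = ud V z" using p(2) by (elim posdef_decomp) blast
  obtain e where e: "enumerates_decreasingly e x" using enumerates_decreasingly_exists by blast
  obtain e' where e': "enumerates_decreasingly e' z" using enumerates_decreasingly_exists by blast
  define y where "y i = x i powr t" for i
  have y0: "0 < y i" for i using U(2)[of i] by (simp add: y_def)
  have Xt: "mat_powr ?X t = ud U y" using U by (simp add: y_def[abs_def] mat_powr_ud)
  have ey: "enumerates_decreasingly e y"
    using e by (rule enumerates_decreasingly_mono)
      (use U(2) assms(2) in \<open>auto simp: y_def less_imp_le intro!: powr_mono2\<close>)
  have shift: "(\<Prod>i=1..k. f (i - 1)) = (\<Prod>i<k. f i)" for k and f :: "nat \<Rightarrow> real"
    by (rule prod.reindex_bij_witness[where i=Suc and j="\<lambda>i. i - 1"]) auto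
  have eig_Z: "(\<Prod>i=1..k. eigenvalue i ?Z) = (\<Prod>i<k. z (e' i))" if "k \<le> ?n" for k
  proof -
    have "(\<Prod>i=1..k. eigenvalue i ?Z) = (\<Prod>i=1..k. z (e' (i - 1)))"
      unfolding V(3) using that by (intro prod.cong refl eigenvalue_ud[OF V(1) e']) auto
    then show ?thesis using shift[of "\<lambda>i. z (e' i)" k] by simp
  qed
  have eig_X: "(\<Prod>i=1..k. eigenvalue i (mat_powr ?X t)) = (\<Prod>i<k. y (e i))" if "k \<le> ?n" for k
  proof -
    have "(\<Prod>i=1..k. eigenvalue i (mat_powr ?X t)) = (\<Prod>i=1..k. y (e (i - 1)))"
      unfolding Xt using that by (intro prod.cong refl eigenvalue_ud[OF U(1) ey]) auto
    then show ?thesis using shift[of "\<lambda>i. y (e i)" k] by simp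
  qed
  have le: "(\<Prod>i<k. z (e' i)) \<le> (\<Prod>i<k. y (e i))" if k: "k \<le> ?n" for k
  proof (cases "k = 0")
    case False
    let ?p = "\<Prod>i<k. x (e i)"
    have "?p > 0" using U by (simp add: prod_pos)
    moreover have "subset_prod_le ?X k ?p"
      unfolding subset_prod_le_def using U prod_subset_le_top[OF e] by blast
    ultimately have "subset_prod_le ?Z k (?p powr t)"
      using False k by (intro subset_prod_le_powr[OF \<mu> assms(2)]) auto
    then obtain V' z' where V': "unitary V'" "?Z = ud V' z'" "\<And>T. card T = k \<Longrightarrow> (\<Prod>i\<in>T. z' i) \<le> ?p powr t"
      unfolding subset_prod_le_def by blast
    obtain d where d: "enumerates_decreasingly d z'" using enumerates_decreasingly_exists by blast
    \<comment> \<open>The bound comes with its own diagonalization of \<open>?Z\<close>;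
      \<open>eigenvalue\<close> depends on the matrix only, which identifies the two decreasing
      lists.\<close>
    have "z (e' i) = z' (d i)" if "i < k" for i
      using eigenvalue_ud[OF V(1) e', of "Suc i"] eigenvalue_ud[OF V'(1) d, of "Suc i"] that k V(3) V'(2) by simp
    then have "(\<Prod>i<k. z (e' i)) = (\<Prod>i<k. z' (d i))" by (intro prod.cong) auto
    also have "\<dots> = (\<Prod>i\<in>d ` {..<k}. z' i)"
      using enumerates_decreasingly_inj_on[OF d k] by (simp add: prod.reindex)
    also have "\<dots> \<le> ?p powr t"
      using enumerates_decreasingly_inj_on[OF d k] by (intro V'(3)) (simp add: card_image)
    also have "?p powr t = (\<Prod>i<k. y (e i))" by (simp add: y_def prod_powr_distrib)
    finally show ?thesis .
  qed simp
  have "log_majorized ?Z (mat_powr ?X t)"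
    unfolding log_majorized_def
    using p le eig_X eig_Z det_cartan_barycenter_powr[OF \<mu>, of t] by auto
  moreover have "N ?Z \<le> N (mat_powr ?X t)" if N: "unitarily_invariant_norm N" for N
    unfolding Xt V(3) unitarily_invariant_norm_ud[OF N U(1)] unitarily_invariant_norm_ud[OF N V(1)]
    by (rule unitarily_invariant_norm_mono[OF N V(2) y0 e' ey le])
  ultimately show ?thesis by blast
qed

end
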